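(* Let $d\ge 2$, and suppose that $\mathbf r=(r_1,\dots,r_d)\in\mathbb N_0^d$ and $\rho,k,b\in\mathbb N_0$ satisfy $$1\le\Big\lceil\tfrac{3r_1-1}{2}\Big\rceil\le r_2\le 2r_1-1,\qquad 2^{d-2}r_2\le 2^{d-3}r_3\le\cdots\le r_d,\qquad 2r_d+1\le k,$$ $$\rho=k-b,\qquad 2r_1-r_2\le b\le r_2-r_1+1.$$ Then a $C^{r_1}$ conforming finite element space can be constructed with the local shape function space $\mathcal S_k^{\mathbf r,\rho}(\mathcal T_A(K))$.
   Context: Alfeld split. $K\subset\mathbb R^d$ is a $d$-dimensional simplex with vertices $V_0,\dots,V_d$, and $V_A$ (the split point) is an interior point of $K$, usually the barycenter. For $j\in\mathbb I_d:=\{0,1,\dots,d\}$, $K_j$ is the $d$-simplex whose vertices are $V_A$ and the $V_i$ with $i\ne j$. The Alfeld split of $K$ is $\mathcal T_A(K)=\{K_0,\dots,K_d\}$. A $t$-dimensional subsimplex of $K$ is the convex hull of $t+1$ of the vertices $V_0,\dots,V_d$. Local shape function space. $\mathcal P_k(K_j)$ is the space of $d$-variate polynomials of total degree at most $k$ on $K_j$, and $\nabla^n u$ is the collection of all $n$-th order partial derivatives of $u$. For a piecewise polynomial $u$, "$\nabla^n u$ is single-valued on $F$" means that the traces on $F$ of $\nabla^n(u|_{K_j})$ coincide for all cells $K_j$ containing $F$. The superspline space $\mathcal S_k^{\mathbf r,\rho}(\mathcal T_A(K))$ is the set of all $u\in C^{r_1}(K)$ such that: $u|_{K_j}\in\mathcal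 P_k(K_j)$ for each $j\in\mathbb I_d$; $\nabla^n u$ is single-valued on $F$ for each $t$-dimensional subsimplex $F$ of $K$ with $0\le t\le d-2$ and each $0\le n\le r_{d-t}$; and $\nabla^n u$ is single-valued at $V_A$ for $0\le n\le\rho$. Terminology (standard). A finite element on $K$ consists of $K$, a finite-dimensional shape function space on $K$, and a set of degrees of freedom, i.e. linear functionals that form a basis of the dual of the shape function space, each attached to a subsimplex of $K$ or to $K$ itself. Given a triangulation of a $d$-dimensional domain $\Omega$, the resulting finite element space consists of the functions on $\Omega$ whose restriction to each $d$-simplex $K$ of the triangulation lies in the local shape function space of $K$ and whose degrees of freedom attached to shared subsimplices are single-valued. It is $C^{r_1}$ conforming if it is contained in $C^{r_1}(\Omega)$. *)

theory Defs
  imports "HOL-Analysis.Analysis"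
begin

section \<open>Polynomials, partial derivatives, and smoothness on closed sets\<close>

text \<open>The multi-indices are the functions \<open>'n \<Rightarrow> nat\<close>; those with \<open>sum \<alpha> UNIV \<le> k\<close> form a finite set.\<close>

definition polys :: "nat \<Rightarrow> (real ^ 'n \<Rightarrow> real) set" where
  "polys k = {p. \<exists>c :: ('n \<Rightarrow> nat) \<Rightarrow> real.
      \<forall>x. p x = (\<Sum>\<alpha> | sum \<alpha> UNIV \<le> k. c \<alpha> * (\<Prod>i\<in>UNIV. (x $ i) ^ \<alpha> i))}"

definition partial_deriv :: "'n \<Rightarrow> (real ^ 'n \<Rightarrow> real) \<Rightarrow> real ^ 'n \<Rightarrow> real" where
  "partial_deriv i f x = deriv (\<lambda>t. f (x + t *\<^sub>R axis i 1)) 0"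

text \<open>\<open>\<nabla>\<^sup>n f\<close> is the family of all \<open>partial_derivs is f\<close> with \<open>length is = n\<close>.\<close>

definition partial_derivs :: "'n list \<Rightarrow> (real ^ 'n \<Rightarrow> real) \<Rightarrow> real ^ 'n \<Rightarrow> real" where
  "partial_derivs is f = foldr partial_deriv is f"

text \<open>
  \<open>C\<^sup>m(X)\<close> for a set \<open>X\<close> contained in the closure of its interior (a simplex, or a finite union
  of full-dimensional simplices): all partial derivatives up to order \<open>m\<close> exist in the interior
  and, as functions \<open>g is\<close>, extend continuously to \<open>X\<close>.
\<close>

definition C_upto :: "nat \<Rightarrow> (real ^ 'n) set \<Rightarrow> (real ^ 'n \<Rightarrow> real) \<Rightarrow> bool" where
  "C_upto m X u \<longleftrightarrow> (\<exists>g :: 'n list \<Rightarrow> real ^ 'n \<Rightarrow> real.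
      (\<forall>x\<in>X. g [] x = u x) \<and>
      (\<forall>is. length is \<le> m \<longrightarrow> continuous_on X (g is)) \<and>
      (\<forall>is i. \<forall>x\<in>interior X. length is < m \<longrightarrow>
         ((\<lambda>t. g is (x + t *\<^sub>R axis i 1)) has_real_derivative g (i # is) x) (at 0)))"


section \<open>Simplices and the Alfeld split\<close>

abbreviation full_simplex :: "(real ^ 'n) set \<Rightarrow> bool" where
  "full_simplex K \<equiv> int CARD('n) simplex K"

definition vertices :: "(real ^ 'n) set \<Rightarrow> (real ^ 'n) set" where
  "vertices K = {V. V extreme_point_of K}"

definition subsimplex :: "nat \<Rightarrow> (real ^ 'n) set \<Rightarrow> (real ^ 'n) set \<Rightarrow> bool" where
  "subsimplex t F K \<longleftrightarrow> (\<exists>C \<subseteq> vertices K. card C = t + 1 \<and> F = convex hull C)"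

definition subsimplices :: "(real ^ 'n) set \<Rightarrow> (real ^ 'n) set set" where
  "subsimplices K = {F. \<exists>t. subsimplex t F K}"

text \<open>Throughout, \<open>A\<close> is the split point \<open>V\<^sub>A\<close> of \<open>K\<close>.\<close>

definition alfeld_split :: "real ^ 'n \<Rightarrow> (real ^ 'n) set \<Rightarrow> (real ^ 'n) set set" where
  "alfeld_split A K = (\<lambda>V. convex hull (insert A (vertices K - {V}))) ` vertices K"


section \<open>The superspline space\<close>

text \<open>
  \<open>u|\<^sub>T\<close> as a polynomial on all of \<open>\<real>\<^sup>d\<close>, when \<open>u|\<^sub>T \<in> P\<^sub>k(T)\<close>; it is unique because
  \<open>T\<close> has nonempty interior. The trace of \<open>\<nabla>\<^sup>n (u|\<^sub>T)\<close> on a subset of \<open>T\<close> is read off from it.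
\<close>

definition cell_poly :: "nat \<Rightarrow> (real ^ 'n) set \<Rightarrow> (real ^ 'n \<Rightarrow> real) \<Rightarrow> real ^ 'n \<Rightarrow> real" where
  "cell_poly k T u = (THE p. p \<in> polys k \<and> (\<forall>x\<in>T. p x = u x))"

definition same_trace ::
  "nat \<Rightarrow> nat \<Rightarrow> (real ^ 'n) set \<Rightarrow> (real ^ 'n) set \<Rightarrow> (real ^ 'n \<Rightarrow> real)
    \<Rightarrow> (real ^ 'n) set \<Rightarrow> (real ^ 'n \<Rightarrow> real) \<Rightarrow> bool" where
  "same_trace k n F T u T' u' \<longleftrightarrow> (\<forall>is. length is = n \<longrightarrow>
      (\<forall>x\<in>F. partial_derivs is (cell_poly k T u) x = partial_derivs is (cell_poly k T' u') x))"

definition single_valued ::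
  "nat \<Rightarrow> real ^ 'n \<Rightarrow> (real ^ 'n) set \<Rightarrow> (real ^ 'n \<Rightarrow> real) \<Rightarrow> nat \<Rightarrow> (real ^ 'n) set \<Rightarrow> bool" where
  "single_valued k A K u n F \<longleftrightarrow>
      (\<forall>T\<in>alfeld_split A K. \<forall>T'\<in>alfeld_split A K. F \<subseteq> T \<and> F \<subseteq> T' \<longrightarrow> same_trace k n F T u T' u)"

text \<open>
  A function on \<open>K\<close> is represented by its extension by zero to \<open>\<real>\<^sup>d\<close>, so that distinct elements
  of the space are distinct as functions on \<open>K\<close>. Only \<open>r 1, \<dots>, r d\<close> are used.
\<close>

definition superspline ::
  "nat \<Rightarrow> (nat \<Rightarrow> nat) \<Rightarrow> nat \<Rightarrow> real ^ 'n \<Rightarrow> (real ^ 'n) set \<Rightarrow> (real ^ 'n \<Rightarrow> real) set" where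
  "superspline k r \<rho> A K = {u :: real ^ 'n \<Rightarrow> real.
      (\<forall>x. x \<notin> K \<longrightarrow> u x = 0) \<and>
      C_upto (r 1) K u \<and>
      (\<forall>T\<in>alfeld_split A K. \<exists>p\<in>polys k. \<forall>x\<in>T. p x = u x) \<and>
      (\<forall>t F n. t + 2 \<le> CARD('n) \<and> subsimplex t F K \<and> n \<le> r (CARD('n) - t)
         \<longrightarrow> single_valued k A K u n F) \<and>
      (\<forall>n\<le>\<rho>. single_valued k A K u n {A})}"


section \<open>Finite elements\<close>

definition linear_functional_on :: "('a \<Rightarrow> real) set \<Rightarrow> (('a \<Rightarrow> real) \<Rightarrow> real) \<Rightarrow> bool" where
  "linear_functional_on S \<phi> \<longleftrightarrow>
      (\<forall>u\<in>S. \<forall>v\<in>S. \<phi> (\<lambda>x. u x + v x) = \<phi> u + \<phi> v) \<and>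
      (\<forall>c. \<forall>u\<in>S. \<phi> (\<lambda>x. c * u x) = c * \<phi> u)"

text \<open>
  The family \<open>\<phi> i\<close>, \<open>i \<in> I\<close>, is a basis of the dual of \<open>S\<close>. A finite basis of the dual
  forces \<open>S\<close> itself to be finite-dimensional.
\<close>

definition dual_basis :: "('a \<Rightarrow> real) set \<Rightarrow> 'i set \<Rightarrow> ('i \<Rightarrow> ('a \<Rightarrow> real) \<Rightarrow> real) \<Rightarrow> bool" where
  "dual_basis S I \<phi> \<longleftrightarrow>
      finite I \<and>
      (\<forall>i\<in>I. linear_functional_on S (\<phi> i)) \<and>
      (\<forall>c. (\<forall>u\<in>S. (\<Sum>i\<in>I. c i * \<phi> i u) = 0) \<longrightarrow> (\<forall>i\<in>I. c i = 0)) \<and>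
      (\<forall>\<psi>. linear_functional_on S \<psi> \<longrightarrow> (\<exists>c. \<forall>u\<in>S. \<psi> u = (\<Sum>i\<in>I. c i * \<phi> i u)))"

text \<open>
  Degrees of freedom are given simultaneously for all simplices: \<open>N F\<close> of them are attached to a
  subsimplex \<open>F\<close>, and \<open>dof K F i\<close> with \<open>i < N F\<close> is the \<open>i\<close>-th one, acting on the shape functions
  of \<open>K\<close>. The number \<open>N F\<close> depends only on \<open>F\<close>, so that the degrees of freedom on a subsimplex
  shared by \<open>K\<close> and \<open>K'\<close> can be matched one by one.
\<close>

type_synonym 'n dofs =
  "(real ^ 'n) set \<Rightarrow> (real ^ 'n) set \<Rightarrow> nat \<Rightarrow> (real ^ 'n \<Rightarrow> real) \<Rightarrow> real"

definition dof_indices :: "((real ^ 'n) set \<Rightarrow> nat) \<Rightarrow> (real ^ 'n) set \<Rightarrow> ((real ^ 'n) set \<times> nat) set" where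
  "dof_indices N K = (SIGMA F : subsimplices K. {..<N F})"

definition unisolvent_dofs ::
  "((real ^ 'n) set \<Rightarrow> (real ^ 'n \<Rightarrow> real) set) \<Rightarrow> ((real ^ 'n) set \<Rightarrow> nat) \<Rightarrow> 'n dofs \<Rightarrow> bool" where
  "unisolvent_dofs S N dof \<longleftrightarrow>
      (\<forall>K. full_simplex K \<longrightarrow> dual_basis (S K) (dof_indices N K) (\<lambda>(F, i). dof K F i))"

text \<open>
  What it means that the degrees of freedom are attached to their subsimplices: on a proper
  subsimplex \<open>F\<close> of dimension \<open>t\<close>, \<open>dof _ F i\<close> is one and the same functional of the traces on \<open>F\<close> of
  the derivatives of order at most \<open>r\<^sub>d\<^sub>-\<^sub>t\<close> (the ones that are single-valued on \<open>F\<close> for every shape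
  function), for all simplices having \<open>F\<close> as a subsimplex. Degrees of freedom attached to
  \<open>K\<close> itself are unrestricted.
\<close>

definition attached_dofs ::
  "nat \<Rightarrow> (nat \<Rightarrow> nat) \<Rightarrow> ((real ^ 'n) set \<Rightarrow> real ^ 'n) \<Rightarrow> ((real ^ 'n) set \<Rightarrow> (real ^ 'n \<Rightarrow> real) set)
    \<Rightarrow> ((real ^ 'n) set \<Rightarrow> nat) \<Rightarrow> 'n dofs \<Rightarrow> bool" where
  "attached_dofs k r A S N dof \<longleftrightarrow>
      (\<forall>K K' F t. \<forall>i<N F. \<forall>u\<in>S K. \<forall>u'\<in>S K'.
         full_simplex K \<and> full_simplex K' \<and> t < CARD('n) \<and> subsimplex t F K \<and> subsimplex t F K' \<and>
         (\<forall>n \<le> r (CARD('n) - t). \<forall>T\<in>alfeld_split (A K) K. \<forall>T'\<in>alfeld_split (A K') K'.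
            F \<subseteq> T \<and> F \<subseteq> T' \<longrightarrow> same_trace k n F T u T' u')
         \<longrightarrow> dof K F i u = dof K' F i u')"

text \<open>
  A function on the triangulated domain is represented by the family \<open>v\<close> of its restrictions
  \<open>v K\<close> to the simplices of the triangulation. Nothing is assumed about these pieces agreeing
  on common faces, so even continuity has to come from the degrees of freedom.
\<close>

definition fe_space ::
  "((real ^ 'n) set \<Rightarrow> (real ^ 'n \<Rightarrow> real) set) \<Rightarrow> ((real ^ 'n) set \<Rightarrow> nat) \<Rightarrow> 'n dofs
    \<Rightarrow> (real ^ 'n) set set \<Rightarrow> ((real ^ 'n) set \<Rightarrow> real ^ 'n \<Rightarrow> real) set" where
  "fe_space S N dof \<T> = {v.
      (\<forall>K\<in>\<T>. v K \<in> S K) \<and>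
      (\<forall>K\<in>\<T>. \<forall>K'\<in>\<T>. \<forall>F \<in> subsimplices K \<inter> subsimplices K'. \<forall>i<N F.
         dof K F i (v K) = dof K' F i (v K'))}"

definition conforming ::
  "nat \<Rightarrow> (real ^ 'n) set set \<Rightarrow> ((real ^ 'n) set \<Rightarrow> real ^ 'n \<Rightarrow> real) set \<Rightarrow> bool" where
  "conforming m \<T> X \<longleftrightarrow>
      (\<forall>v\<in>X. \<exists>u. C_upto m (\<Union>\<T>) u \<and> (\<forall>K\<in>\<T>. \<forall>x\<in>K. u x = v K x))"

end

theory Submission
  imports Defs
begin

text \<open>
  All polynomials of degree \<open>k\<close> lie in the superspline space, so its traces on a proper subsimplex
  \<open>F\<close> are the jets of such polynomials along \<open>F\<close>, whatever simplex \<open>K\<close> contains \<open>F\<close>. Degrees of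
  freedom at \<open>F\<close> are derivative evaluations that are dual to the jets vanishing on the boundary of
  \<open>F\<close>. This gives conformity, and unisolvence reduces to extending each such jet to a shape function
  that has zero trace on all other subsimplices of at most the same dimension.

  In codimension at least two a truncated Bernstein expansion does this. For the facet opposite to
  the vertex \<open>0\<close>, let \<open>y\<^sub>j\<close> be the barycentric coordinates rescaled to be \<open>1\<close> at the split point.
  A monomial \<open>\<Prod>j. y\<^sub>j\<^bsup>\<alpha> j\<^esup>\<close> with \<open>m = \<alpha> 0 > 0\<close> is extended by the piecewise polynomial that equals
  \<open>\<integral> t\<^sup>\<gamma> (y\<^sub>0 - t)\<^bsup>m-1-\<gamma>\<^esup> (\<Prod>j\<ge>1. (y\<^sub>j - t)\<^bsup>\<alpha> j\<^esup>) dt\<close> over \<open>[0, y\<^sub>i]\<close> on the \<open>i\<close>-th cell, up to a positive factor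
  and terms of higher order in \<open>y\<^sub>0\<close>; the bounds on \<open>r\<^sub>2\<close> and \<open>b\<close> are what makes a suitable \<open>\<gamma>\<close> exist.
\<close>

section \<open>Subspaces of functions\<close>

text \<open>Facets are the obstacle. Truncation relies on \<open>2 * r i \<le> r (Suc i)\<close>,
  which fails between codimensions one and two because \<open>r 2 + 1 \<le> 2 * r 1\<close>: a
  monomial can be of low order on two facets without being of low order on their intersection. So a
  facet trace needs a genuinely piecewise extension. The integral supplies one, since its integrand
  is the same on all cells and only the upper limit changes. Let \<open>Z\<close> be the vertex
  opposite to the facet and \<open>m\<close> the exponent of \<open>Z\<close>. Four inequalities
  restrict \<gamma>: \<open>\<gamma> \<le> m - 1\<close> keeps the exponent of
  \<open>y Z x - t\<close> nonnegative, \<open>\<gamma> + 1 \<le> b\<close> gives order \<rho> at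
  the split point, \<open>\<gamma> + r 1 \<le> r 2\<close> gives smoothness across the interfaces,
  and \<open>m + r 1 \<le> Suc (\<gamma> + r 2)\<close> makes the pieces flat on the other facets.
  The last one asks for a large \<gamma>, the others for a small one. At the extreme
  \<open>m = r 1\<close> the least choice is \<open>2 * r 1 - 1 - r 2\<close>, and there the two
  middle inequalities become \<open>2 * r 1 - r 2 \<le> b\<close> and
  \<open>3 * r 1 - 1 \<le> 2 * r 2\<close>.\<close>

definition fun_subspace :: "('a \<Rightarrow> real) set \<Rightarrow> bool" where
  "fun_subspace S \<longleftrightarrow> (\<lambda>x. 0) \<in> S \<and> (\<forall>f\<in>S. \<forall>g\<in>S. (\<lambda>x. f x + g x) \<in> S)
     \<and> (\<forall>c. \<forall>f\<in>S. (\<lambda>x. c * f x) \<in> S)"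

lemma fun_subspace_zero: "fun_subspace S \<Longrightarrow> (\<lambda>x. 0) \<in> S"
  and fun_subspace_add: "fun_subspace S \<Longrightarrow> f \<in> S \<Longrightarrow> g \<in> S \<Longrightarrow> (\<lambda>x. f x + g x) \<in> S"
  and fun_subspace_scale: "fun_subspace S \<Longrightarrow> f \<in> S \<Longrightarrow> (\<lambda>x. c * f x) \<in> S"
  by (auto simp: fun_subspace_def)

lemma fun_subspace_diff:
  assumes "fun_subspace S" "f \<in> S" "g \<in> S"
  shows "(\<lambda>x. f x - g x) \<in> S"
  using fun_subspace_add[OF assms(1,2) fun_subspace_scale[OF assms(1,3), of "-1"]] by simp

lemma fun_subspace_sum:
  assumes "fun_subspace S" "\<And>i. i \<in> I \<Longrightarrow> f i \<in> S"
  shows "(\<lambda>x. \<Sum>i\<in>I. f i x) \<in> S"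
  using assms(2)
proof (induction I rule: infinite_finite_induct)
  case (insert i I)
  then show ?case using fun_subspace_add[OF assms(1), of "f i" "\<lambda>x. \<Sum>i\<in>I. f i x"] by simp
qed (use assms(1) in \<open>auto simp: fun_subspace_def\<close>)

text \<open>Evaluation at \<open>2 s\<close> minus \<open>2\<^sup>n\<close> times evaluation at \<open>s\<close> removes the top coefficient.\<close>

lemma fun_subspace_coeffs:
  fixes h :: "nat \<Rightarrow> 'a \<Rightarrow> real"
  assumes S: "fun_subspace S" and mem: "\<And>s. (\<lambda>x. \<Sum>j\<le>n. s ^ j * h j x) \<in> S" and "j \<le> n"
  shows "h j \<in> S"
  using mem \<open>j \<le> n\<close>
proof (induction n arbitrary: h j)
  case 0
  have "(\<lambda>x. \<Sum>j\<le>0. 1 ^ j * h j x) \<in> S" by (rule 0)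
  with 0 show ?case by simp
next
  case (Suc n)
  define c :: "nat \<Rightarrow> real" where "c j = 2 ^ j - 2 ^ Suc n" for j
  have "(\<lambda>x. \<Sum>j\<le>n. s ^ j * (c j * h j x)) \<in> S" for s
  proof -
    have "(\<lambda>x. (\<Sum>j\<le>Suc n. (2 * s) ^ j * h j x) - 2 ^ Suc n * (\<Sum>j\<le>Suc n. s ^ j * h j x)) \<in> S"
      by (intro fun_subspace_diff[OF S] fun_subspace_scale[OF S] Suc.prems)
    moreover have "(\<Sum>j\<le>Suc n. (2 * s) ^ j * h j x) - 2 ^ Suc n * (\<Sum>j\<le>Suc n. s ^ j * h j x)
        = (\<Sum>j\<le>n. s ^ j * (c j * h j x))" for x
    proof -
      have "(\<Sum>j\<le>Suc n. (2 * s) ^ j * h j x) - 2 ^ Suc n * (\<Sum>j\<le>Suc n. s ^ j * h j x)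
        = (\<Sum>j\<le>Suc n. s ^ j * (c j * h j x))"
        unfolding sum_distrib_left sum_subtractf[symmetric]
        by (rule sum.cong) (auto simp: c_def power_mult_distrib algebra_simps)
      then show ?thesis by (simp add: c_def)
    qed
    ultimately show ?thesis by simp
  qed
  then have *: "(\<lambda>x. c j * h j x) \<in> S" if "j \<le> n" for j
    using Suc.IH[of "\<lambda>j x. c j * h j x", OF _ that] by simp
  have low: "h j \<in> S" if "j \<le> n" for j
  proof -
    have "(2::real) ^ j < 2 ^ Suc n" using that by (intro power_strict_increasing) auto
    then have "c j \<noteq> 0" by (simp add: c_def)
    then show ?thesis using fun_subspace_scale[OF S *[OF that], of "1 / c j"] by simp
  qed
  have "(\<lambda>x. (\<Sum>j\<le>Suc n. 1 ^ j * h j x) - (\<Sum>j\<le>n. h j x)) \<in> S"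
    by (intro fun_subspace_diff[OF S] fun_subspace_sum[OF S] Suc.prems low) auto
  then have "h (Suc n) \<in> S" by simp
  with low Suc.prems(2) show ?case by (cases "j = Suc n") auto
qed

text \<open>The integral of \<open>pderiv (H x)\<close> over [0, 1] is a fixed finite combination of
  its coefficients, and \<open>fun_subspace_coeffs\<close> places each coefficient in
  \<open>S\<close>. So membership of the integrand for every fixed \<open>s\<close> passes to the
  integral by algebra alone. With \<open>S\<close> a space of functions vanishing to some order,
  this bounds the order of an integral.\<close>

lemma fun_subspace_integral:
  fixes H :: "'a \<Rightarrow> real poly"
  assumes S: "fun_subspace S" and deg: "\<And>x. degree (H x) \<le> n"
    and mem: "\<And>s. (\<lambda>x. poly (pderiv (H x)) s) \<in> S"
  shows "(\<lambda>x. poly (H x) 1 - poly (H x) 0) \<in> S"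
proof -
  have sum_poly: "poly P s = (\<Sum>j\<le>n. s ^ j * coeff P j)" if "degree P \<le> n" for P and s :: real
  proof -
    have "poly P s = (\<Sum>j\<le>degree P. s ^ j * coeff P j)" by (simp add: poly_altdef mult.commute)
    also have "\<dots> = (\<Sum>j\<le>n. s ^ j * coeff P j)"
      by (rule sum.mono_neutral_left) (use that in \<open>auto simp: coeff_eq_0\<close>)
    finally show ?thesis .
  qed
  have "degree (pderiv (H x)) \<le> n" for x
    using deg[of x] by (simp add: degree_pderiv)
  then have "(\<lambda>x. \<Sum>j\<le>n. s ^ j * coeff (pderiv (H x)) j) \<in> S" for s
    using mem[of s] by (simp add: sum_poly)
  then have "(\<lambda>x. coeff (pderiv (H x)) j) \<in> S" if "j \<le> n" for j
    using fun_subspace_coeffs[OF S, where n = n and h = "\<lambda>j x. coeff (pderiv (H x)) j", OF _ that] by simp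
  then have **: "(\<lambda>x. real (Suc j) * coeff (H x) (Suc j)) \<in> S" if "j \<le> n" for j
    using that by (simp add: coeff_pderiv)
  have "(\<lambda>x. coeff (H x) (Suc j)) \<in> S" if "j < n" for j
    using that fun_subspace_scale[OF S **, of j "1 / real (Suc j)"]
    by (simp del: of_nat_Suc)
  then have "(\<lambda>x. \<Sum>j<n. coeff (H x) (Suc j)) \<in> S"
    by (intro fun_subspace_sum[OF S]) auto
  moreover have "poly (H x) 1 - poly (H x) 0 = (\<Sum>j<n. coeff (H x) (Suc j))" for x
    by (simp add: sum_poly[OF deg, of x 1] poly_0_coeff_0 lessThan_Suc_atMost[symmetric] sum.lessThan_Suc_shift del: sum.lessThan_Suc)
  ultimately show ?thesis by simp
qed

section \<open>Polynomials of bounded degree\<close>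

definition monomial_fun :: "('n::finite \<Rightarrow> nat) \<Rightarrow> real ^ 'n \<Rightarrow> real" where
  "monomial_fun \<alpha> x = (\<Prod>i\<in>UNIV. (x $ i) ^ \<alpha> i)"

lemma finite_multi_indices: "finite {\<alpha> :: 'n::finite \<Rightarrow> nat. sum \<alpha> UNIV \<le> k}"
proof (rule finite_subset)
  show "{\<alpha> :: 'n \<Rightarrow> nat. sum \<alpha> UNIV \<le> k} \<subseteq> Pi\<^sub>E UNIV (\<lambda>_. {..k})"
  proof
    fix \<alpha> :: "'n \<Rightarrow> nat" assume "\<alpha> \<in> {\<alpha>. sum \<alpha> UNIV \<le> k}"
    then have "\<alpha> i \<le> k" for i
      using member_le_sum[of i UNIV \<alpha>] by simp
    then show "\<alpha> \<in> Pi\<^sub>E UNIV (\<lambda>_. {..k})" by (simp add: PiE_def)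
  qed
  show "finite (Pi\<^sub>E (UNIV :: 'n set) (\<lambda>_. {..k}))" by (intro finite_PiE) simp_all
qed

lemma polys_iff:
  "p \<in> polys k \<longleftrightarrow> (\<exists>c. p = (\<lambda>x. \<Sum>\<alpha> | sum \<alpha> UNIV \<le> k. c \<alpha> * monomial_fun \<alpha> x))"
  by (auto simp: polys_def monomial_fun_def fun_eq_iff)

lemma fun_subspace_polys: "fun_subspace (polys k)"
  unfolding fun_subspace_def
proof (intro conjI ballI allI)
  show "(\<lambda>x. 0) \<in> polys k"
    by (auto simp: polys_def intro!: exI[of _ "\<lambda>_. 0"])
  fix f g :: "real ^ 'a \<Rightarrow> real" and a
  assume f: "f \<in> polys k"
  then obtain c where c: "f = (\<lambda>x. \<Sum>\<alpha> | sum \<alpha> UNIV \<le> k. c \<alpha> * monomial_fun \<alpha> x)"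
    by (auto simp: polys_iff)
  show "(\<lambda>x. a * f x) \<in> polys k"
    unfolding polys_iff
    by (auto simp: c sum_distrib_left intro!: exI[of _ "\<lambda>\<alpha>. a * c \<alpha>"] sum.cong)
  assume "g \<in> polys k"
  then obtain d where d: "g = (\<lambda>x. \<Sum>\<alpha> | sum \<alpha> UNIV \<le> k. d \<alpha> * monomial_fun \<alpha> x)"
    by (auto simp: polys_iff)
  show "(\<lambda>x. f x + g x) \<in> polys k"
    unfolding polys_iff
    by (auto simp: c d sum.distrib distrib_right intro!: exI[of _ "\<lambda>\<alpha>. c \<alpha> + d \<alpha>"])
qed

lemmas polys_zero = fun_subspace_zero[OF fun_subspace_polys]
  and polys_add = fun_subspace_add[OF fun_subspace_polys]
  and polys_scale = fun_subspace_scale[OF fun_subspace_polys]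
  and polys_diff = fun_subspace_diff[OF fun_subspace_polys]
  and polys_sum = fun_subspace_sum[OF fun_subspace_polys]

lemma monomial_fun_in_polys:
  assumes "sum \<alpha> UNIV \<le> k"
  shows "monomial_fun \<alpha> \<in> polys k"
proof -
  have "(\<Sum>\<beta> | sum \<beta> UNIV \<le> k. (if \<beta> = \<alpha> then 1 else 0) * monomial_fun \<beta> x) = monomial_fun \<alpha> x" for x
  proof -
    have "(\<Sum>\<beta> | sum \<beta> UNIV \<le> k. (if \<beta> = \<alpha> then 1 else 0) * monomial_fun \<beta> x)
      = (\<Sum>\<beta> | sum \<beta> UNIV \<le> k. if \<beta> = \<alpha> then monomial_fun \<beta> x else 0)"
      by (intro sum.cong) auto
    also have "\<dots> = monomial_fun \<alpha> x"
      using assms by (subst sum.delta) (auto simp: finite_multi_indices)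
    finally show ?thesis .
  qed
  then have "monomial_fun \<alpha> = (\<lambda>x. \<Sum>\<beta> | sum \<beta> UNIV \<le> k. (if \<beta> = \<alpha> then 1 else 0) * monomial_fun \<beta> x)"
    by simp
  then show ?thesis unfolding polys_iff by (rule exI[where x = "\<lambda>\<beta>. if \<beta> = \<alpha> then 1 else 0"])
qed

lemma polys_mono:
  assumes "p \<in> polys a" "a \<le> b"
  shows "p \<in> polys b"
proof -
  from assms obtain c where c: "p = (\<lambda>x. \<Sum>\<alpha> | sum \<alpha> UNIV \<le> a. c \<alpha> * monomial_fun \<alpha> x)"
    by (auto simp: polys_iff)
  show ?thesis unfolding c
    by (intro polys_sum polys_scale
        monomial_fun_in_polys) (use assms in auto)
qed

lemma monomial_fun_mult:
  "monomial_fun \<alpha> x * monomial_fun \<beta> x = monomial_fun (\<lambda>i. \<alpha> i + \<beta> i) x"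
  by (simp add: monomial_fun_def power_add prod.distrib)

lemma polys_mult:
  assumes "p \<in> polys a" "q \<in> polys b"
  shows "(\<lambda>x. p x * q x) \<in> polys (a + b)"
proof -
  from assms obtain c d where c: "p = (\<lambda>x. \<Sum>\<alpha> | sum \<alpha> UNIV \<le> a. c \<alpha> * monomial_fun \<alpha> x)"
    and d: "q = (\<lambda>x. \<Sum>\<alpha> | sum \<alpha> UNIV \<le> b. d \<alpha> * monomial_fun \<alpha> x)"
    by (auto simp: polys_iff)
  have "p x * q x = (\<Sum>\<alpha> | sum \<alpha> UNIV \<le> a. \<Sum>\<beta> | sum \<beta> UNIV \<le> b.
      (c \<alpha> * d \<beta>) * monomial_fun (\<lambda>i. \<alpha> i + \<beta> i) x)" for x
    unfolding c d sum_product
    by (intro sum.cong refl) (simp add: monomial_fun_mult[symmetric])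
  moreover have "(\<lambda>x. \<Sum>\<alpha> | sum \<alpha> UNIV \<le> a. \<Sum>\<beta> | sum \<beta> UNIV \<le> b.
      (c \<alpha> * d \<beta>) * monomial_fun (\<lambda>i. \<alpha> i + \<beta> i) x) \<in> polys (a + b)"
    by (intro polys_sum polys_scale
        monomial_fun_in_polys) (auto simp: sum.distrib intro: add_mono)
  ultimately show ?thesis by simp
qed

lemma const_in_polys: "(\<lambda>x. c) \<in> polys k"
proof -
  have "(\<lambda>x. c * monomial_fun (\<lambda>_. 0) x) \<in> polys k"
    by (intro polys_scale monomial_fun_in_polys) auto
  then show ?thesis by (simp add: monomial_fun_def)
qed

lemma inner_in_polys: "(\<lambda>x. g \<bullet> x) \<in> polys 1"
proof -
  have "(\<lambda>x. x $ i) \<in> polys 1" for i :: 'a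
  proof -
    have "monomial_fun (\<lambda>j. if j = i then 1 else 0) \<in> polys (Suc 0)"
      by (intro monomial_fun_in_polys) auto
    moreover have "monomial_fun (\<lambda>j. if j = i then 1 else 0) = (\<lambda>x. x $ i)"
      by (auto simp: monomial_fun_def fun_eq_iff if_distrib[of "\<lambda>n. _ ^ n"] cong: if_cong)
    ultimately show ?thesis by simp
  qed
  then show ?thesis
    unfolding inner_vec_def inner_real_def
    by (intro polys_sum polys_scale)
qed

text \<open>For \<open>\<alpha> i = 0\<close> the truncated difference \<open>\<alpha> i - 1\<close>
  does no harm, since the factor \<open>real (\<alpha> i)\<close> is zero.\<close>

lemma monomial_fun_has_partial_deriv:
  "((\<lambda>t. monomial_fun \<alpha> (x + t *\<^sub>R axis i 1)) has_real_derivative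
     real (\<alpha> i) * monomial_fun (\<alpha>(i := \<alpha> i - 1)) x) (at 0)"
proof -
  define R where "R = (\<Prod>j\<in>UNIV - {i}. (x $ j) ^ \<alpha> j)"
  have 1: "monomial_fun \<alpha> (x + t *\<^sub>R axis i 1) = (x $ i + t) ^ \<alpha> i * R" for t
    unfolding monomial_fun_def R_def
    by (subst prod.remove[of _ i]) (auto simp: axis_def intro!: prod.cong)
  have 2: "monomial_fun (\<alpha>(i := \<alpha> i - 1)) x = (x $ i) ^ (\<alpha> i - 1) * R"
    unfolding monomial_fun_def R_def
    by (subst prod.remove[of _ i]) (auto intro!: prod.cong)
  have "((\<lambda>t. (x $ i + t) ^ \<alpha> i * R) has_real_derivative
      real (\<alpha> i) * ((x $ i) ^ (\<alpha> i - 1) * R)) (at 0)"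
    by (auto intro!: derivative_eq_intros)
  then show ?thesis unfolding 1 2 .
qed

lemma polys_partial_deriv_ex:
  assumes "p \<in> polys k"
  shows "\<exists>p'\<in>polys k. \<forall>x. ((\<lambda>t. p (x + t *\<^sub>R axis i 1)) has_real_derivative p' x) (at 0)"
proof -
  from assms obtain c where c: "p = (\<lambda>x. \<Sum>\<alpha> | sum \<alpha> UNIV \<le> k. c \<alpha> * monomial_fun \<alpha> x)"
    by (auto simp: polys_iff)
  let ?p' = "\<lambda>x. \<Sum>\<alpha> | sum \<alpha> UNIV \<le> k.
      c \<alpha> * (real (\<alpha> i) * monomial_fun (\<alpha>(i := \<alpha> i - 1)) x)"
  have "?p' \<in> polys k"
  proof (intro polys_sum polys_scale
        monomial_fun_in_polys)
    fix \<alpha> :: "'a \<Rightarrow> nat" assume "\<alpha> \<in> {\<alpha>. sum \<alpha> UNIV \<le> k}"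
    moreover have "sum (\<alpha>(i := \<alpha> i - 1)) UNIV \<le> sum \<alpha> UNIV"
      by (intro sum_mono) auto
    ultimately show "sum (\<alpha>(i := \<alpha> i - 1)) UNIV \<le> k" by auto
  qed
  moreover have "((\<lambda>t. p (x + t *\<^sub>R axis i 1)) has_real_derivative ?p' x) (at 0)" for x
    unfolding c by (intro DERIV_sum DERIV_cmult monomial_fun_has_partial_deriv)
  ultimately show ?thesis by (intro bexI[of _ ?p'] allI)
qed

lemma partial_deriv_eqI:
  assumes "\<And>x. ((\<lambda>t. p (x + t *\<^sub>R axis i 1)) has_real_derivative p' x) (at 0)"
  shows "partial_deriv i p = p'"
  using assms by (auto simp: partial_deriv_def fun_eq_iff intro: DERIV_imp_deriv)

lemma
  assumes "p \<in> polys k"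
  shows partial_deriv_in_polys: "partial_deriv i p \<in> polys k"
    and polys_has_partial_deriv:
      "((\<lambda>t. p (x + t *\<^sub>R axis i 1)) has_real_derivative partial_deriv i p x) (at 0)"
  using polys_partial_deriv_ex[OF assms, of i] partial_deriv_eqI[of p i] by auto

lemma partial_deriv_add:
  assumes "p \<in> polys k" "q \<in> polys k'"
  shows "partial_deriv i (\<lambda>x. p x + q x) = (\<lambda>x. partial_deriv i p x + partial_deriv i q x)"
  by (intro partial_deriv_eqI DERIV_add polys_has_partial_deriv[OF assms(1)]
      polys_has_partial_deriv[OF assms(2)])

lemma partial_deriv_cmult:
  assumes "p \<in> polys k"
  shows "partial_deriv i (\<lambda>x. c * p x) = (\<lambda>x. c * partial_deriv i p x)"
  by (intro partial_deriv_eqI DERIV_cmult polys_has_partial_deriv[OF assms(1)])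

lemma partial_deriv_mult:
  assumes "p \<in> polys k" "q \<in> polys k'"
  shows "partial_deriv i (\<lambda>x. p x * q x) =
    (\<lambda>x. partial_deriv i p x * q x + p x * partial_deriv i q x)"
proof (rule partial_deriv_eqI)
  fix x
  show "((\<lambda>t. p (x + t *\<^sub>R axis i 1) * q (x + t *\<^sub>R axis i 1)) has_real_derivative
      partial_deriv i p x * q x + p x * partial_deriv i q x) (at 0)"
    using DERIV_mult[OF polys_has_partial_deriv[OF assms(1)] polys_has_partial_deriv[OF assms(2)], of x i x i]
    by (simp add: algebra_simps)
qed

lemma partial_derivs_Nil [simp]: "partial_derivs [] p = p"
  and partial_derivs_Cons: "partial_derivs (i # is) p = partial_deriv i (partial_derivs is p)"
  and partial_derivs_snoc: "partial_derivs (is @ [i]) p = partial_derivs is (partial_deriv i p)"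
  by (simp_all add: partial_derivs_def)

lemma partial_derivs_in_polys: "p \<in> polys k \<Longrightarrow> partial_derivs is p \<in> polys k"
  by (induction "is") (auto simp: partial_derivs_Cons intro: partial_deriv_in_polys)

lemma partial_derivs_add:
  assumes "p \<in> polys k" "q \<in> polys k"
  shows "partial_derivs is (\<lambda>x. p x + q x) = (\<lambda>x. partial_derivs is p x + partial_derivs is q x)"
proof (induction "is")
  case (Cons i "is")
  then show ?case
    using partial_deriv_add[OF partial_derivs_in_polys[OF assms(1)] partial_derivs_in_polys[OF assms(2)]]
    by (simp add: partial_derivs_Cons)
qed simp

lemma partial_derivs_cmult:
  assumes "p \<in> polys k"
  shows "partial_derivs is (\<lambda>x. c * p x) = (\<lambda>x. c * partial_derivs is p x)"
proof (induction "is")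
  case (Cons i "is")
  then show ?case
    using partial_deriv_cmult[OF partial_derivs_in_polys[OF assms(1)]]
    by (simp add: partial_derivs_Cons)
qed simp

lemma partial_derivs_diff:
  assumes "p \<in> polys k" "q \<in> polys k"
  shows "partial_derivs is (\<lambda>x. p x - q x) = (\<lambda>x. partial_derivs is p x - partial_derivs is q x)"
  using partial_derivs_add[OF assms(1) polys_scale[OF assms(2), of "-1"]]
    partial_derivs_cmult[OF assms(2), of _ "-1"] by simp

lemma polys_continuous_on: "p \<in> polys k \<Longrightarrow> continuous_on X p"
  by (auto simp: polys_def fun_eq_iff[symmetric] intro!: continuous_intros)
    
lemma polys_differentiable: 
  assumes "p \<in> polys k" shows "p differentiable (at x)"
proof -
  from assms obtain c where c: "p = (\<lambda>x. \<Sum>\<alpha> | sum \<alpha> UNIV \<le> k. c \<alpha> * monomial_fun \<alpha> x)"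
    by (auto simp: polys_iff)
  have "(\<lambda>x. x $ i) differentiable (at x)" for i :: 'a
    by (intro linear_imp_differentiable bounded_linear.linear bounded_linear_vec_nth)
  then have "monomial_fun \<alpha> differentiable (at x)" for \<alpha> :: "'a \<Rightarrow> nat"
  proof -
    have "(\<lambda>x. \<Prod>i\<in>I. (x $ i) ^ \<alpha> i) differentiable (at x)" for I :: "'a set"
      by (induction I rule: infinite_finite_induct)
        (auto intro!: differentiable_mult differentiable_power \<open>\<And>i. (\<lambda>x. x $ i) differentiable (at x)\<close>)
    then show ?thesis unfolding monomial_fun_def[abs_def] .
  qed
  then show ?thesis unfolding c
    by (intro differentiable_sum differentiable_mult) (auto simp: finite_multi_indices)
qed

text \<open>Barycentric coordinates change simply along edge directions \<open>V - W\<close> and not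
  along the axes, so the induction on Bernstein coefficients differentiates in those directions.
  This lemma translates between the two kinds of derivative.\<close>

lemma polys_has_directional_deriv:
  fixes p :: "real ^ 'n \<Rightarrow> real"
  assumes "p \<in> polys k"
  shows "((\<lambda>t. p (x + t *\<^sub>R w)) has_real_derivative (\<Sum>i\<in>UNIV. w $ i * partial_deriv i p x)) (at 0)"
proof -
  obtain D where D: "(p has_derivative D) (at x)"
    using polys_differentiable[OF assms] by (auto simp: differentiable_def)
  then interpret D: bounded_linear D by (rule has_derivative_bounded_linear)
  have dir: "((\<lambda>t. p (x + t *\<^sub>R v)) has_real_derivative D v) (at 0)" for v
  proof -
    have "((\<lambda>t. x + t *\<^sub>R v) has_derivative (\<lambda>t. t *\<^sub>R v)) (at 0)"
      by (auto intro!: derivative_eq_intros)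
    moreover have "(p has_derivative D) (at (x + 0 *\<^sub>R v))" using D by simp
    ultimately have "((\<lambda>t. p (x + t *\<^sub>R v)) has_derivative (\<lambda>t. D (t *\<^sub>R v))) (at 0)"
      using diff_chain_at[of "\<lambda>t. x + t *\<^sub>R v" "\<lambda>t. t *\<^sub>R v" 0 p D] by (simp add: o_def)
    moreover have "(\<lambda>t. D (t *\<^sub>R v)) = (*) (D v)"
      by (simp add: fun_eq_iff D.scaleR)
    ultimately show ?thesis by (simp add: has_field_derivative_def)
  qed
  have "D (axis i 1) = partial_deriv i p x" for i
    using DERIV_unique[OF dir polys_has_partial_deriv[OF assms]] .
  moreover have "D w = (\<Sum>i\<in>UNIV. w $ i * D (axis i 1))"
  proof -
    have "w = (\<Sum>i\<in>UNIV. w $ i *\<^sub>R axis i 1)"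
      using basis_expansion[of w] by (simp add: scalar_mult_eq_scaleR)
    then have "D w = D (\<Sum>i\<in>UNIV. w $ i *\<^sub>R axis i 1)" by simp
    then show ?thesis by (simp add: D.sum D.scaleR)
  qed
  ultimately show ?thesis using dir[of w] by simp
qed

text \<open>On the line from an interior point of \<open>T\<close> to any \<open>z\<close> the
  difference is a univariate polynomial with infinitely many zeros. This is what makes
  \<open>cell_poly\<close> well defined.\<close>

lemma polys_eq_if_eq_on_open:
  fixes p q :: "real ^ 'n \<Rightarrow> real"
  assumes p: "p \<in> polys k" and q: "q \<in> polys k" and int: "interior T \<noteq> {}"
    and eq: "\<And>x. x \<in> T \<Longrightarrow> p x = q x"
  shows "p = q"
proof -
  define f where "f = (\<lambda>x. p x - q x)"
  have f: "f \<in> polys k" unfolding f_def by (intro polys_diff p q)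
  obtain a e where e: "e > 0" "ball a e \<subseteq> T"
    using int by (auto simp: mem_interior)
  have "f z = 0" for z
  proof -
    define w where "w = z - a"
    obtain c where c: "f = (\<lambda>x. \<Sum>\<alpha> | sum \<alpha> UNIV \<le> k. c \<alpha> * monomial_fun \<alpha> x)"
      using f by (auto simp: polys_iff)
    define P where "P = (\<Sum>\<alpha> | sum \<alpha> UNIV \<le> k. smult (c \<alpha>) (\<Prod>i\<in>UNIV. [:a $ i, w $ i:] ^ \<alpha> i))"
    have P: "poly P s = f (a + s *\<^sub>R w)" for s
      by (simp add: P_def c monomial_fun_def poly_sum poly_prod)
    have "P = 0"
    proof (rule ccontr)
      assume "P \<noteq> 0"
      then have "finite {s. poly P s = 0}" by (rule poly_roots_finite)
      \<comment> \<open>Adding 1 to the norm keeps the bound meaningful for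
        \<open>w = 0\<close>.\<close>
      moreover have "{0<..<e / (norm w + 1)} \<subseteq> {s. poly P s = 0}"
      proof safe
        fix s assume s: "s \<in> {0<..<e / (norm w + 1)}"
        have "norm w + 1 > 0" using norm_ge_zero[of w] by linarith
        then have "s * (norm w + 1) < e" using s by (auto simp: field_simps)
        then have "s * norm w < e" using s by (auto simp: algebra_simps)
        then have "a + s *\<^sub>R w \<in> ball a e" using s by (simp add: dist_norm)
        then show "poly P s = 0" using e eq by (auto simp: P f_def)
      qed
      moreover have "e / (norm w + 1) > 0" using e norm_ge_zero[of w] by (intro divide_pos_pos) linarith+
      then have "infinite {0<..<e / (norm w + 1)}" by (simp add: infinite_Ioo)
      ultimately show False using finite_subset by blast
    qed
    then show ?thesis using P[of 1] by (simp add: w_def)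
  qed
  then show ?thesis by (auto simp: f_def fun_eq_iff)
qed

section \<open>Order of vanishing\<close>

text \<open>The strict bound makes \<open>m\<close> a multiplicity: \<open>m = 0\<close> imposes
  nothing, orders add under multiplication, and agreement of all derivatives up to order
  \<open>r\<close> is vanishing of the difference to order \<open>Suc r\<close>.\<close>

definition vanishing :: "nat \<Rightarrow> nat \<Rightarrow> (real ^ 'n) set \<Rightarrow> (real ^ 'n \<Rightarrow> real) set" where
  "vanishing k m Y = {p \<in> polys k. \<forall>is. length is < m \<longrightarrow> (\<forall>x\<in>Y. partial_derivs is p x = 0)}"

lemma vanishing_polys: "p \<in> vanishing k m Y \<Longrightarrow> p \<in> polys k"
  by (simp add: vanishing_def)

lemma vanishing_0 [simp]: "vanishing k 0 Y = polys k"
  by (simp add: vanishing_def)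

lemma vanishing_mono:
  "p \<in> vanishing k m Y \<Longrightarrow> k \<le> k' \<Longrightarrow> m' \<le> m \<Longrightarrow> Y' \<subseteq> Y \<Longrightarrow> p \<in> vanishing k' m' Y'"
  unfolding vanishing_def using polys_mono[of p k k'] by force

lemma fun_subspace_vanishing: "fun_subspace (vanishing k m Y)"
proof -
  have "partial_derivs is (\<lambda>x. 0) = (\<lambda>x. 0)" for "is" :: "'a list"
    using partial_derivs_cmult[OF const_in_polys[of 0 k], of "is" 0] by simp
  then show ?thesis
    using fun_subspace_polys[of k]
    by (auto simp: fun_subspace_def vanishing_def partial_derivs_add partial_derivs_cmult)
qed

lemmas vanishing_zero = fun_subspace_zero[OF fun_subspace_vanishing]
  and vanishing_add = fun_subspace_add[OF fun_subspace_vanishing]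
  and vanishing_scale = fun_subspace_scale[OF fun_subspace_vanishing]
  and vanishing_diff = fun_subspace_diff[OF fun_subspace_vanishing]
  and vanishing_sum = fun_subspace_sum[OF fun_subspace_vanishing]

text \<open>The derivative split off is the one applied first, that is, the last entry of the list;
  the others are then derivatives of \<open>partial_deriv i p\<close>. In this recursive form the
  product rule can be used.\<close>

lemma vanishing_Suc:
  "p \<in> vanishing k (Suc m) Y \<longleftrightarrow>
    p \<in> polys k \<and> (\<forall>x\<in>Y. p x = 0) \<and> (\<forall>i. partial_deriv i p \<in> vanishing k m Y)"
proof safe
  assume p: "p \<in> vanishing k (Suc m) Y"
  then show pk: "p \<in> polys k" by (rule vanishing_polys)
  show "p x = 0" if "x \<in> Y" for x
    using p that by (auto simp: vanishing_def dest: spec[of _ "[]"])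
  fix i
  show "partial_deriv i p \<in> vanishing k m Y"
    unfolding vanishing_def
  proof (clarsimp simp: partial_deriv_in_polys[OF pk])
    fix "is" :: "'a list" and x assume "length is < m" "x \<in> Y"
    then have "partial_derivs (is @ [i]) p x = 0"
      using p by (auto simp: vanishing_def)
    then show "partial_derivs is (partial_deriv i p) x = 0" by (simp add: partial_derivs_snoc)
  qed
next
  assume p: "p \<in> polys k" and z: "\<forall>x\<in>Y. p x = 0" and d: "\<forall>i. partial_deriv i p \<in> vanishing k m Y"
  show "p \<in> vanishing k (Suc m) Y"
    unfolding vanishing_def
  proof (clarsimp simp: p)
    fix "is" :: "'a list" and x assume "length is < Suc m" "x \<in> Y"
    then show "partial_derivs is p x = 0"
      using z d by (cases "is" rule: rev_cases) (auto simp: partial_derivs_snoc vanishing_def)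
  qed
qed

text \<open>Leibniz rule by induction on the claimed order \<open>N\<close>. Each differentiation
  hits one of the two factors, so \<open>m\<close> and \<open>n\<close> have to vary in the
  induction.\<close>

lemma vanishing_mult:
  assumes "p \<in> vanishing a m Y" "q \<in> vanishing b n Y"
  shows "(\<lambda>x. p x * q x) \<in> vanishing (a + b) (m + n) Y"
proof -
  have "(\<lambda>x. p x * q x) \<in> vanishing (a + b) N Y"
    if "N \<le> m + n" "p \<in> vanishing a m Y" "q \<in> vanishing b n Y" for N m n p q
    using that
  proof (induction N arbitrary: m n p q)
    case 0
    then show ?case by (auto intro: polys_mult vanishing_polys)
  next
    case (Suc N)
    note pq = vanishing_polys[OF Suc.prems(2)] vanishing_polys[OF Suc.prems(3)]
    show ?case unfolding vanishing_Suc
    proof (intro conjI allI ballI)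
      show "(\<lambda>x. p x * q x) \<in> polys (a + b)" by (intro polys_mult pq)
      show "p x * q x = 0" if "x \<in> Y" for x
        using Suc.prems that
        by (cases m; cases n) (auto simp: vanishing_Suc)
      fix i
      \<comment> \<open>For \<open>m = 0\<close> the truncated \<open>m - 1\<close> is 0 as well,
        but then \<open>Suc N \<le> n\<close> still leaves \<open>N \<le> n\<close> for the
        induction hypothesis.\<close>
      have 1: "partial_deriv i p \<in> vanishing a (m - 1) Y"
        using Suc.prems(2) pq by (cases m) (auto simp: vanishing_Suc partial_deriv_in_polys)
      have 2: "partial_deriv i q \<in> vanishing b (n - 1) Y"
        using Suc.prems(3) pq by (cases n) (auto simp: vanishing_Suc partial_deriv_in_polys)
      show "partial_deriv i (\<lambda>x. p x * q x) \<in> vanishing (a + b) N Y"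
        unfolding partial_deriv_mult[OF pq]
        by (intro vanishing_add Suc.IH[OF _ 1 Suc.prems(3)]
            Suc.IH[OF _ Suc.prems(2) 2]) (use Suc.prems(1) in auto)
    qed
  qed
  from this[OF order_refl assms] show ?thesis .
qed

lemma vanishing_power:
  assumes "p \<in> vanishing a m Y"
  shows "(\<lambda>x. p x ^ n) \<in> vanishing (n * a) (n * m) Y"
  by (induction n) (auto intro: const_in_polys dest: vanishing_mult[OF assms])

lemma vanishing_prod:
  assumes "finite I" "\<And>i. i \<in> I \<Longrightarrow> p i \<in> vanishing (a i) (m i) Y"
  shows "(\<lambda>x. \<Prod>i\<in>I. p i x) \<in> vanishing (\<Sum>i\<in>I. a i) (\<Sum>i\<in>I. m i) Y"
  using assms by (induction I rule: finite_induct) (auto intro: const_in_polys vanishing_mult)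

section \<open>Evaluation functionals and dual bases\<close>

text \<open>Each step splits off one evaluation and exchanges one spanning function.\<close>

lemma evaluation_basis:
  fixes b :: "'i \<Rightarrow> 'a \<Rightarrow> real"
  assumes "finite I" "fun_subspace W" "\<And>w. w \<in> W \<Longrightarrow> \<exists>c. w = (\<lambda>x. \<Sum>i\<in>I. c i * b i x)"
  shows "\<exists>(n::nat) xs ws. (\<forall>i<n. ws i \<in> W) \<and> (\<forall>i<n. \<forall>j<n. ws j (xs i) = (if i = j then 1 else 0))
    \<and> (\<forall>w\<in>W. (\<forall>i<n. w (xs i) = 0) \<longrightarrow> w = (\<lambda>x. 0))"
  using assms
proof (induction "card I" arbitrary: I b W rule: less_induct)
  case less
  show ?case
  proof (cases "\<forall>w\<in>W. w = (\<lambda>x. 0)")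
    case True
    then show ?thesis by (intro exI[of _ 0]) auto
  next
    case False
    then obtain w x0 where w: "w \<in> W" "w x0 \<noteq> 0" by (auto simp: fun_eq_iff)
    define w0 where "w0 = (\<lambda>x. (1 / w x0) * w x)"
    have w0: "w0 \<in> W" "w0 x0 = 1"
      using w fun_subspace_scale[OF less.prems(2) w(1), of "1 / w x0"] by (auto simp: w0_def)
    obtain c0 where c0: "w0 = (\<lambda>x. \<Sum>i\<in>I. c0 i * b i x)" using less.prems(3)[OF w0(1)] by auto
    have "\<exists>i\<in>I. c0 i \<noteq> 0"
    proof (rule ccontr)
      assume "\<not> ?thesis"
      then have "w0 x0 = 0" unfolding c0 by (intro sum.neutral) auto
      with w0 show False by simp
    qed
    then obtain i0 where i0: "i0 \<in> I" "c0 i0 \<noteq> 0" by blast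
    define W' where "W' = {w \<in> W. w x0 = 0}"
    \<comment> \<open>Subtracting multiples of \<open>w0\<close> makes every \<open>b' j\<close>
      vanish at \<open>x0\<close>. Since \<open>w0\<close> can replace \<open>b i0\<close>, the
      functions that remain without the index \<open>i0\<close> span \<open>W'\<close>.\<close>
    define b' where "b' j = (\<lambda>x. b j x - b j x0 * w0 x)" for j
    have W': "fun_subspace W'"
      using less.prems(2) by (auto simp: fun_subspace_def W'_def)
    have span: "\<exists>c. w = (\<lambda>x. \<Sum>i\<in>I - {i0}. c i * b' i x)" if w: "w \<in> W'" for w
    proof -
      obtain c where c: "w = (\<lambda>x. \<Sum>i\<in>I. c i * b i x)" using less.prems(3)[of w] w by (auto simp: W'_def)
      define e where "e = c i0 / c0 i0"
      define d where "d j = c j - e * c0 j" for j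
      have 1: "w x = (\<Sum>i\<in>I - {i0}. d i * b i x) + e * w0 x" for x
      proof -
        have "(\<Sum>i\<in>I. d i * b i x) = w x - e * w0 x"
          by (simp add: c c0 d_def algebra_simps sum_subtractf sum_distrib_left)
        moreover have "(\<Sum>i\<in>I. d i * b i x) = (\<Sum>i\<in>I - {i0}. d i * b i x)"
          using i0 less.prems(1) by (subst sum.remove[of _ i0]) (auto simp: d_def e_def)
        ultimately show ?thesis by simp
      qed
      have 2: "e = - (\<Sum>i\<in>I - {i0}. d i * b i x0)"
        using 1[of x0] w w0 by (simp add: W'_def)
      have "w x = (\<Sum>i\<in>I - {i0}. d i * b' i x)" for x
        unfolding 1[of x] by (subst 2) (simp add: b'_def algebra_simps sum_subtractf sum_distrib_left)
      then show ?thesis by (intro exI[of _ d]) auto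
    qed
    have "card (I - {i0}) < card I" using i0 less.prems(1) by (intro psubset_card_mono) auto
    moreover have "finite (I - {i0})" using less.prems(1) by simp
    ultimately have "\<exists>(n::nat) xs ws. (\<forall>i<n. ws i \<in> W') \<and>
        (\<forall>i<n. \<forall>j<n. ws j (xs i) = (if i = j then 1 else 0)) \<and>
        (\<forall>w\<in>W'. (\<forall>i<n. w (xs i) = 0) \<longrightarrow> w = (\<lambda>x. 0))"
      by (rule less.hyps[OF _ _ W' span])
    then obtain n :: nat and xs ws where N: "(\<forall>i<n. ws i \<in> W') \<and>
        (\<forall>i<n. \<forall>j<n. ws j (xs i) = (if i = j then 1 else 0)) \<and>
        (\<forall>w\<in>W'. (\<forall>i<n. w (xs i) = 0) \<longrightarrow> w = (\<lambda>x. 0))"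
      by (elim exE) (rule that)
    have n: "ws i \<in> W'" "j < n \<Longrightarrow> ws j (xs i) = (if i = j then 1 else 0)" if "i < n" for i j
      using N that by simp_all
    have sep: "w = (\<lambda>x. 0)" if "w \<in> W'" "\<And>i. i < n \<Longrightarrow> w (xs i) = 0" for w
      using N[THEN conjunct2, THEN conjunct2, rule_format, OF that(1)] that(2) by simp
    \<comment> \<open>\<open>w0\<close> is corrected to vanish at the earlier points; its value 1 at
      \<open>x0\<close> survives because all \<open>ws j\<close> vanish there.\<close>
    define v where "v = (\<lambda>x. w0 x - (\<Sum>j<n. w0 (xs j) * ws j x))"
    define xs' where "xs' i = (if i < n then xs i else x0)" for i
    define ws' where "ws' i = (if i < n then ws i else v)" for i
    have v: "v \<in> W" unfolding v_def
      by (intro fun_subspace_diff[OF less.prems(2)] fun_subspace_sum[OF less.prems(2)]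
          fun_subspace_scale[OF less.prems(2)] w0) (use n(1) in \<open>auto simp: W'_def\<close>)
    have ws0: "ws i x0 = 0" if "i < n" for i using n(1)[OF that] by (simp add: W'_def)
    have vx: "v x0 = 1" using w0 by (simp add: v_def ws0)
    have vxs: "v (xs i) = 0" if "i < n" for i
    proof -
      have "(\<Sum>j<n. w0 (xs j) * ws j (xs i)) = (\<Sum>j<n. if j = i then w0 (xs i) else 0)"
        by (intro sum.cong refl) (use n(2) that in auto)
      then show ?thesis using that by (simp add: v_def)
    qed
    show ?thesis
    proof (intro exI[of _ "Suc n"] exI[of _ xs'] exI[of _ ws'] conjI allI impI ballI)
      show "ws' i \<in> W" if "i < Suc n" for i using v n(1) that by (auto simp: ws'_def W'_def)
      show "ws' j (xs' i) = (if i = j then 1 else 0)" if "i < Suc n" "j < Suc n" for i j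
        using that n(2) ws0 vx vxs by (auto simp: ws'_def xs'_def less_Suc_eq)
      fix w assume w: "w \<in> W" "\<forall>i<Suc n. w (xs' i) = 0"
      then have "w x0 = 0" "\<And>i. i < n \<Longrightarrow> w (xs i) = 0" by (auto simp: xs'_def less_Suc_eq)
      then show "w = (\<lambda>x. 0)" using sep[of w] w by (simp add: W'_def)
    qed
  qed
qed

lemma
  assumes "linear_functional_on S \<phi>"
  shows linear_functional_on_add: "u \<in> S \<Longrightarrow> v \<in> S \<Longrightarrow> \<phi> (\<lambda>x. u x + v x) = \<phi> u + \<phi> v"
    and linear_functional_on_scale: "u \<in> S \<Longrightarrow> \<phi> (\<lambda>x. c * u x) = c * \<phi> u"
  using assms by (auto simp: linear_functional_on_def)

lemma linear_functional_on_sum: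
  assumes S: "fun_subspace S" and \<phi>: "linear_functional_on S \<phi>"
    and e: "\<And>i. i \<in> I \<Longrightarrow> e i \<in> S"
  shows "\<phi> (\<lambda>x. \<Sum>i\<in>I. c i * e i x) = (\<Sum>i\<in>I. c i * \<phi> (e i))"
  using e
proof (induction I rule: infinite_finite_induct)
  case (insert i I)
  have "\<phi> (\<lambda>x. c i * e i x + (\<Sum>i\<in>I. c i * e i x)) = \<phi> (\<lambda>x. c i * e i x) + \<phi> (\<lambda>x. \<Sum>i\<in>I. c i * e i x)"
    by (intro linear_functional_on_add[OF \<phi>] fun_subspace_sum[OF S] fun_subspace_scale[OF S])
      (use insert in auto)
  then show ?case using insert linear_functional_on_scale[OF \<phi>, of "e i" "c i"] by simp
qed (use linear_functional_on_scale[OF \<phi> fun_subspace_zero[OF S], of 0] in auto)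

lemma linear_functional_on_diff:
  assumes S: "fun_subspace S" and \<phi>: "linear_functional_on S \<phi>" and uv: "u \<in> S" "v \<in> S"
  shows "\<phi> (\<lambda>x. u x - v x) = \<phi> u - \<phi> v"
  using linear_functional_on_add[OF \<phi> uv(1) fun_subspace_scale[OF S uv(2), of "-1"]]
    linear_functional_on_scale[OF \<phi> uv(2), of "-1"] by simp

text \<open>Ordered by \<open>rank\<close>, the matrix of the values \<open>\<phi> j (u i)\<close>
  has 1 on the diagonal and other nonzero entries only where \<open>j\<close> has strictly larger
  rank than \<open>i\<close>. Elimination from the highest rank downwards gives dual functions, and
  \<open>sep\<close> makes them span. This shape fits extensions of traces, which are controlled
  only on subsimplices of at most the same dimension.\<close>

lemma dual_basis_of_triangular:
  fixes rank :: "'i \<Rightarrow> nat"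
  assumes fin: "finite I" and S: "fun_subspace S"
    and \<phi>: "\<And>i. i \<in> I \<Longrightarrow> linear_functional_on S (\<phi> i)"
    and u: "\<And>i. i \<in> I \<Longrightarrow> u i \<in> S" "\<And>i. i \<in> I \<Longrightarrow> \<phi> i (u i) = 1"
      "\<And>i j. i \<in> I \<Longrightarrow> j \<in> I \<Longrightarrow> j \<noteq> i \<Longrightarrow> rank j \<le> rank i \<Longrightarrow> \<phi> j (u i) = 0"
    and sep: "\<And>v. v \<in> S \<Longrightarrow> (\<And>i. i \<in> I \<Longrightarrow> \<phi> i v = 0) \<Longrightarrow> v = (\<lambda>x. 0)"
  shows "dual_basis S I \<phi>"
proof -
  define M where "M = Max (rank ` I)"
  have M: "rank i \<le> M" if "i \<in> I" for i using that fin by (auto simp: M_def)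
  have "\<exists>e\<in>S. \<forall>j\<in>I. \<phi> j e = (if j = i then 1 else 0)" if "i \<in> I" for i
    using that
  proof (induction "M - rank i" arbitrary: i rule: less_induct)
    case less
    define J where "J = {j \<in> I. rank j > rank i}"
    have "\<exists>e\<in>S. \<forall>l\<in>I. \<phi> l e = (if l = j then 1 else 0)" if "j \<in> J" for j
      by (rule less.hyps) (use that M[of j] in \<open>auto simp: J_def\<close>)
    then obtain e where e: "\<And>j. j \<in> J \<Longrightarrow> e j \<in> S"
        "\<And>j l. j \<in> J \<Longrightarrow> l \<in> I \<Longrightarrow> \<phi> l (e j) = (if l = j then 1 else 0)"
      by metis
    define v where "v = (\<lambda>x. u i x - (\<Sum>j\<in>J. \<phi> j (u i) * e j x))"
    have s: "(\<lambda>x. \<Sum>j\<in>J. \<phi> j (u i) * e j x) \<in> S"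
      by (intro fun_subspace_sum[OF S] fun_subspace_scale[OF S] e)
    have "v \<in> S" unfolding v_def by (intro fun_subspace_diff[OF S] s u less.prems)
    moreover have "\<phi> l v = (if l = i then 1 else 0)" if l: "l \<in> I" for l
    proof -
      have "\<phi> l v = \<phi> l (u i) - (\<Sum>j\<in>J. \<phi> j (u i) * \<phi> l (e j))"
        unfolding v_def
        by (subst linear_functional_on_diff[OF S \<phi>[OF l] u(1)[OF less.prems] s],
            subst linear_functional_on_sum[OF S \<phi>[OF l] e(1)]) auto
      also have "(\<Sum>j\<in>J. \<phi> j (u i) * \<phi> l (e j)) = (\<Sum>j\<in>J. if j = l then \<phi> l (u i) else 0)"
        by (intro sum.cong refl) (use e(2) l in auto)
      also have "\<dots> = (if l \<in> J then \<phi> l (u i) else 0)"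
        using fin by (simp add: J_def)
      finally show ?thesis using u(2)[OF less.prems] u(3)[OF less.prems l] l
        by (auto simp: J_def)
    qed
    ultimately show ?case by blast
  qed
  then obtain e where e: "\<And>i. i \<in> I \<Longrightarrow> e i \<in> S"
      "\<And>i j. i \<in> I \<Longrightarrow> j \<in> I \<Longrightarrow> \<phi> j (e i) = (if j = i then 1 else 0)"
    by metis
  have expand: "v = (\<lambda>x. \<Sum>i\<in>I. \<phi> i v * e i x)" if v: "v \<in> S" for v
  proof -
    have s: "(\<lambda>x. \<Sum>i\<in>I. \<phi> i v * e i x) \<in> S"
      by (intro fun_subspace_sum[OF S] fun_subspace_scale[OF S] e)
    have "(\<lambda>x. v x - (\<Sum>i\<in>I. \<phi> i v * e i x)) = (\<lambda>x. 0)"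
    proof (rule sep)
      show "(\<lambda>x. v x - (\<Sum>i\<in>I. \<phi> i v * e i x)) \<in> S" by (intro fun_subspace_diff[OF S] v s)
      fix j assume j: "j \<in> I"
      have "(\<Sum>i\<in>I. \<phi> i v * \<phi> j (e i)) = (\<Sum>i\<in>I. if i = j then \<phi> j v else 0)"
        by (intro sum.cong refl) (use e(2) j in auto)
      also have "\<dots> = \<phi> j v" using j fin by simp
      finally show "\<phi> j (\<lambda>x. v x - (\<Sum>i\<in>I. \<phi> i v * e i x)) = 0"
        by (subst linear_functional_on_diff[OF S \<phi>[OF j] v s],
            subst linear_functional_on_sum[OF S \<phi>[OF j] e(1)]) auto
    qed
    then show ?thesis by (auto simp: fun_eq_iff)
  qed
  show ?thesis unfolding dual_basis_def
  proof (intro conjI fin ballI \<phi> allI impI)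
    fix c i assume c: "\<forall>v\<in>S. (\<Sum>i\<in>I. c i * \<phi> i v) = 0" and i: "i \<in> I"
    have "(\<Sum>j\<in>I. c j * \<phi> j (e i)) = (\<Sum>j\<in>I. if j = i then c i else 0)"
      by (intro sum.cong refl) (use e(2) i in auto)
    then show "c i = 0" using c e(1)[OF i] i fin by simp
  next
    fix \<psi> assume \<psi>: "linear_functional_on S \<psi>"
    show "\<exists>c. \<forall>u\<in>S. \<psi> u = (\<Sum>i\<in>I. c i * \<phi> i u)"
    proof (intro exI[of _ "\<lambda>i. \<psi> (e i)"] ballI)
      fix v assume "v \<in> S"
      from expand[OF this] have "\<psi> v = \<psi> (\<lambda>x. \<Sum>i\<in>I. \<phi> i v * e i x)" by simp
      also have "\<dots> = (\<Sum>i\<in>I. \<phi> i v * \<psi> (e i))"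
        by (intro linear_functional_on_sum[OF S \<psi>] e)
      finally show "\<psi> v = (\<Sum>i\<in>I. \<psi> (e i) * \<phi> i v)" by (simp add: mult.commute)
    qed
  qed
qed

section \<open>Piecewise polynomials and smoothness\<close>

text \<open>From a point on an interface a coordinate line may run through several cells. The
  derivatives within the pieces of the line combine because there are finitely many pieces.\<close>

lemma has_field_derivative_within_Union:
  fixes f :: "real \<Rightarrow> real"
  assumes "finite \<A>" "\<And>X. X \<in> \<A> \<Longrightarrow> (f has_field_derivative D) (at x within X)"
  shows "(f has_field_derivative D) (at x within \<Union>\<A>)"
  using assms
proof (induction \<A> rule: finite_induct)
  case (insert X \<A>)
  then show ?case
    unfolding has_field_derivative_iff Union_insert
    unfolding at_within_union by (intro filterlim_sup) auto
qed (simp add: has_field_derivative_iff)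

text \<open>The common traces define the derivatives at every point. As the cells are closed and
  finite in number, continuity and partial differentiability can both be checked cell by
  cell.\<close>

lemma C_upto_piecewise:
  fixes P :: "'i \<Rightarrow> real ^ 'n \<Rightarrow> real" and T :: "'i \<Rightarrow> (real ^ 'n) set"
  assumes fin: "finite I" and cl: "\<And>i. i \<in> I \<Longrightarrow> closed (T i)" and P: "\<And>i. i \<in> I \<Longrightarrow> P i \<in> polys k"
    and X: "(\<Union>i\<in>I. T i) = X" and u: "\<And>i x. i \<in> I \<Longrightarrow> x \<in> T i \<Longrightarrow> u x = P i x"
    and agree: "\<And>i j x is. i \<in> I \<Longrightarrow> j \<in> I \<Longrightarrow> x \<in> T i \<Longrightarrow> x \<in> T j \<Longrightarrow> length is \<le> m \<Longrightarrow>
      partial_derivs is (P i) x = partial_derivs is (P j) x"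
  shows "C_upto m X u"
proof -
  define g where "g is x = partial_derivs is (P (SOME i. i \<in> I \<and> x \<in> T i)) x" for "is" x
  have g: "g is x = partial_derivs is (P i) x" if "i \<in> I" "x \<in> T i" "length is \<le> m" for "is" x i
    unfolding g_def using someI[of "\<lambda>i. i \<in> I \<and> x \<in> T i", OF conjI[OF that(1,2)]] that agree by blast
  show ?thesis unfolding C_upto_def
  proof (intro exI[of _ g] conjI ballI allI impI)
    show "g [] x = u x" if "x \<in> X" for x using that X g[of _ x "[]"] u by auto
    show "continuous_on X (g is)" if "length is \<le> m" for "is"
      unfolding X[symmetric]
    proof (intro continuous_on_closed_Union fin cl)
      fix i assume i: "i \<in> I"
      have "continuous_on (T i) (partial_derivs is (P i))"
        by (rule polys_continuous_on[OF partial_derivs_in_polys[OF P[OF i]]])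
      then show "continuous_on (T i) (g is)"
        by (rule continuous_on_cong[THEN iffD1, rotated -1]) (use g i that in auto)
    qed
    fix "is" :: "'n list" and i x assume x: "x \<in> interior X" and len: "length is < m"
    define f where "f t = g is (x + t *\<^sub>R axis i 1)" for t
    \<comment> \<open>The parameters for which the coordinate line through \<open>x\<close> lies in
      the cell \<open>T j\<close>. These closed sets cover a neighbourhood of 0 because
      \<open>x\<close> is interior to \<open>X\<close>, and a cell that misses \<open>x\<close>
      contributes only a trivial filter at 0.\<close>
    define S where "S j = {t. x + t *\<^sub>R axis i 1 \<in> T j}" for j
    have "(f has_field_derivative g (i # is) x) (at 0 within S j)" if j: "j \<in> I" for j
    proof (cases "x \<in> T j")
      case True
      have 1: "((\<lambda>t. partial_derivs is (P j) (x + t *\<^sub>R axis i 1)) has_field_derivative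
          g (i # is) x) (at 0 within S j)"
        using polys_has_partial_deriv[OF partial_derivs_in_polys[OF P[OF j]], of "is" x i] len
        by (auto simp: g[OF j True] partial_derivs_Cons intro: has_field_derivative_at_within)
      show ?thesis
        by (rule has_field_derivative_transform_within[OF 1, of 1])
          (use True j len in \<open>auto simp: S_def f_def g[OF j]\<close>)
    next
      case False
      have "S j = (\<lambda>t. x + t *\<^sub>R axis i 1) -` T j" by (auto simp: S_def)
      then have "closed (S j)"
        by (auto intro!: closed_vimage cl j continuous_intros)
      moreover have "0 \<notin> S j" using False by (simp add: S_def)
      ultimately have "at 0 within S j = bot"
        by (metis closure_closed not_in_closure_trivial_limitI trivial_limit_def)
      then show ?thesis by (simp add: has_field_derivative_iff)
    qed
    then have "(f has_field_derivative g (i # is) x) (at 0 within \<Union>(S ` I))"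
      by (intro has_field_derivative_within_Union) (use fin in auto)
    moreover have "at 0 within \<Union>(S ` I) = at 0"
    proof (rule at_within_interior)
      have op: "open ((\<lambda>t. x + t *\<^sub>R axis i 1) -` interior X)"
        by (intro open_vimage open_interior continuous_intros)
      have sub: "(\<lambda>t. x + t *\<^sub>R axis i 1) -` interior X \<subseteq> \<Union>(S ` I)"
        using interior_subset[of X] X by (auto simp: S_def)
      show "0 \<in> interior (\<Union>(S ` I))"
        by (rule interiorI[OF op _ sub]) (use x in simp)
    qed
    ultimately show "((\<lambda>t. g is (x + t *\<^sub>R axis i 1)) has_real_derivative g (i # is) x) (at 0)"
      by (simp add: f_def[abs_def])
  qed
qed

text \<open>On the interior of \<open>T\<close> the functions \<open>g\<close> are forced to be the
  derivatives of \<open>p\<close>, by induction on the order, and continuity carries this to the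
  closure. One \<open>g\<close> serves all cells, so the derivatives of two cell polynomials agree
  wherever their cells meet.\<close>

lemma C_upto_poly_derivs:
  assumes "C_upto m X u"
  shows "\<exists>g. \<forall>T p k is x. T \<subseteq> X \<and> closure (interior T) = T \<and> p \<in> polys k \<and> (\<forall>x\<in>T. p x = u x)
    \<and> length is \<le> m \<and> x \<in> T \<longrightarrow> partial_derivs is p x = g is x"
proof -
  obtain g where g0: "\<And>x. x \<in> X \<Longrightarrow> g [] x = u x"
    and gc: "\<And>is. length is \<le> m \<Longrightarrow> continuous_on X (g is)"
    and gd: "\<And>is i x. x \<in> interior X \<Longrightarrow> length is < m \<Longrightarrow>
        ((\<lambda>t. g is (x + t *\<^sub>R axis i 1)) has_real_derivative g (i # is) x) (at 0)"
    using assms unfolding C_upto_def by metis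
  have "partial_derivs is p x = g is x"
    if T: "T \<subseteq> X" "closure (interior T) = T" and p: "p \<in> polys k" "\<And>x. x \<in> T \<Longrightarrow> p x = u x"
      and len: "length is \<le> m" and x: "x \<in> T" for T p k "is" x
  proof -
    have int: "partial_derivs is p x = g is x" if "x \<in> interior T" for x
      using len that
    proof (induction "is" arbitrary: x)
      case Nil
      then show ?case using p(2) g0 T(1) interior_subset by fastforce
    next
      case (Cons i "is")
      have "open ((\<lambda>t. x + t *\<^sub>R axis i 1) -` interior T)"
        by (intro open_vimage open_interior continuous_intros)
      then have "\<forall>\<^sub>F t in nhds 0. t \<in> (\<lambda>t. x + t *\<^sub>R axis i 1) -` interior T"
        by (rule eventually_nhds_in_open) (use Cons.prems in auto)
      then have ev: "\<forall>\<^sub>F t in nhds 0. partial_derivs is p (x + t *\<^sub>R axis i 1) = g is (x + t *\<^sub>R axis i 1)"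
        by eventually_elim (use Cons in auto)
      have "((\<lambda>t. partial_derivs is p (x + t *\<^sub>R axis i 1)) has_real_derivative g (i # is) x) (at 0)"
        using gd[of x "is" i] Cons.prems interior_mono[OF T(1)] DERIV_cong_ev[OF refl ev refl] by auto
      from DERIV_unique[OF polys_has_partial_deriv[OF partial_derivs_in_polys[OF p(1)]] this]
      show ?case by (simp add: partial_derivs_Cons)
    qed
    have "continuous_on (closure (interior T)) (\<lambda>x. partial_derivs is p x - g is x)"
      unfolding T(2) by (intro continuous_intros continuous_on_subset[OF gc T(1)] len
          polys_continuous_on[OF partial_derivs_in_polys[OF p(1)]])
    from continuous_constant_on_closure[OF this, of 0 x] int x T(2) show ?thesis by auto
  qed
  then show ?thesis by (intro exI[of _ g] allI impI) (elim conjE, simp)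
qed

section \<open>Barycentric coordinates and Bernstein bases\<close>

text \<open>Fixing all variables except one leaves a univariate polynomial that is zero on the
  infinite set \<open>{0<..}\<close>. Positive arguments are the ones that
  \<open>bern_coeff_zero\<close> can offer, since they rescale to points of a face.\<close>

lemma monomials_independent:
  fixes c :: "('i \<Rightarrow> nat) \<Rightarrow> real"
  assumes "finite I" "finite A" "\<And>\<alpha> \<beta>. \<alpha> \<in> A \<Longrightarrow> \<beta> \<in> A \<Longrightarrow> (\<And>i. i \<in> I \<Longrightarrow> \<alpha> i = \<beta> i) \<Longrightarrow> \<alpha> = \<beta>"
    and "\<And>\<eta>. (\<And>i. i \<in> I \<Longrightarrow> \<eta> i > 0) \<Longrightarrow> (\<Sum>\<alpha>\<in>A. c \<alpha> * (\<Prod>i\<in>I. \<eta> i ^ \<alpha> i)) = 0"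
    and "\<alpha> \<in> A"
  shows "c \<alpha> = 0"
  using assms
proof (induction I arbitrary: A \<alpha> rule: finite_induct)
  case empty
  have "\<beta> = \<alpha>" if "\<beta> \<in> A" for \<beta>
    by (rule empty.prems(2)[OF that empty.prems(4)]) simp
  then have A: "A = {\<alpha>}" using empty.prems(4) by blast
  have "(\<Sum>\<alpha>\<in>A. c \<alpha> * (\<Prod>i\<in>{}. 1 ^ \<alpha> i)) = 0" by (rule empty.prems(3)) simp
  then show ?case by (simp add: A)
next
  case (insert i I)
  define A' where "A' = {\<beta> \<in> A. \<beta> i = \<alpha> i}"
  show ?case
  proof (rule insert.IH)
    show "finite A'" "\<alpha> \<in> A'" using insert.prems by (auto simp: A'_def)
    show "\<beta> = \<gamma>" if "\<beta> \<in> A'" "\<gamma> \<in> A'" "\<And>j. j \<in> I \<Longrightarrow> \<beta> j = \<gamma> j" for \<beta> \<gamma>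
      by (rule insert.prems(2)) (use that in \<open>auto simp: A'_def\<close>)
    fix \<eta> :: "'i \<Rightarrow> real" assume \<eta>: "\<And>i. i \<in> I \<Longrightarrow> \<eta> i > 0"
    define P where "P = (\<Sum>\<beta>\<in>A. monom (c \<beta> * (\<Prod>i\<in>I. \<eta> i ^ \<beta> i)) (\<beta> i))"
    have "poly P s = 0" if "s > 0" for s
    proof -
      have "(\<Prod>j\<in>I. (\<eta>(i := s)) j ^ \<beta> j) = (\<Prod>j\<in>I. \<eta> j ^ \<beta> j)" for \<beta>
        by (rule prod.cong) (use insert.hyps in auto)
      then have "(\<Prod>j\<in>insert i I. (\<eta>(i := s)) j ^ \<beta> j) = s ^ \<beta> i * (\<Prod>j\<in>I. \<eta> j ^ \<beta> j)" for \<beta>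
        using insert.hyps by simp
      moreover have "(\<Sum>\<beta>\<in>A. c \<beta> * (\<Prod>j\<in>insert i I. (\<eta>(i := s)) j ^ \<beta> j)) = 0"
        by (rule insert.prems(3)) (use \<eta> that in auto)
      ultimately show ?thesis by (simp add: P_def poly_sum poly_monom mult_ac)
    qed
    then have "{0<..} \<subseteq> {s. poly P s = 0}" by auto
    moreover have "infinite {0::real<..}" by (rule infinite_Ioi)
    ultimately have "P = 0" using poly_roots_finite[of P] finite_subset by blast
    \<comment> \<open>The coefficient at the exponent of \<open>\<alpha>\<close> retains exactly the
      indices in \<open>A'\<close>. They agree with \<open>\<alpha>\<close> in the variable
      \<open>i\<close>, so they are still distinguished by their values on \<open>I\<close>.\<close>
    then have "0 = coeff P (\<alpha> i)" by simp
    also have "\<dots> = (\<Sum>\<beta>\<in>A. if \<beta> i = \<alpha> i then c \<beta> * (\<Prod>i\<in>I. \<eta> i ^ \<beta> i) else 0)"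
      by (simp add: P_def coeff_sum)
    also have "\<dots> = (\<Sum>\<beta>\<in>A'. c \<beta> * (\<Prod>i\<in>I. \<eta> i ^ \<beta> i))"
      unfolding A'_def using insert.prems(1) by (simp add: sum.inter_filter)
    finally show "(\<Sum>\<beta>\<in>A'. c \<beta> * (\<Prod>i\<in>I. \<eta> i ^ \<beta> i)) = 0" by simp
  qed
qed

lemma vanishing_1I: "p \<in> polys k \<Longrightarrow> (\<And>x. x \<in> Y \<Longrightarrow> p x = 0) \<Longrightarrow> p \<in> vanishing k 1 Y"
  using vanishing_Suc[of p k 0 Y] by (simp add: partial_deriv_in_polys)

lemma affine_in_polys: "(\<lambda>x. g \<bullet> x + c) \<in> polys 1"
  by (intro polys_add inner_in_polys const_in_polys)

locale simplex_coords =
  fixes X :: "(real ^ 'n) set" and l :: "real ^ 'n \<Rightarrow> real ^ 'n \<Rightarrow> real"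
  assumes indep: "\<not> affine_dependent X" and card_X: "card X = Suc CARD('n)"
    and affine: "V \<in> X \<Longrightarrow> \<exists>g c. \<forall>x. l V x = g \<bullet> x + c"
    and l_vertex: "V \<in> X \<Longrightarrow> W \<in> X \<Longrightarrow> l V W = (if V = W then 1 else 0)"
    and sum_l: "(\<Sum>V\<in>X. l V x) = 1"
    and expand: "(\<Sum>V\<in>X. l V x *\<^sub>R V) = x"

lemma simplex_coords_exists:
  fixes X :: "(real ^ 'n) set"
  assumes indep: "\<not> affine_dependent X" and card: "card X = Suc CARD('n)"
  shows "\<exists>l. simplex_coords X l"
proof -
  have fin: "finite X" using indep by (rule aff_independent_finite)
  have "\<exists>f. (\<exists>g c. \<forall>x. f x = g \<bullet> x + c) \<and> (\<forall>W\<in>X. f W = (if V = W then 1 else 0))" if V: "V \<in> X" for V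
  proof -
    have "independent ((\<lambda>x. - V + x) ` (X - {V}))"
      using indep affine_dependent_iff_dependent2[OF V] by simp
    \<comment> \<open>The value -1 on every \<open>W - V\<close> makes \<open>1 + g (x - V)\<close>
      equal to 1 at \<open>V\<close> and 0 at the other vertices; its constant term is
      \<open>1 - g V\<close>.\<close>
    then obtain g :: "real ^ 'n \<Rightarrow> real" where g: "linear g" "\<forall>x\<in>(\<lambda>x. - V + x) ` (X - {V}). g x = -1"
      using linear_independent_extend[of _ "\<lambda>_. -1"] by blast
    have ginner: "g x = adjoint g 1 \<bullet> x" for x
      using adjoint_works[OF g(1), of x 1] by (simp add: inner_commute)
    define f where "f x = adjoint g 1 \<bullet> x + (1 - g V)" for x
    have "f V = 1" by (simp add: f_def ginner)
    moreover have "f W = 0" if "W \<in> X" "W \<noteq> V" for W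
    proof -
      have "g (- V + W) = -1" using g(2) that by auto
      then show ?thesis by (simp add: f_def ginner inner_add_right inner_diff_right)
    qed
    ultimately show ?thesis unfolding f_def by (intro exI[of _ f] conjI) (auto simp: f_def)
  qed
  then have "\<exists>l. \<forall>V\<in>X. (\<exists>g c. \<forall>x. l V x = g \<bullet> x + c) \<and> (\<forall>W\<in>X. l V W = (if V = W then 1 else 0))"
    by (rule bchoice[OF ballI])
  then obtain l where l: "\<And>V. V \<in> X \<Longrightarrow> \<exists>g c. \<forall>x. l V x = g \<bullet> x + c"
    "\<And>V W. V \<in> X \<Longrightarrow> W \<in> X \<Longrightarrow> l V W = (if V = W then 1 else 0)" by auto
  \<comment> \<open>Affine functions commute with affine combinations, so the functions just built
    read off the coefficients of \<open>x\<close> with respect to \<open>X\<close>.\<close>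
  have hull: "(\<Sum>V\<in>X. l V x) = 1 \<and> (\<Sum>V\<in>X. l V x *\<^sub>R V) = x" for x
  proof -
    have "x \<in> affine hull X" using affine_independent_span_eq[OF indep] card by simp
    then obtain u where u: "sum u X = 1" "(\<Sum>v\<in>X. u v *\<^sub>R v) = x"
      using affine_hull_finite[OF fin] by auto
    have "l V x = u V" if V: "V \<in> X" for V
    proof -
      obtain g c where gc: "\<And>x. l V x = g \<bullet> x + c" using l(1)[OF V] by blast
      have "l V x = (\<Sum>W\<in>X. u W * (g \<bullet> W)) + c * sum u X"
        unfolding gc u(1) by (simp add: u(2)[symmetric] inner_sum_right)
      also have "\<dots> = (\<Sum>W\<in>X. u W * l V W)"
        by (simp add: gc algebra_simps sum.distrib sum_distrib_left)
      also have "\<dots> = (\<Sum>W\<in>X. if V = W then u V else 0)"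
        by (intro sum.cong refl) (use l(2) V in auto)
      finally show ?thesis using fin V by simp
    qed
    then show ?thesis using u by (auto cong: sum.cong)
  qed
  show ?thesis
    by (intro exI[of _ l] simplex_coords.intro indep card l) (use hull in auto)
qed

context simplex_coords
begin

lemma fin: "finite X"
  using indep by (rule aff_independent_finite)

lemma fin_sub: "C \<subseteq> X \<Longrightarrow> finite C"
  using fin finite_subset by blast

lemma l_comb:
  assumes "V \<in> X" "sum u S = 1"
  shows "l V (\<Sum>W\<in>S. u W *\<^sub>R W) = (\<Sum>W\<in>S. u W * l V W)"
proof -
  obtain g c where gc: "\<And>x. l V x = g \<bullet> x + c" using affine[OF assms(1)] by blast
  have "l V (\<Sum>W\<in>S. u W *\<^sub>R W) = (\<Sum>W\<in>S. u W * (g \<bullet> W)) + c * sum u S"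
    unfolding gc assms(2) by (simp add: inner_sum_right)
  also have "\<dots> = (\<Sum>W\<in>S. u W * l V W)"
    by (simp add: gc algebra_simps sum.distrib sum_distrib_left)
  finally show ?thesis .
qed

lemma l_comb2:
  assumes "V \<in> X" "a + b = 1"
  shows "l V (a *\<^sub>R x + b *\<^sub>R y) = a * l V x + b * l V y"
proof -
  obtain g c where gc: "\<And>x. l V x = g \<bullet> x + c" using affine[OF assms(1)] by blast
  have b: "b = 1 - a" using assms(2) by simp
  show ?thesis by (simp add: gc b inner_add_right algebra_simps)
qed

lemma l_line:
  assumes "V \<in> X"
  shows "l V (x + t *\<^sub>R (y - z)) = l V x + t * (l V y - l V z)"
proof -
  obtain g c where gc: "\<And>x. l V x = g \<bullet> x + c" using affine[OF assms(1)] by blast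
  show ?thesis by (simp add: gc inner_add_right inner_diff_right)
qed

lemma l_in_polys: "V \<in> X \<Longrightarrow> l V \<in> polys 1"
proof -
  assume "V \<in> X"
  then obtain g c where "l V = (\<lambda>x. g \<bullet> x + c)" using affine[of V] by (auto simp: fun_eq_iff)
  then show ?thesis using affine_in_polys by simp
qed

lemma l_point:
  assumes "C \<subseteq> X" "sum u C = 1" "V \<in> X"
  shows "l V (\<Sum>W\<in>C. u W *\<^sub>R W) = (if V \<in> C then u V else 0)"
proof -
  have "l V (\<Sum>W\<in>C. u W *\<^sub>R W) = (\<Sum>W\<in>C. if V = W then u V else 0)"
    unfolding l_comb[OF assms(3,2)] by (intro sum.cong refl) (use assms l_vertex in auto)
  then show ?thesis using fin_sub[OF assms(1)] by simp
qed

lemma mem_hull: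
  assumes C: "C \<subseteq> X"
  shows "x \<in> convex hull C \<longleftrightarrow> (\<forall>V\<in>X. 0 \<le> l V x) \<and> (\<forall>V\<in>X - C. l V x = 0)"
proof
  assume "x \<in> convex hull C"
  then obtain u where u: "\<forall>v\<in>C. 0 \<le> u v" "sum u C = 1" "(\<Sum>v\<in>C. u v *\<^sub>R v) = x"
    using convex_hull_finite[OF fin_sub[OF C]] by auto
  then show "(\<forall>V\<in>X. 0 \<le> l V x) \<and> (\<forall>V\<in>X - C. l V x = 0)"
    using l_point[OF C u(2)] by auto
next
  assume a: "(\<forall>V\<in>X. 0 \<le> l V x) \<and> (\<forall>V\<in>X - C. l V x = 0)"
  have "(\<Sum>V\<in>C. l V x) = (\<Sum>V\<in>X. l V x)"
    by (rule sum.mono_neutral_left) (use a C fin in auto)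
  moreover have "(\<Sum>V\<in>C. l V x *\<^sub>R V) = (\<Sum>V\<in>X. l V x *\<^sub>R V)"
    by (rule sum.mono_neutral_left) (use a C fin in auto)
  ultimately show "x \<in> convex hull C"
    unfolding convex_hull_finite[OF fin_sub[OF C]] using a C sum_l expand
    by (auto intro!: exI[of _ "\<lambda>V. l V x"])
qed

text \<open>Being zero outside \<open>X\<close> makes an index determined by its values on
  \<open>X\<close>, so there are finitely many of them.\<close>

definition idx :: "nat \<Rightarrow> (real ^ 'n \<Rightarrow> nat) set" where
  "idx k = {\<alpha>. (\<forall>V. V \<notin> X \<longrightarrow> \<alpha> V = 0) \<and> sum \<alpha> X = k}"

text \<open>A Bernstein polynomial up to its multinomial coefficient.\<close>

definition bern :: "(real ^ 'n \<Rightarrow> nat) \<Rightarrow> real ^ 'n \<Rightarrow> real" where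
  "bern \<alpha> x = (\<Prod>V\<in>X. l V x ^ \<alpha> V)"

lemma finite_idx: "finite (idx k)"
proof (rule finite_subset)
  show "idx k \<subseteq> {\<alpha>. \<forall>V. (V \<in> X \<longrightarrow> \<alpha> V \<in> {..k}) \<and> (V \<notin> X \<longrightarrow> \<alpha> V = 0)}"
    using member_le_sum[of _ X] fin by (fastforce simp: idx_def)
  show "finite {\<alpha>. \<forall>V. (V \<in> X \<longrightarrow> \<alpha> V \<in> {..k}) \<and> (V \<notin> X \<longrightarrow> \<alpha> V = 0)}"
    by (rule finite_set_of_finite_funs) (use fin in auto)
qed

text \<open>Each \<open>l V\<close> with \<open>V \<in> L\<close> vanishes on the face opposite to
  \<open>L\<close>, and orders of vanishing add over the factors.\<close>

lemma bern_vanishing: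
  assumes "\<alpha> \<in> idx k" "L \<subseteq> X"
  shows "bern \<alpha> \<in> vanishing k (sum \<alpha> L) (convex hull (X - L))"
proof -
  have "(\<lambda>x. l V x ^ \<alpha> V) \<in> vanishing (\<alpha> V) (if V \<in> L then \<alpha> V else 0) (convex hull (X - L))"
    if V: "V \<in> X" for V
  proof -
    have "l V \<in> vanishing 1 (if V \<in> L then 1 else 0) (convex hull (X - L))"
      using l_in_polys[OF V] V mem_hull[of "X - L"] by (auto intro!: vanishing_1I[unfolded One_nat_def])
    from vanishing_power[OF this, of "\<alpha> V"] show ?thesis by (simp split: if_splits)
  qed
  from vanishing_prod[OF fin this, of "\<lambda>V. V"]
  have "bern \<alpha> \<in> vanishing (sum \<alpha> X) (\<Sum>V\<in>X. if V \<in> L then \<alpha> V else 0) (convex hull (X - L))"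
    unfolding bern_def[abs_def] by simp
  moreover have "(\<Sum>V\<in>X. if V \<in> L then \<alpha> V else 0) = sum \<alpha> L"
    using assms(2) fin by (simp add: sum.inter_restrict[symmetric] Int_absorb1)
  ultimately show ?thesis using assms(1) by (simp add: idx_def)
qed

lemma bern_in_polys: "\<alpha> \<in> idx k \<Longrightarrow> bern \<alpha> \<in> polys k"
  using bern_vanishing[of \<alpha> k "{}"] by (simp)

lemma bern_upd: "V \<in> X \<Longrightarrow> bern (\<alpha>(V := Suc (\<alpha> V))) x = l V x * bern \<alpha> x"
proof -
  assume V: "V \<in> X"
  have "(\<Prod>U\<in>X - {V}. l U x ^ (\<alpha>(V := Suc (\<alpha> V))) U) = (\<Prod>U\<in>X - {V}. l U x ^ \<alpha> U)"
    by (rule prod.cong) auto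
  then show ?thesis unfolding bern_def prod.remove[OF fin V] by simp
qed

lemma idx_upd: "V \<in> X \<Longrightarrow> \<alpha> \<in> idx k \<Longrightarrow> \<alpha>(V := Suc (\<alpha> V)) \<in> idx (Suc k)"
proof -
  assume V: "V \<in> X" and \<alpha>: "\<alpha> \<in> idx k"
  have "sum (\<alpha>(V := Suc (\<alpha> V))) (X - {V}) = sum \<alpha> (X - {V})"
    by (rule sum.cong) auto
  then show ?thesis using \<alpha> V sum.remove[OF fin V, of \<alpha>] sum.remove[OF fin V, of "\<alpha>(V := Suc (\<alpha> V))"]
    by (auto simp: idx_def)
qed

lemma idx_upd_minus:
  assumes "V \<in> X" "\<alpha> \<in> idx (Suc k)" "\<alpha> V > 0"
  shows "\<alpha>(V := \<alpha> V - 1) \<in> idx k"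
proof -
  have "sum (\<alpha>(V := \<alpha> V - 1)) (X - {V}) = sum \<alpha> (X - {V})"
    by (rule sum.cong) auto
  then show ?thesis
    using assms sum.remove[OF fin assms(1), of \<alpha>] sum.remove[OF fin assms(1), of "\<alpha>(V := \<alpha> V - 1)"]
    by (auto simp: idx_def)
qed

definition bern_span :: "nat \<Rightarrow> (real ^ 'n \<Rightarrow> real) set" where
  "bern_span k = {p. \<exists>c. p = (\<lambda>x. \<Sum>\<alpha>\<in>idx k. c \<alpha> * bern \<alpha> x)}"

lemma fun_subspace_bern_span: "fun_subspace (bern_span k)"
  unfolding fun_subspace_def
proof (intro conjI ballI allI)
  show "(\<lambda>x. 0) \<in> bern_span k"
    by (auto simp: bern_span_def intro!: exI[of _ "\<lambda>_. 0"])
  fix f g a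
  assume f: "f \<in> bern_span k"
  then obtain c where c: "f = (\<lambda>x. \<Sum>\<alpha>\<in>idx k. c \<alpha> * bern \<alpha> x)"
    by (auto simp: bern_span_def)
  show "(\<lambda>x. a * f x) \<in> bern_span k"
    by (auto simp: bern_span_def c sum_distrib_left mult.assoc intro!: exI[of _ "\<lambda>\<alpha>. a * c \<alpha>"])
  assume "g \<in> bern_span k"
  then obtain d where d: "g = (\<lambda>x. \<Sum>\<alpha>\<in>idx k. d \<alpha> * bern \<alpha> x)"
    by (auto simp: bern_span_def)
  show "(\<lambda>x. f x + g x) \<in> bern_span k"
    by (auto simp: bern_span_def c d sum.distrib distrib_right intro!: exI[of _ "\<lambda>\<alpha>. c \<alpha> + d \<alpha>"])
qed

lemma bern_in_span:
  assumes "\<alpha> \<in> idx k"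
  shows "bern \<alpha> \<in> bern_span k"
proof -
  have "(\<Sum>\<beta>\<in>idx k. (if \<beta> = \<alpha> then 1 else 0) * bern \<beta> x) = bern \<alpha> x" for x
  proof -
    have "(\<Sum>\<beta>\<in>idx k. (if \<beta> = \<alpha> then 1 else 0) * bern \<beta> x) = (\<Sum>\<beta>\<in>idx k. if \<beta> = \<alpha> then bern \<alpha> x else 0)"
      by (intro sum.cong) auto
    then show ?thesis using assms by (simp add: finite_idx)
  qed
  then have "bern \<alpha> = (\<lambda>x. \<Sum>\<beta>\<in>idx k. (if \<beta> = \<alpha> then 1 else 0) * bern \<beta> x)" by simp
  then show ?thesis unfolding bern_span_def
    by (intro CollectI exI[where x = "\<lambda>\<beta>. if \<beta> = \<alpha> then 1 else 0"])
qed

text \<open>An affine function is the combination of the \<open>l V\<close> with its vertex values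
  as coefficients, and multiplication by \<open>l V\<close> raises one exponent. Applied to the
  constant function 1 this is degree elevation.\<close>

lemma bern_span_mult:
  assumes "f \<in> bern_span k"
  shows "(\<lambda>x. (g \<bullet> x + c) * f x) \<in> bern_span (Suc k)"
proof -
  obtain d where d: "f = (\<lambda>x. \<Sum>\<alpha>\<in>idx k. d \<alpha> * bern \<alpha> x)"
    using assms by (auto simp: bern_span_def)
  have lin: "g \<bullet> x + c = (\<Sum>V\<in>X. (g \<bullet> V + c) * l V x)" for x
  proof -
    have "g \<bullet> x + c = g \<bullet> (\<Sum>V\<in>X. l V x *\<^sub>R V) + c * (\<Sum>V\<in>X. l V x)"
      by (simp add: expand sum_l)
    also have "\<dots> = (\<Sum>V\<in>X. (g \<bullet> V + c) * l V x)"
      by (simp add: inner_sum_right sum_distrib_left sum.distrib algebra_simps)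
    finally show ?thesis .
  qed
  have "(g \<bullet> x + c) * f x =
      (\<Sum>V\<in>X. \<Sum>\<alpha>\<in>idx k. ((g \<bullet> V + c) * d \<alpha>) * bern (\<alpha>(V := Suc (\<alpha> V))) x)" for x
    unfolding lin[of x] d sum_product by (intro sum.cong refl) (simp add: bern_upd)
  then have "(\<lambda>x. (g \<bullet> x + c) * f x) =
      (\<lambda>x. \<Sum>V\<in>X. \<Sum>\<alpha>\<in>idx k. ((g \<bullet> V + c) * d \<alpha>) * bern (\<alpha>(V := Suc (\<alpha> V))) x)"
    by simp
  also have "\<dots> \<in> bern_span (Suc k)"
    by (intro fun_subspace_sum[OF fun_subspace_bern_span] fun_subspace_scale[OF fun_subspace_bern_span]
        bern_in_span idx_upd)
  finally show ?thesis .
qed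

lemma polys_bern_expansion:
  assumes "p \<in> polys k"
  obtains c where "p = (\<lambda>x. \<Sum>\<alpha>\<in>idx k. c \<alpha> * bern \<alpha> x)"
proof -
  have one: "(\<lambda>x. 1) \<in> bern_span 0"
    using bern_in_span[of "\<lambda>_. 0" 0] by (simp add: idx_def bern_def[abs_def])
  have "(\<lambda>x. \<Prod>i\<in>I. (x $ i) ^ \<alpha> i) \<in> bern_span (sum \<alpha> I)" if "finite I" for \<alpha> :: "'n \<Rightarrow> nat" and I
    using that
  proof (induction I rule: finite_induct)
    case (insert i I)
    have "(\<lambda>x. (x $ i) ^ m * (\<Prod>i\<in>I. (x $ i) ^ \<alpha> i)) \<in> bern_span (m + sum \<alpha> I)" for m
    proof (induction m)
      case (Suc m)
      from bern_span_mult[OF Suc, of "axis i 1" 0] show ?case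
        by (simp add: inner_axis' mult_ac)
    qed (use insert in simp)
    then show ?case using insert by simp
  qed (use one in simp)
  from this[of UNIV] have mono: "monomial_fun \<alpha> \<in> bern_span (sum \<alpha> UNIV)" for \<alpha> :: "'n \<Rightarrow> nat"
    by (simp add: monomial_fun_def[abs_def])
  have up: "f \<in> bern_span (n + m)" if "f \<in> bern_span n" for f n m
  proof (induction m)
    case (Suc m)
    from bern_span_mult[OF Suc, of 0 1] show ?case by simp
  qed (use that in simp)
  have "monomial_fun \<alpha> \<in> bern_span k" if "sum \<alpha> UNIV \<le> k" for \<alpha> :: "'n \<Rightarrow> nat"
    using up[OF mono[of \<alpha>], of "k - sum \<alpha> UNIV"] that by simp
  moreover obtain c where c: "p = (\<lambda>x. \<Sum>\<alpha> | sum \<alpha> UNIV \<le> k. c \<alpha> * monomial_fun \<alpha> x)"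
    using assms by (auto simp: polys_iff)
  ultimately have "p \<in> bern_span k" unfolding c
    by (intro fun_subspace_sum[OF fun_subspace_bern_span] fun_subspace_scale[OF fun_subspace_bern_span]) auto
  then show ?thesis using that by (auto simp: bern_span_def)
qed

lemma bern_has_directional_deriv:
  assumes V: "V \<in> X" and W: "W \<in> X" and VW: "V \<noteq> W"
  shows "((\<lambda>t. bern \<alpha> (x + t *\<^sub>R (V - W))) has_real_derivative
    real (\<alpha> V) * bern (\<alpha>(V := \<alpha> V - 1)) x - real (\<alpha> W) * bern (\<alpha>(W := \<alpha> W - 1)) x) (at 0)"
proof -
  define R where "R = (\<Prod>U\<in>X - {V} - {W}. l U x ^ \<alpha> U)"
  have split: "prod f X = f V * (f W * prod f (X - {V} - {W}))" for f :: "real ^ 'n \<Rightarrow> real"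
    using prod.remove[OF fin V, of f] prod.remove[of "X - {V}" W f] V W VW fin by simp
  have 1: "bern \<alpha> (x + t *\<^sub>R (V - W)) = (l V x + t) ^ \<alpha> V * ((l W x - t) ^ \<alpha> W * R)" for t
    unfolding bern_def split R_def using V W VW
    by (simp add: l_line l_vertex)
  have 2: "bern (\<alpha>(V := \<alpha> V - 1)) x = l V x ^ (\<alpha> V - 1) * (l W x ^ \<alpha> W * R)"
    unfolding bern_def split R_def using VW by (auto intro!: prod.cong)
  have 3: "bern (\<alpha>(W := \<alpha> W - 1)) x = l V x ^ \<alpha> V * (l W x ^ (\<alpha> W - 1) * R)"
    unfolding bern_def split R_def using VW by (auto intro!: prod.cong)
  show ?thesis unfolding 1 2 3
    by (auto intro!: derivative_eq_intros simp: algebra_simps)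
qed

lemma sum_idx_shift:
  assumes V: "V \<in> X"
  shows "(\<Sum>\<alpha>\<in>idx (Suc k). c \<alpha> * (real (\<alpha> V) * bern (\<alpha>(V := \<alpha> V - 1)) x)) =
    (\<Sum>\<beta>\<in>idx k. real (Suc (\<beta> V)) * c (\<beta>(V := Suc (\<beta> V))) * bern \<beta> x)"
proof -
  have "(\<Sum>\<alpha>\<in>idx (Suc k). c \<alpha> * (real (\<alpha> V) * bern (\<alpha>(V := \<alpha> V - 1)) x)) =
      (\<Sum>\<alpha> | \<alpha> \<in> idx (Suc k) \<and> \<alpha> V > 0. c \<alpha> * (real (\<alpha> V) * bern (\<alpha>(V := \<alpha> V - 1)) x))"
    by (rule sum.mono_neutral_right) (auto simp: finite_idx)
  also have "\<dots> = (\<Sum>\<beta>\<in>idx k. real (Suc (\<beta> V)) * c (\<beta>(V := Suc (\<beta> V))) * bern \<beta> x)"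
    by (rule sum.reindex_bij_witness[of _ "\<lambda>\<beta>. \<beta>(V := Suc (\<beta> V))" "\<lambda>\<alpha>. \<alpha>(V := \<alpha> V - 1)"])
      (use V in \<open>auto simp: idx_upd idx_upd_minus[unfolded One_nat_def]\<close>)
  finally show ?thesis .
qed

text \<open>Restricted to the face, only the terms supported in \<open>C\<close> survive, and these
  are independent monomials. A derivative along an edge leaving the face lowers the exponent sum off
  \<open>C\<close> by one, which reduces each further order to the previous one. So the jet along a
  face controls the coefficients that are low there, while \<open>bern_vanishing\<close> says that
  the high terms do not enter the jet.\<close>

lemma bern_coeff_zero:
  assumes C: "C \<subseteq> X" "C \<noteq> {}"
    and "(\<lambda>x. \<Sum>\<alpha>\<in>idx k. c \<alpha> * bern \<alpha> x) \<in> vanishing k (Suc m) (convex hull C)"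
    and "\<alpha> \<in> idx k" "sum \<alpha> (X - C) \<le> m"
  shows "c \<alpha> = 0"
  using assms(3-)
proof (induction m arbitrary: k c \<alpha>)
  case 0
  define A where "A = {\<alpha> \<in> idx k. \<forall>V\<in>X - C. \<alpha> V = 0}"
  show ?case
  proof (rule monomials_independent[of C A])
    show "finite C" "finite A" using fin_sub C finite_idx by (auto simp: A_def)
    show "\<alpha> \<in> A" using 0 fin by (auto simp: A_def)
    show "\<beta> = \<gamma>" if "\<beta> \<in> A" "\<gamma> \<in> A" "\<And>j. j \<in> C \<Longrightarrow> \<beta> j = \<gamma> j" for \<beta> \<gamma>
    proof
      fix V show "\<beta> V = \<gamma> V" using that by (cases "V \<in> C"; cases "V \<in> X") (auto simp: A_def idx_def)
    qed
    fix \<eta> :: "real ^ 'n \<Rightarrow> real" assume \<eta>: "\<And>V. V \<in> C \<Longrightarrow> \<eta> V > 0"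
    define \<sigma> where "\<sigma> = sum \<eta> C"
    have \<sigma>: "\<sigma> > 0" unfolding \<sigma>_def using C fin_sub \<eta> by (intro sum_pos) auto
    \<comment> \<open>Arbitrary positive arguments become barycentric coordinates after division by
      their sum \<open>\<sigma>\<close>; homogeneity of degree \<open>k\<close> removes the factor
      again.\<close>
    define x where "x = (\<Sum>V\<in>C. (\<eta> V / \<sigma>) *\<^sub>R V)"
    have s1: "(\<Sum>V\<in>C. \<eta> V / \<sigma>) = 1" using \<sigma> by (simp add: sum_divide_distrib[symmetric] \<sigma>_def)
    have lx: "l V x = (if V \<in> C then \<eta> V / \<sigma> else 0)" if "V \<in> X" for V
      unfolding x_def by (rule l_point[OF C(1) s1 that])
    have "x \<in> convex hull C" unfolding mem_hull[OF C(1)] using lx \<eta> \<sigma>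
      by (auto intro!: divide_nonneg_pos simp: less_imp_le)
    then have "0 = \<sigma> ^ k * (\<Sum>\<alpha>\<in>idx k. c \<alpha> * bern \<alpha> x)"
      using 0(1) by (auto simp: vanishing_Suc)
    also have "\<dots> = (\<Sum>\<alpha>\<in>idx k. c \<alpha> * (\<Prod>V\<in>X. (\<sigma> * l V x) ^ \<alpha> V))"
      unfolding sum_distrib_left bern_def
      by (intro sum.cong refl) (auto simp: power_mult_distrib prod.distrib power_sum idx_def)
    also have "\<dots> = (\<Sum>\<alpha>\<in>A. c \<alpha> * (\<Prod>V\<in>X. (\<sigma> * l V x) ^ \<alpha> V))"
    proof (rule sum.mono_neutral_right[OF finite_idx])
      show "A \<subseteq> idx k" by (auto simp: A_def)
      show "\<forall>\<alpha>\<in>idx k - A. c \<alpha> * (\<Prod>V\<in>X. (\<sigma> * l V x) ^ \<alpha> V) = 0"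
      proof
        fix \<beta> assume "\<beta> \<in> idx k - A"
        then obtain V where V: "V \<in> X" "V \<notin> C" "\<beta> V > 0" by (auto simp: A_def)
        then have "(\<Prod>V\<in>X. (\<sigma> * l V x) ^ \<beta> V) = 0"
          using fin by (intro prod_zero) (auto simp: lx intro!: bexI[of _ V])
        then show "c \<beta> * (\<Prod>V\<in>X. (\<sigma> * l V x) ^ \<beta> V) = 0" by simp
      qed
    qed
    also have "\<dots> = (\<Sum>\<alpha>\<in>A. c \<alpha> * (\<Prod>V\<in>C. \<eta> V ^ \<alpha> V))"
    proof (intro sum.cong refl)
      fix \<beta> assume "\<beta> \<in> A"
      then have "(\<Prod>V\<in>X. (\<sigma> * l V x) ^ \<beta> V) = (\<Prod>V\<in>C. (\<sigma> * l V x) ^ \<beta> V)"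
        using C fin by (intro prod.mono_neutral_right) (auto simp: A_def)
      also have "\<dots> = (\<Prod>V\<in>C. \<eta> V ^ \<beta> V)"
        using C \<sigma> by (intro prod.cong refl) (auto simp: lx subset_iff)
      finally show "c \<beta> * (\<Prod>V\<in>X. (\<sigma> * l V x) ^ \<beta> V) = c \<beta> * (\<Prod>V\<in>C. \<eta> V ^ \<beta> V)" by simp
    qed
    finally show "(\<Sum>\<alpha>\<in>A. c \<alpha> * (\<Prod>V\<in>C. \<eta> V ^ \<alpha> V)) = 0" by simp
  qed
next
  case (Suc m)
  define p where "p = (\<lambda>x. \<Sum>\<alpha>\<in>idx k. c \<alpha> * bern \<alpha> x)"
  have pv: "p \<in> vanishing k (Suc (Suc m)) (convex hull C)" using Suc.prems(1) by (simp add: p_def)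
  have low: "c \<beta> = 0" if "\<beta> \<in> idx k" "sum \<beta> (X - C) \<le> m" for \<beta>
    by (rule Suc.IH[OF vanishing_mono[OF Suc.prems(1)] that]) auto
  show ?case
  proof (cases "sum \<alpha> (X - C) \<le> m")
    case False
    with Suc.prems(3) have eq: "sum \<alpha> (X - C) = Suc m" by simp
    then have "\<exists>V\<in>X - C. \<alpha> V > 0" by (metis bot_nat_0.not_eq_extremum nat.distinct(1) sum.neutral)
    then obtain V where V: "V \<in> X" "V \<notin> C" "\<alpha> V > 0" by auto
    obtain W where W: "W \<in> C" using C by auto
    have WX: "W \<in> X" and VW: "V \<noteq> W" using W V C by auto
    have "\<alpha> V \<le> k" using Suc.prems(2) member_le_sum[of V X \<alpha>] fin V by (auto simp: idx_def)
    with V obtain k' where k: "k = Suc k'" by (cases k) auto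
    define q where "q = (\<lambda>x. \<Sum>i\<in>UNIV. (V - W) $ i * partial_deriv i p x)"
    \<comment> \<open>Coefficients of the derivative along \<open>V - W\<close>. Raising the
      exponent at \<open>W \<in> C\<close> does not change the exponent sum off \<open>C\<close>, so
      at the index \<open>\<beta>\<close> below the second term is zero by \<open>low\<close> and
      the first is a positive multiple of \<open>c \<alpha>\<close>.\<close>
    define c' where "c' \<beta> = real (Suc (\<beta> V)) * c (\<beta>(V := Suc (\<beta> V))) - real (Suc (\<beta> W)) * c (\<beta>(W := Suc (\<beta> W)))" for \<beta>
    have qv: "q \<in> vanishing k (Suc m) (convex hull C)" unfolding q_def
      by (intro vanishing_sum vanishing_scale)
        (use pv in \<open>auto simp: vanishing_Suc[of _ _ "Suc m"]\<close>)
    have qe: "q = (\<lambda>x. \<Sum>\<beta>\<in>idx k'. c' \<beta> * bern \<beta> x)"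
    proof
      fix x
      have "((\<lambda>t. p (x + t *\<^sub>R (V - W))) has_real_derivative (\<Sum>\<alpha>\<in>idx k. c \<alpha> *
          (real (\<alpha> V) * bern (\<alpha>(V := \<alpha> V - 1)) x - real (\<alpha> W) * bern (\<alpha>(W := \<alpha> W - 1)) x))) (at 0)"
        unfolding p_def by (intro DERIV_sum DERIV_cmult bern_has_directional_deriv V WX VW)
      then have "q x = (\<Sum>\<alpha>\<in>idx k. c \<alpha> *
          (real (\<alpha> V) * bern (\<alpha>(V := \<alpha> V - 1)) x - real (\<alpha> W) * bern (\<alpha>(W := \<alpha> W - 1)) x))"
        unfolding q_def by (rule DERIV_unique[OF polys_has_directional_deriv[OF vanishing_polys[OF pv]]])
      also have "\<dots> = (\<Sum>\<alpha>\<in>idx k. c \<alpha> * (real (\<alpha> V) * bern (\<alpha>(V := \<alpha> V - 1)) x)) -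
          (\<Sum>\<alpha>\<in>idx k. c \<alpha> * (real (\<alpha> W) * bern (\<alpha>(W := \<alpha> W - 1)) x))"
        by (simp add: right_diff_distrib sum_subtractf)
      also have "\<dots> = (\<Sum>\<beta>\<in>idx k'. c' \<beta> * bern \<beta> x)"
        unfolding k sum_idx_shift[OF V(1)] sum_idx_shift[OF WX]
        by (simp add: c'_def left_diff_distrib sum_subtractf)
      finally show "q x = (\<Sum>\<beta>\<in>idx k'. c' \<beta> * bern \<beta> x)" .
    qed
    \<comment> \<open>The vanishing of \<open>q\<close> was obtained in degree \<open>k\<close>. Its
      Bernstein form shows that \<open>q\<close> has degree \<open>k'\<close>, as the induction
      hypothesis demands.\<close>
    have "q \<in> polys k'" unfolding qe
      by (intro polys_sum polys_scale bern_in_polys)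
    with qv have "(\<lambda>x. \<Sum>\<beta>\<in>idx k'. c' \<beta> * bern \<beta> x) \<in> vanishing k' (Suc m) (convex hull C)"
      unfolding qe[symmetric] by (simp add: vanishing_def)
    moreover define \<beta> where "\<beta> = \<alpha>(V := \<alpha> V - 1)"
    have \<beta>: "\<beta> \<in> idx k'" unfolding \<beta>_def by (rule idx_upd_minus) (use V Suc.prems k in auto)
    moreover have \<beta>s: "sum \<beta> (X - C) \<le> m"
      using eq V fin by (simp add: \<beta>_def sum.remove[of "X - C" V])
    ultimately have "c' \<beta> = 0" by (rule Suc.IH)
    moreover have "c (\<beta>(W := Suc (\<beta> W))) = 0"
    proof (rule low)
      show "\<beta>(W := Suc (\<beta> W)) \<in> idx k" unfolding k by (rule idx_upd[OF WX \<beta>])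
      have "sum (\<beta>(W := Suc (\<beta> W))) (X - C) = sum \<beta> (X - C)" by (rule sum.cong) (use W in auto)
      then show "sum (\<beta>(W := Suc (\<beta> W))) (X - C) \<le> m" using \<beta>s by simp
    qed
    moreover have "\<beta>(V := Suc (\<beta> V)) = \<alpha>" using V by (auto simp: \<beta>_def)
    ultimately show ?thesis by (simp add: c'_def del: of_nat_Suc)
  next
    case True
    then show ?thesis by (rule low[OF Suc.prems(2)])
  qed
qed

lemma vertices_hull: "C \<subseteq> X \<Longrightarrow> vertices (convex hull C) = C"
  unfolding vertices_def
  by (subst extreme_point_of_convex_hull_affine_independent) (use affine_independent_subset[OF indep] in auto)

end

section \<open>The Alfeld split in coordinates\<close>

locale alfeld = simplex_coords X l
  for X :: "(real ^ 'n) set" and l :: "real ^ 'n \<Rightarrow> real ^ 'n \<Rightarrow> real" +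
  fixes A :: "real ^ 'n"
  assumes l_A_pos: "V \<in> X \<Longrightarrow> 0 < l V A"

lemma (in simplex_coords) interior_imp_alfeld:
  assumes "A \<in> interior (convex hull X)"
  shows "alfeld X l A"
proof
  fix V assume V: "V \<in> X"
  obtain u where "\<forall>x\<in>X. 0 < u x" "sum u X = 1" "(\<Sum>x\<in>X. u x *\<^sub>R x) = A"
    using assms unfolding interior_convex_hull_explicit_minimal[OF indep] by (auto simp: card_X)
  then show "0 < l V A" using l_point[of X u V] V by auto
qed

context alfeld
begin

text \<open>The rescaled coordinates \<open>y V\<close> all equal \<open>1\<close> at \<open>A\<close>, and the cell opposite to \<open>V\<close> is the
  set of points of the simplex at which \<open>y V\<close> is minimal.\<close>

definition y :: "real ^ 'n \<Rightarrow> real ^ 'n \<Rightarrow> real" where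
  "y V x = l V x / l V A"

definition T :: "real ^ 'n \<Rightarrow> (real ^ 'n) set" where
  "T V = convex hull (insert A (X - {V}))"

lemma y_A: "V \<in> X \<Longrightarrow> y V A = 1"
  using l_A_pos[of V] by (simp add: y_def)

lemma y_nonneg_iff: "V \<in> X \<Longrightarrow> 0 \<le> y V x \<longleftrightarrow> 0 \<le> l V x"
  using l_A_pos[of V] by (simp add: y_def zero_le_divide_iff)

lemma y_in_polys: "V \<in> X \<Longrightarrow> y V \<in> polys 1"
  using polys_scale[OF l_in_polys, of V "1 / l V A"] by (simp add: y_def[abs_def])

lemma ex_other: "\<exists>W\<in>X. W \<noteq> V"
proof (rule ccontr)
  assume "\<not> ?thesis"
  then have "X \<subseteq> {V}" by auto
  then have "card X \<le> card {V}" by (intro card_mono) auto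
  then show False using card_X by simp
qed

lemma A_notin: "A \<notin> X"
proof
  assume "A \<in> X"
  moreover obtain W where "W \<in> X" "W \<noteq> A" using ex_other by blast
  ultimately show False using l_A_pos[of W] l_vertex[of W A] by auto
qed

text \<open>Give \<open>A\<close> the weight \<open>y V x\<close> and each vertex \<open>W\<close>
  the weight \<open>l W x - y V x * l W A\<close>. These weights reproduce \<open>x\<close>, the one
  of \<open>V\<close> is zero, and they are nonnegative when \<open>y V x\<close> is nonnegative and
  minimal. Conversely, the set described by the inequalities is convex and contains the vertices of
  the cell.\<close>

lemma mem_T:
  assumes V: "V \<in> X"
  shows "x \<in> T V \<longleftrightarrow> 0 \<le> y V x \<and> (\<forall>W\<in>X. y V x \<le> y W x)"
proof
  let ?H = "{x. 0 \<le> y V x \<and> (\<forall>W\<in>X. y V x \<le> y W x)}"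
  have comb: "y W (a *\<^sub>R x + b *\<^sub>R z) = a * y W x + b * y W z" if "W \<in> X" "a + b = 1" for W a b x z
    unfolding y_def l_comb2[OF that] by (simp add: add_divide_distrib)
  have "convex ?H"
    using V by (intro convexI) (simp add: comb add_mono mult_left_mono)
  moreover have "A \<in> ?H" using V by (simp add: y_A)
  moreover have "W \<in> ?H" if "W \<in> X - {V}" for W
    using V that less_imp_le[OF l_A_pos] by (auto simp: y_def l_vertex)
  then have "X - {V} \<subseteq> ?H" by blast
  ultimately have "T V \<subseteq> ?H" unfolding T_def by (intro hull_minimal insert_subsetI)
  then show "0 \<le> y V x \<and> (\<forall>W\<in>X. y V x \<le> y W x)" if "x \<in> T V" using that by auto
next
  assume x: "0 \<le> y V x \<and> (\<forall>W\<in>X. y V x \<le> y W x)"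
  define u where "u W = (if W = A then y V x else l W x - y V x * l W A)" for W
  have AV: "A \<notin> X - {V}" using A_notin by auto
  have uV: "l V x - y V x * l V A = 0" using l_A_pos[OF V] by (simp add: y_def)
  have u0: "0 \<le> u W" if "W \<in> insert A (X - {V})" for W
  proof (cases "W = A")
    case False
    then have W: "W \<in> X" using that by auto
    then have "y V x \<le> l W x / l W A" using x by (auto simp: y_def[of W])
    then show ?thesis using False l_A_pos[OF W] by (simp add: u_def field_simps)
  qed (use x in \<open>auto simp: u_def\<close>)
  have s1: "sum u (insert A (X - {V})) = 1"
  proof -
    have "sum u (insert A (X - {V})) = y V x + (\<Sum>W\<in>X - {V}. l W x - y V x * l W A)"
      using fin AV by (simp add: u_def) (intro sum.cong, auto simp: A_notin)
    also have "(\<Sum>W\<in>X - {V}. l W x - y V x * l W A) = (\<Sum>W\<in>X. l W x - y V x * l W A)"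
      using sum.remove[OF fin V, of "\<lambda>W. l W x - y V x * l W A"] uV by simp
    also have "y V x + \<dots> = 1"
      by (simp add: sum_subtractf sum_l sum_distrib_left[symmetric])
    finally show ?thesis .
  qed
  have s2: "(\<Sum>W\<in>insert A (X - {V}). u W *\<^sub>R W) = x"
  proof -
    have "(\<Sum>W\<in>insert A (X - {V}). u W *\<^sub>R W) = y V x *\<^sub>R A + (\<Sum>W\<in>X - {V}. (l W x - y V x * l W A) *\<^sub>R W)"
      using fin AV by (simp add: u_def) (intro sum.cong, auto simp: A_notin)
    also have "(\<Sum>W\<in>X - {V}. (l W x - y V x * l W A) *\<^sub>R W) = (\<Sum>W\<in>X. (l W x - y V x * l W A) *\<^sub>R W)"
      using sum.remove[OF fin V, of "\<lambda>W. (l W x - y V x * l W A) *\<^sub>R W"] uV by simp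
    also have "\<dots> = (\<Sum>W\<in>X. l W x *\<^sub>R W) - y V x *\<^sub>R (\<Sum>W\<in>X. l W A *\<^sub>R W)"
      by (simp add: scaleR_left_diff_distrib sum_subtractf scaleR_sum_right)
    also have "y V x *\<^sub>R A + \<dots> = x" by (simp add: expand)
    finally show ?thesis .
  qed
  show "x \<in> T V" unfolding T_def convex_hull_finite[OF finite.insertI[OF finite_Diff[OF fin]]]
    using u0 s1 s2 by blast
qed

lemma T_subset: "V \<in> X \<Longrightarrow> T V \<subseteq> convex hull X"
proof
  fix x assume "V \<in> X" "x \<in> T V"
  then have "0 \<le> y W x" if "W \<in> X" for W using mem_T[OF \<open>V \<in> X\<close>, of x] that by force
  then show "x \<in> convex hull X" using mem_hull[of X x] y_nonneg_iff by auto
qed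

lemma UN_T: "(\<Union>V\<in>X. T V) = convex hull X"
proof
  show "convex hull X \<subseteq> (\<Union>V\<in>X. T V)"
  proof
    fix x assume x: "x \<in> convex hull X"
    have "X \<noteq> {}" using card_X by auto
    define m where "m = Min ((\<lambda>V. y V x) ` X)"
    have "m \<in> (\<lambda>V. y V x) ` X" unfolding m_def using fin \<open>X \<noteq> {}\<close> by (intro Min_in) auto
    then obtain V where V: "V \<in> X" "y V x = m" by auto
    have "m \<le> y W x" if "W \<in> X" for W unfolding m_def using fin that by (intro Min_le) auto
    moreover have "0 \<le> m" using x V mem_hull[of X x] y_nonneg_iff[of V x] by auto
    ultimately have "x \<in> T V" using mem_T[OF V(1)] V by auto
    then show "x \<in> (\<Union>V\<in>X. T V)" using V by auto
  qed
qed (use T_subset in auto)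

lemma T_Int: "V \<in> X \<Longrightarrow> W \<in> X \<Longrightarrow> x \<in> T V \<Longrightarrow> x \<in> T W \<Longrightarrow> y V x = y W x"
  by (simp add: mem_T antisym)

lemma A_in_T: "A \<in> T V"
  unfolding T_def by (rule hull_inc) simp

text \<open>So the cells containing a face are indexed by \<open>X - C\<close>, and their number is
  its codimension. In particular a facet lies in one cell only.\<close>

lemma hull_subset_T_iff:
  assumes "C \<subseteq> X" "V \<in> X"
  shows "convex hull C \<subseteq> T V \<longleftrightarrow> V \<notin> C"
proof
  assume sub: "convex hull C \<subseteq> T V"
  show "V \<notin> C"
  proof
    assume "V \<in> C"
    then have "V \<in> T V" using sub hull_inc[of V C convex] by auto
    moreover obtain W where W: "W \<in> X" "W \<noteq> V" using ex_other by blast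
    ultimately have "y V V \<le> y W V" using mem_T[OF assms(2)] by auto
    then show False using W assms(2) l_A_pos[of V] by (simp add: y_def l_vertex)
  qed
next
  assume "V \<notin> C"
  then show "convex hull C \<subseteq> T V" unfolding T_def using assms by (intro hull_mono) auto
qed

lemma interior_T: "V \<in> X \<Longrightarrow> interior (T V) \<noteq> {}"
proof -
  assume V: "V \<in> X"
  have "A \<notin> affine hull (X - {V})"
  proof
    assume "A \<in> affine hull (X - {V})"
    then obtain u where u: "sum u (X - {V}) = 1" "(\<Sum>v\<in>X - {V}. u v *\<^sub>R v) = A"
      using affine_hull_finite[of "X - {V}"] fin by auto
    then have "l V A = 0" using l_point[of "X - {V}" u V] V by auto
    then show False using l_A_pos[OF V] by simp
  qed
  then have "\<not> affine_dependent (insert A (X - {V}))"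
    by (intro affine_independent_insert affine_independent_subset[OF indep]) auto
  moreover have "card (insert A (X - {V})) = Suc (DIM(real ^ 'n))"
    using fin V A_notin card_X by simp
  ultimately show ?thesis unfolding T_def by (simp add: interior_convex_hull_eq_empty)
qed

lemma closed_T: "closed (T V)"
  unfolding T_def using fin by (intro compact_imp_closed finite_imp_compact_convex_hull) auto

lemma closure_interior_T: "V \<in> X \<Longrightarrow> closure (interior (T V)) = T V"
  using convex_closure_interior[OF _ interior_T] closed_T by (simp add: T_def closure_closed)

lemma alfeld_split_eq: "alfeld_split A (convex hull X) = T ` X"
  by (simp add: alfeld_split_def vertices_hull T_def)

lemma cell_poly_eq:
  assumes "V \<in> X" "p \<in> polys k" "\<And>x. x \<in> T V \<Longrightarrow> p x = u x"
  shows "cell_poly k (T V) u = p"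
  unfolding cell_poly_def
proof (rule the_equality)
  show "p \<in> polys k \<and> (\<forall>x\<in>T V. p x = u x)" using assms by auto
  fix q assume "q \<in> polys k \<and> (\<forall>x\<in>T V. q x = u x)"
  then show "q = p" using assms by (intro polys_eq_if_eq_on_open[OF _ assms(2) interior_T[OF assms(1)]]) auto
qed

lemma subsimplex_iff:
  "subsimplex t F (convex hull X) \<longleftrightarrow> (\<exists>C\<subseteq>X. card C = t + 1 \<and> F = convex hull C)"
  by (simp add: subsimplex_def vertices_hull)

lemma card_compl: "C \<subseteq> X \<Longrightarrow> card (X - C) = Suc CARD('n) - card C"
  using card_Diff_subset[OF fin_sub] card_X by simp

text \<open>Each smoothness condition becomes the vanishing of a difference of pieces to some order.
  These conditions are linear in the family \<open>P\<close>, and both the extension of traces and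
  the closure under linear combinations go through them. Order zero on the interfaces makes the
  choice of a cell in \<open>u\<close> immaterial.\<close>

lemma superspline_of_pieces:
  assumes P: "\<And>V. V \<in> X \<Longrightarrow> P V \<in> polys k"
    and int: "\<And>V W. V \<in> X \<Longrightarrow> W \<in> X \<Longrightarrow> (\<lambda>x. P V x - P W x) \<in> vanishing k (Suc (r 1)) (T V \<inter> T W)"
    and centre: "\<And>V W. V \<in> X \<Longrightarrow> W \<in> X \<Longrightarrow> (\<lambda>x. P V x - P W x) \<in> vanishing k (Suc \<rho>) {A}"
    and faces: "\<And>C V W. C \<subseteq> X \<Longrightarrow> C \<noteq> {} \<Longrightarrow> 2 \<le> card (X - C) \<Longrightarrow> V \<in> X - C \<Longrightarrow> W \<in> X - C \<Longrightarrow>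
      (\<lambda>x. P V x - P W x) \<in> vanishing k (Suc (r (card (X - C)))) (convex hull C)"
  shows "\<exists>u\<in>superspline k r \<rho> A (convex hull X). \<forall>V\<in>X. cell_poly k (T V) u = P V"
proof -
  define u where "u x = (if x \<in> convex hull X then P (SOME V. V \<in> X \<and> x \<in> T V) x else 0)" for x
  have derivs: "partial_derivs is (P V) x = partial_derivs is (P W) x"
    if "V \<in> X" "W \<in> X" "(\<lambda>x. P V x - P W x) \<in> vanishing k (Suc n) F" "x \<in> F" "length is \<le> n" for V W n F x "is"
  proof -
    have "partial_derivs is (\<lambda>x. P V x - P W x) x = 0"
      using that by (simp add: vanishing_def)
    then show ?thesis
      using fun_cong[OF partial_derivs_diff[OF P[OF that(1)] P[OF that(2)]], of "is" x] by simp
  qed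
  have u: "u x = P V x" if V: "V \<in> X" "x \<in> T V" for V x
  proof -
    have "x \<in> convex hull X" using T_subset that by auto
    moreover define W where "W = (SOME V. V \<in> X \<and> x \<in> T V)"
    have W: "W \<in> X \<and> x \<in> T W"
      unfolding W_def by (rule someI[of "\<lambda>V. V \<in> X \<and> x \<in> T V" V]) (use that in simp)
    have "P W x = P V x"
      using derivs[OF conjunct1[OF W] V(1) int[OF conjunct1[OF W] V(1)], of x "[]"] V W by simp
    ultimately show ?thesis by (simp add: u_def W_def)
  qed
  have cp: "cell_poly k (T V) u = P V" if "V \<in> X" for V
    using cell_poly_eq[OF that P[OF that]] u[OF that] by simp
  have sv: "single_valued k A (convex hull X) u n F"
    if "\<And>V W. V \<in> X \<Longrightarrow> W \<in> X \<Longrightarrow> F \<subseteq> T V \<Longrightarrow> F \<subseteq> T W \<Longrightarrow> (\<lambda>x. P V x - P W x) \<in> vanishing k (Suc n) F" for n F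
    unfolding single_valued_def alfeld_split_eq same_trace_def
  proof (intro ballI impI allI, elim imageE conjE)
    fix S S' V W x and "is" :: "'n list"
    assume "length is = n" "x \<in> F" "F \<subseteq> S" "F \<subseteq> S'" "S = T V" "S' = T W" and VW: "V \<in> X" "W \<in> X"
    then show "partial_derivs is (cell_poly k S u) x = partial_derivs is (cell_poly k S' u) x"
      using derivs[OF VW that[OF VW]] cp VW by simp
  qed
  have "u \<in> superspline k r \<rho> A (convex hull X)"
    unfolding superspline_def
  proof (intro CollectI conjI allI impI ballI)
    show "u x = 0" if "x \<notin> convex hull X" for x using that by (simp add: u_def)
    show "C_upto (r 1) (convex hull X) u"
    proof (rule C_upto_piecewise[where T = T and P = P, OF fin closed_T P UN_T u])
      show "partial_derivs is (P V) x = partial_derivs is (P W) x"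
        if "V \<in> X" "W \<in> X" "x \<in> T V" "x \<in> T W" "length is \<le> r 1" for V W x "is"
        using derivs[OF that(1,2) int[OF that(1,2)]] that by simp
    qed
    show "\<exists>p\<in>polys k. \<forall>x\<in>S. p x = u x" if "S \<in> alfeld_split A (convex hull X)" for S
    proof -
      obtain V where "V \<in> X" "S = T V" using \<open>S \<in> alfeld_split A (convex hull X)\<close> alfeld_split_eq by auto
      then show ?thesis using P u by (intro bexI[of _ "P V"]) auto
    qed
    show "single_valued k A (convex hull X) u n {A}" if "n \<le> \<rho>" for n
      by (rule sv) (use vanishing_mono[OF centre] that in auto)
    fix t F n
    assume *: "t + 2 \<le> CARD('n) \<and> subsimplex t F (convex hull X) \<and> n \<le> r (CARD('n) - t)"
    then obtain C where C: "C \<subseteq> X" "card C = t + 1" "F = convex hull C" by (auto simp: subsimplex_iff)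
    \<comment> \<open>A face misses as many vertices as its codimension.\<close>
    have c: "card (X - C) = CARD('n) - t" using card_compl[OF C(1)] C(2) by simp
    show "single_valued k A (convex hull X) u n F"
    proof (rule sv)
      fix V W assume VW: "V \<in> X" "W \<in> X" "F \<subseteq> T V" "F \<subseteq> T W"
      have "(\<lambda>x. P V x - P W x) \<in> vanishing k (Suc (r (card (X - C)))) (convex hull C)"
        by (rule faces) (use VW C * c hull_subset_T_iff[OF C(1)] in auto)
      then show "(\<lambda>x. P V x - P W x) \<in> vanishing k (Suc n) F"
        by (rule vanishing_mono) (use C c * in auto)
    qed
  qed
  then show ?thesis using cp by blast
qed

end

section \<open>Integrals of univariate polynomials\<close>

lemma poly_antiderivative:
  fixes q :: "real poly"
  shows "\<exists>F. pderiv F = q \<and> poly F 0 = 0 \<and> degree F \<le> Suc (degree q)"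
proof -
  define F where "F = (\<Sum>i\<le>degree q. monom (coeff q i / real (Suc i)) (Suc i))"
  have "pderiv F = (\<Sum>i\<le>degree q. monom (coeff q i) i)"
    unfolding F_def using higher_pderiv_sum[of 1 "\<lambda>i. monom (coeff q i / real (Suc i)) (Suc i)" "{..degree q}"]
    by (simp add: pderiv_monom del: of_nat_Suc)
  then have "pderiv F = q" by (simp add: poly_as_sum_of_monoms)
  moreover have "poly F 0 = 0" by (simp add: F_def poly_sum poly_monom)
  moreover have "degree F \<le> Suc (degree q)"
    unfolding F_def by (intro degree_sum_le) (auto intro: order_trans[OF degree_monom_le])
  ultimately show ?thesis by blast
qed

definition antideriv :: "real poly \<Rightarrow> real poly" where
  "antideriv q = (SOME F. pderiv F = q \<and> poly F 0 = 0 \<and> degree F \<le> Suc (degree q))"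

lemma pderiv_antideriv: "pderiv (antideriv q) = q"
  and poly_antideriv_0: "poly (antideriv q) 0 = 0"
  and degree_antideriv: "degree (antideriv q) \<le> Suc (degree q)"
  using someI_ex[OF poly_antiderivative[of q]] by (auto simp: antideriv_def)

text \<open>Substituting \<open>t = a x + s * (b x - a x)\<close> moves the variable limits to 0 and
  1 at the price of the factor \<open>b x - a x\<close>, which itself contributes an order of
  vanishing where the limits coincide.\<close>

lemma fun_subspace_antideriv:
  fixes Q :: "'a \<Rightarrow> real poly"
  assumes S: "fun_subspace S" and deg: "\<And>x. degree (Q x) \<le> n"
    and mem: "\<And>s. (\<lambda>x. (b x - a x) * poly (Q x) (a x + s * (b x - a x))) \<in> S"
  shows "(\<lambda>x. poly (antideriv (Q x)) (b x) - poly (antideriv (Q x)) (a x)) \<in> S"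
proof -
  define H where "H x = pcompose (antideriv (Q x)) [:a x, b x - a x:]" for x
  have "degree (H x) \<le> Suc n" for x
  proof -
    have "degree (H x) \<le> degree (antideriv (Q x)) * degree [:a x, b x - a x:]"
      unfolding H_def by (rule degree_pcompose_le)
    also have "\<dots> \<le> Suc n * 1"
      by (rule mult_le_mono) (use degree_antideriv[of "Q x"] deg[of x] in auto)
    finally show ?thesis by simp
  qed
  moreover have "(\<lambda>x. poly (pderiv (H x)) s) \<in> S" for s
    using mem[of s] by (simp add: H_def pderiv_pcompose pderiv_antideriv poly_pcompose pderiv_pCons mult.commute)
  ultimately have "(\<lambda>x. poly (H x) 1 - poly (H x) 0) \<in> S"
    by (rule fun_subspace_integral[OF S])
  then show ?thesis by (simp add: H_def poly_pcompose)
qed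

context alfeld
begin

text \<open>On the cell opposite to \<open>V\<close> the correction functions below are
  \<open>\<integral> t\<^sup>\<gamma> (\<Prod>W. (y W - t)\<^bsup>\<beta> W\<^esup>) dt\<close> over \<open>[0, y V]\<close>. On the interface of the cells of \<open>V\<close> and \<open>W\<close>, where
  \<open>y V = y W\<close>, two of them agree to order \<open>\<beta> V + \<beta> W\<close>, and at \<open>A\<close> to order \<open>\<Sum>W. \<beta> W\<close>.\<close>

definition kernel :: "nat \<Rightarrow> (real ^ 'n \<Rightarrow> nat) \<Rightarrow> real ^ 'n \<Rightarrow> real poly" where
  "kernel \<gamma> \<beta> x = [:0, 1:] ^ \<gamma> * (\<Prod>V\<in>X. [:y V x, -1:] ^ \<beta> V)"

lemma poly_kernel: "poly (kernel \<gamma> \<beta> x) t = t ^ \<gamma> * (\<Prod>V\<in>X. (y V x - t) ^ \<beta> V)"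
  by (simp add: kernel_def poly_prod)

lemma degree_kernel: "degree (kernel \<gamma> \<beta> x) \<le> \<gamma> + sum \<beta> X"
proof -
  have "degree (\<Prod>V\<in>X. [:y V x, -1:] ^ \<beta> V) \<le> sum (degree \<circ> (\<lambda>V. [:y V x, -1:] ^ \<beta> V)) X"
    by (rule degree_prod_sum_le[OF fin])
  also have "\<dots> \<le> sum \<beta> X"
    by (intro sum_mono) (auto intro: order_trans[OF degree_power_le])
  finally have "degree (\<Prod>V\<in>X. [:y V x, -1:] ^ \<beta> V) \<le> sum \<beta> X" .
  moreover have "degree ([:0, 1:] ^ \<gamma> :: real poly) \<le> \<gamma>"
    by (rule order_trans[OF degree_power_le]) simp
  ultimately show ?thesis
    unfolding kernel_def by (intro order_trans[OF degree_mult_le] add_mono)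
qed

text \<open>Orders add: \<open>m1\<close> comes from the length of the interval of integration,
  \<open>m2\<close> from each factor \<open>t\<close>, and \<open>m V\<close> from each factor
  \<open>y V x - t\<close>, where \<open>t = a x + s * (b x - a x)\<close>. The estimates on
  interfaces, on faces and at the split point are instances with different limits and
  orders.\<close>

lemma kernel_vanishing:
  assumes d: "(\<lambda>x. b x - a x) \<in> vanishing 1 m1 Y"
    and t: "\<And>s. (\<lambda>x. a x + s * (b x - a x)) \<in> vanishing 1 m2 Y"
    and f: "\<And>s V. V \<in> X \<Longrightarrow> (\<lambda>x. y V x - (a x + s * (b x - a x))) \<in> vanishing 1 (m V) Y"
    and n: "n \<le> m1 + \<gamma> * m2 + (\<Sum>V\<in>X. \<beta> V * m V)" and deg: "Suc (\<gamma> + sum \<beta> X) \<le> k"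
  shows "(\<lambda>x. poly (antideriv (kernel \<gamma> \<beta> x)) (b x) - poly (antideriv (kernel \<gamma> \<beta> x)) (a x)) \<in> vanishing k n Y"
proof (rule fun_subspace_antideriv[OF fun_subspace_vanishing degree_kernel])
  fix s
  have "(\<lambda>x. (y V x - (a x + s * (b x - a x))) ^ \<beta> V) \<in> vanishing (\<beta> V) (\<beta> V * m V) Y" if "V \<in> X" for V
    using vanishing_power[OF f[OF that, of s], of "\<beta> V"] by simp
  from vanishing_prod[OF fin this]
  have "(\<lambda>x. \<Prod>V\<in>X. (y V x - (a x + s * (b x - a x))) ^ \<beta> V) \<in> vanishing (sum \<beta> X) (\<Sum>V\<in>X. \<beta> V * m V) Y" .
  from vanishing_mult[OF d vanishing_mult[OF vanishing_power[OF t[of s], of \<gamma>] this]]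
  show "(\<lambda>x. (b x - a x) * poly (kernel \<gamma> \<beta> x) (a x + s * (b x - a x))) \<in> vanishing k n Y"
    unfolding poly_kernel by (rule vanishing_mono) (use n deg in auto)
qed

end

section \<open>Extension of traces into the superspline space\<close>

text \<open>The numerical hypotheses over the natural numbers: \<open>r12\<close> is the ceiling
  bound, \<open>r_double\<close> is the chain of inequalities after cancelling powers of two, and
  subtractions are moved to the other side.\<close>

locale superspline_params = alfeld X l A
  for X :: "(real ^ 'n) set" and l :: "real ^ 'n \<Rightarrow> real ^ 'n \<Rightarrow> real" and A :: "real ^ 'n" +
  fixes r :: "nat \<Rightarrow> nat" and \<rho> k b :: nat
  assumes dim: "2 \<le> CARD('n)" and r1: "1 \<le> r 1" and r12: "3 * r 1 \<le> 2 * r 2 + 1"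
    and r2: "r 2 + 1 \<le> 2 * r 1"
    and r_double: "2 \<le> i \<Longrightarrow> i < CARD('n) \<Longrightarrow> 2 * r i \<le> r (Suc i)"
    and k: "2 * r CARD('n) + 1 \<le> k" and \<rho>: "k = \<rho> + b"
    and b1: "2 * r 1 \<le> r 2 + b" and b2: "b + r 1 \<le> r 2 + 1"
begin

lemma r1_le_r2: "r 1 \<le> r 2"
  using r12 r1 by linarith

lemma r_mono:
  assumes "2 \<le> i" "i \<le> j" "j \<le> CARD('n)"
  shows "r i \<le> r j"
  using assms(2,3,1)
proof (induction j rule: dec_induct)
  case (step j)
  then show ?case using r_double[of j] by simp
qed simp

lemma r1_le:
  assumes "2 \<le> i" "i \<le> CARD('n)"
  shows "r 1 \<le> r i"
  using r_mono[of 2 i] r1_le_r2 assms by simp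

lemma r_double_less:
  assumes "2 \<le> i" "i < j" "j \<le> CARD('n)"
  shows "2 * r i \<le> r j"
  using r_double[of i] r_mono[of "Suc i" j] assms by simp

text \<open>\<open>card (X - C)\<close> is the codimension of the face spanned by \<open>C\<close>,
  so this is the order prescribed there, with \<open>r 1\<close> for facets.\<close>

definition face_order :: "(real ^ 'n) set \<Rightarrow> nat" where
  "face_order C = r (card (X - C))"

abbreviation flat_on :: "(real ^ 'n) set \<Rightarrow> (real ^ 'n \<Rightarrow> real) set" where
  "flat_on C \<equiv> vanishing k (Suc (face_order C)) (convex hull C)"

lemma card_compl_le: "C \<subseteq> X \<Longrightarrow> C \<noteq> {} \<Longrightarrow> card (X - C) \<le> CARD('n)"
  using card_compl[of C] fin_sub[of C] by (cases "card C") auto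

text \<open>On faces of codimension at least two, dropping all Bernstein terms of high order on the face
  suffices: \<open>2 r\<^sub>i \<le> r\<^sub>i\<^sub>+\<^sub>1\<close> makes a term that is low on two faces low on their intersection.\<close>

lemma truncated_extension:
  assumes C: "C \<subseteq> X" "C \<noteq> {}" "2 \<le> card (X - C)" and p: "p \<in> polys k"
    and bd: "\<And>C'. C' \<subset> C \<Longrightarrow> C' \<noteq> {} \<Longrightarrow> p \<in> flat_on C'"
  shows "\<exists>q\<in>polys k. (\<lambda>x. p x - q x) \<in> flat_on C \<and>
    (\<forall>C'\<subseteq>X. C' \<noteq> {} \<longrightarrow> C' \<noteq> C \<longrightarrow> card C' \<le> card C \<longrightarrow>
      q \<in> flat_on C')"
proof -
  obtain c where c: "p = (\<lambda>x. \<Sum>\<alpha>\<in>idx k. c \<alpha> * bern \<alpha> x)"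
    using polys_bern_expansion[OF p] by blast
  have coeff: "c \<alpha> = 0" if "C' \<subset> C" "C' \<noteq> {}" "\<alpha> \<in> idx k" "sum \<alpha> (X - C') \<le> face_order C'" for C' \<alpha>
    by (rule bern_coeff_zero[OF _ that(2) _ that(3,4)]) (use that C bd[OF that(1,2)] c in auto)
  \<comment> \<open>The terms visible in the trace on \<open>C\<close>; all others vanish there to
    sufficient order.\<close>
  define S where "S = {\<alpha> \<in> idx k. sum \<alpha> (X - C) \<le> face_order C}"
  define q where "q = (\<lambda>x. \<Sum>\<alpha>\<in>S. c \<alpha> * bern \<alpha> x)"
  have van: "bern \<alpha> \<in> vanishing k (sum \<alpha> (X - C')) (convex hull C')" if "\<alpha> \<in> idx k" "C' \<subseteq> X" for \<alpha> C'
    using bern_vanishing[OF that(1), of "X - C'"] that(2) by (simp add: double_diff)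
  have "q \<in> polys k" unfolding q_def S_def
    by (intro polys_sum polys_scale bern_in_polys) simp
  moreover have "(\<lambda>x. p x - q x) \<in> flat_on C"
  proof -
    have "p x - q x = (\<Sum>\<alpha>\<in>idx k - S. c \<alpha> * bern \<alpha> x)" for x
    proof -
      have "p x = (\<Sum>\<alpha>\<in>idx k - S. c \<alpha> * bern \<alpha> x) + (\<Sum>\<alpha>\<in>S. c \<alpha> * bern \<alpha> x)"
        unfolding c by (rule sum.subset_diff) (auto simp: S_def finite_idx)
      then show ?thesis by (simp add: q_def)
    qed
    then have "(\<lambda>x. p x - q x) = (\<lambda>x. \<Sum>\<alpha>\<in>idx k - S. c \<alpha> * bern \<alpha> x)" by simp
    also have "\<dots> \<in> flat_on C"
    proof (intro vanishing_sum vanishing_scale)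
      fix \<alpha> assume "\<alpha> \<in> idx k - S"
      then show "bern \<alpha> \<in> flat_on C"
        by (intro vanishing_mono[OF van[of \<alpha> C]]) (use C in \<open>auto simp: S_def\<close>)
    qed
    finally show ?thesis .
  qed
  moreover have "q \<in> flat_on C'"
    if C': "C' \<subseteq> X" "C' \<noteq> {}" "C' \<noteq> C" "card C' \<le> card C" for C'
    unfolding q_def
  proof (intro vanishing_sum)
    fix \<alpha> assume \<alpha>: "\<alpha> \<in> S"
    then have \<alpha>k: "\<alpha> \<in> idx k" and \<alpha>C: "sum \<alpha> (X - C) \<le> face_order C" by (auto simp: S_def)
    show "(\<lambda>x. c \<alpha> * bern \<alpha> x) \<in> flat_on C'"
    proof (cases "sum \<alpha> (X - C') \<le> face_order C'")
      case False
      then show ?thesis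
        by (intro vanishing_scale vanishing_mono[OF van[OF \<alpha>k C'(1)]]) auto
    next
      case True
      \<comment> \<open>The index is low on both \<open>C\<close> and \<open>C'\<close>. Unless
        \<open>C'\<close> is itself inside \<open>C\<close>, its exponent sum off the intersection
        is at most \<open>2 * face_order C'\<close>, and the doubling of the orders makes it low on
        the intersection, a proper face of \<open>C\<close> on which \<open>p\<close> is
        flat.\<close>
      have "c \<alpha> = 0"
      proof (cases "C' \<subset> C")
        case sub: True
        show ?thesis by (rule coeff[OF sub C'(2) \<alpha>k True])
      next
        case notsub: False
        have fC: "finite C" "finite C'" using fin_sub C C' by auto
        have le: "card (X - C) \<le> card (X - C')" using C' card_compl C by simp
        have "card (X - C') \<le> CARD('n)"
          by (rule card_compl_le[OF C'(1,2)])
        then have oC: "face_order C \<le> face_order C'" unfolding face_order_def using r_mono[OF C(3) le] by simp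
        have un: "X - (C \<inter> C') = (X - C) \<union> (X - C')" by auto
        have "sum \<alpha> (X - (C \<inter> C')) \<le> sum \<alpha> (X - C) + sum \<alpha> (X - C')"
          unfolding un using fin by (subst sum.union_inter[symmetric]) auto
        then have s: "sum \<alpha> (X - (C \<inter> C')) \<le> 2 * face_order C'" using True \<alpha>C oC by simp
        \<comment> \<open>For disjoint faces the exponents off the one and off the other account for
          all of \<open>k\<close>, which \<open>2 * r CARD('n) + 1 \<le> k\<close> excludes.\<close>
        have ne: "C \<inter> C' \<noteq> {}"
        proof
          assume "C \<inter> C' = {}"
          then have "k \<le> 2 * face_order C'" using s \<alpha>k by (simp add: idx_def)
          moreover have "face_order C' \<le> r CARD('n)" unfolding face_order_def
            using r_mono[of "card (X - C')" "CARD('n)"] le C \<open>card (X - C') \<le> CARD('n)\<close> by simp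
          ultimately show False using k by simp
        qed
        have pC: "C \<inter> C' \<subset> C"
        proof -
          have "\<not> C \<subseteq> C'" using C'(3,4) fC by (metis card_seteq)
          then show ?thesis by blast
        qed
        have pC': "C \<inter> C' \<subset> C'" using notsub C'(3) by blast
        have "X - C' \<subset> X - (C \<inter> C')" using pC' C'(1) by blast
        then have lt: "card (X - C') < card (X - (C \<inter> C'))" using fin by (intro psubset_card_mono) auto
        have "card (X - (C \<inter> C')) \<le> CARD('n)"
          by (rule card_compl_le[OF _ ne]) (use C'(1) in blast)
        then have "2 * face_order C' \<le> face_order (C \<inter> C')"
          unfolding face_order_def using r_double_less[of "card (X - C')"] lt le C(3) by simp
        then show ?thesis by (intro coeff[OF pC ne \<alpha>k]) (use s in simp)
      qed
      then show ?thesis using vanishing_zero by simp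
    qed
  qed
  ultimately show ?thesis by blast
qed


text \<open>A family of pieces is encoded as one function of pairs (cell index, point), so that the
  results on subspaces of functions apply to it. Away from the facet opposite to \<open>Z\<close>
  each piece has to be flat by itself, not only the differences; \<open>V \<in> X - C\<close>
  selects the cells that contain the face.\<close>

definition facet_family :: "real ^ 'n \<Rightarrow> ((real ^ 'n) \<times> (real ^ 'n) \<Rightarrow> real) set" where
  "facet_family Z = {P.
    (\<forall>V\<in>X. (\<lambda>x. P (V, x)) \<in> polys k) \<and>
    (\<forall>V\<in>X. \<forall>W\<in>X. (\<lambda>x. P (V, x) - P (W, x)) \<in> vanishing k (Suc (r 1)) (T V \<inter> T W)) \<and>
    (\<forall>V\<in>X. \<forall>W\<in>X. (\<lambda>x. P (V, x) - P (W, x)) \<in> vanishing k (Suc \<rho>) {A}) \<and>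
    (\<forall>C V. C \<subseteq> X \<longrightarrow> C \<noteq> {} \<longrightarrow> C \<noteq> X - {Z} \<longrightarrow> V \<in> X - C \<longrightarrow>
      (\<lambda>x. P (V, x)) \<in> flat_on C)}"

lemma facet_family_faces:
  assumes "P \<in> facet_family Z" "C \<subseteq> X" "C \<noteq> {}" "C \<noteq> X - {Z}" "V \<in> X - C"
  shows "(\<lambda>x. P (V, x)) \<in> flat_on C"
  using assms by (simp add: facet_family_def)

lemma fun_subspace_facet_family: "fun_subspace (facet_family Z)"
proof -
  have d: "(\<lambda>x. P (V, x) + P' (V, x) - (P (W, x) + P' (W, x))) \<in> S"
    if "fun_subspace S" "(\<lambda>x. P (V, x) - P (W, x)) \<in> S" "(\<lambda>x. P' (V, x) - P' (W, x)) \<in> S"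
    for P P' :: "(real ^ 'n) \<times> (real ^ 'n) \<Rightarrow> real" and V W S
    using fun_subspace_add[OF that] by (simp add: algebra_simps)
  have m: "(\<lambda>x. c * P (V, x) - c * P (W, x)) \<in> S"
    if "fun_subspace S" "(\<lambda>x. P (V, x) - P (W, x)) \<in> S"
    for P :: "(real ^ 'n) \<times> (real ^ 'n) \<Rightarrow> real" and c V W S
    using fun_subspace_scale[OF that, of c] by (simp add: algebra_simps)
  show ?thesis
    unfolding fun_subspace_def
  proof (intro conjI ballI allI)
    show "(\<lambda>x. 0) \<in> facet_family Z"
      by (simp add: facet_family_def polys_zero vanishing_zero)
    fix P P' c assume P: "P \<in> facet_family Z"
    then show "(\<lambda>x. c * P x) \<in> facet_family Z"
      by (simp add: facet_family_def polys_scale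
          vanishing_scale m[OF fun_subspace_vanishing])
    assume "P' \<in> facet_family Z"
    with P show "(\<lambda>x. P x + P' x) \<in> facet_family Z"
      by (simp add: facet_family_def polys_add
          vanishing_add d[OF fun_subspace_vanishing])
  qed
qed

text \<open>Admissibility is assumed inside the facet only. A face through \<open>Z\<close> is
  handled by deleting \<open>Z\<close>: the smaller face has at least twice the order, and putting
  \<open>Z\<close> back costs at most \<open>\<alpha> Z \<le> r 1\<close>. For the vertex
  \<open>Z\<close> alone the deletion would leave nothing, and
  \<open>2 * r CARD('n) + 1 \<le> k\<close> takes over.\<close>

lemma admissible_order:
  assumes Z: "Z \<in> X" and \<alpha>: "\<alpha> \<in> idx k" "\<alpha> Z \<le> r 1"
    and adm: "\<And>C. C \<subset> X - {Z} \<Longrightarrow> C \<noteq> {} \<Longrightarrow> face_order C < sum \<alpha> (X - C)"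
    and C: "C \<subseteq> X" "C \<noteq> {}" "2 \<le> card (X - C)"
  shows "face_order C < sum \<alpha> (X - C)"
proof (cases "Z \<in> C")
  case False
  have "C \<noteq> X - {Z}"
  proof
    assume "C = X - {Z}"
    then have "X - C = {Z}" using Z by auto
    then show False using C(3) by simp
  qed
  then show ?thesis using False C by (intro adm) auto
next
  case True
  have le: "card (X - C) \<le> CARD('n)" by (rule card_compl_le[OF C(1,2)])
  have o1: "r 1 \<le> face_order C" unfolding face_order_def by (rule r1_le[OF C(3) le])
  show ?thesis
  proof (cases "C = {Z}")
    case CZ: True
    have "face_order C \<le> r CARD('n)" unfolding face_order_def by (rule r_mono[OF C(3) le]) simp
    moreover have "sum \<alpha> X = \<alpha> Z + sum \<alpha> (X - C)" unfolding CZ by (rule sum.remove[OF fin Z])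
    ultimately show ?thesis using \<alpha> k o1 by (simp add: idx_def)
  next
    case CZ: False
    define C' where "C' = C - {Z}"
    have C': "C' \<noteq> {}" "C' \<subset> X - {Z}"
    proof -
      show "C' \<noteq> {}" using CZ C(2) by (auto simp: C'_def)
      have "C \<noteq> X" using C(3) by auto
      then show "C' \<subset> X - {Z}" using C(1) True by (auto simp: C'_def)
    qed
    have e: "X - C' = insert Z (X - C)" using Z True by (auto simp: C'_def)
    have ZC: "Z \<notin> X - C" using True by simp
    have card: "card (X - C') = Suc (card (X - C))" unfolding e using fin ZC by simp
    have "C' \<subseteq> X" using C' by auto
    from card_compl_le[OF this C'(1)] have "2 * face_order C \<le> face_order C'"
      unfolding face_order_def card by (intro r_double[OF C(3)]) simp
    moreover have "face_order C' < sum \<alpha> (X - C')" by (rule adm[OF C'(2,1)])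
    moreover have "sum \<alpha> (X - C') = \<alpha> Z + sum \<alpha> (X - C)" unfolding e using fin ZC by simp
    ultimately show ?thesis using \<alpha> o1 by linarith
  qed
qed

text \<open>This is admissibility on the codimension two face that misses just \<open>V\<close> and
  \<open>Z\<close>, nonempty because the dimension is at least two. The estimates for \<gamma> start
  from this lower bound on the exponent of \<open>V\<close>.\<close>

lemma admissible_facet:
  assumes Z: "Z \<in> X" and V: "V \<in> X" "V \<noteq> Z"
    and adm: "\<And>C. C \<subset> X - {Z} \<Longrightarrow> C \<noteq> {} \<Longrightarrow> face_order C < sum \<alpha> (X - C)"
  shows "r 2 < \<alpha> V + \<alpha> Z"
proof -
  define C where "C = X - {V, Z}"
  have e: "X - C = {V, Z}" using Z V by (auto simp: C_def)
  have "card C = card X - card {V, Z}" unfolding C_def using Z V by (intro card_Diff_subset) auto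
  then have "C \<noteq> {}" using V(2) card_X dim by auto
  moreover have "C \<subset> X - {Z}" using V by (auto simp: C_def)
  ultimately have "face_order C < sum \<alpha> (X - C)" by (intro adm)
  then show ?thesis unfolding face_order_def e using V(2) by (simp add: numeral_2_eq_2)
qed

text \<open>For \<open>\<alpha> Z = 0\<close> the polynomial itself serves on every cell, since
  admissibility makes it flat on all other faces. Otherwise it need not be flat on the other facets,
  and the integral family replaces it. Only the leading term on the facet has to agree, because
  \<open>facet_extension\<close> removes the remainder order by order.\<close>

lemma facet_monomial:
  assumes Z: "Z \<in> X" and \<alpha>: "\<alpha> \<in> idx k" "\<alpha> Z \<le> r 1"
    and adm: "\<And>C. C \<subset> X - {Z} \<Longrightarrow> C \<noteq> {} \<Longrightarrow> face_order C < sum \<alpha> (X - C)"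
  shows "\<exists>P\<in>facet_family Z. (\<lambda>x. bern \<alpha> x - P (Z, x)) \<in> vanishing k (Suc (\<alpha> Z)) (convex hull (X - {Z}))"
proof (cases "\<alpha> Z = 0")
  case True
  have "bern \<alpha> \<in> flat_on C"
    if C: "C \<subseteq> X" "C \<noteq> {}" "C \<noteq> X - {Z}" "V \<in> X - C" for C V
  proof -
    have "face_order C < sum \<alpha> (X - C)"
    proof (cases "2 \<le> card (X - C)")
      case True
      show ?thesis by (rule admissible_order[OF Z \<alpha> _ C(1,2) True]) (rule adm)
    next
      case False
      have "card (X - C) > 0" using C(4) fin by (auto simp: card_gt_0_iff)
      with False have c1: "card (X - C) = 1" by linarith
      then obtain W where "X - C = {W}" by (auto simp: card_1_singleton_iff)
      then have e: "X - C = {V}" using C(4) by simp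
      have "V \<noteq> Z" using C e Z by auto
      then have "r 2 < \<alpha> V" using admissible_facet[OF Z _ _ adm, of V] C(4) \<open>\<alpha> Z = 0\<close> by auto
      then show ?thesis using r1_le_r2 unfolding face_order_def e by simp
    qed
    then have "Suc (face_order C) \<le> sum \<alpha> (X - C)" by simp
    moreover have "bern \<alpha> \<in> vanishing k (sum \<alpha> (X - C)) (convex hull C)"
      using bern_vanishing[OF \<alpha>(1), of "X - C"] C(1) by (simp add: double_diff)
    ultimately show ?thesis by (simp add: vanishing_def)
  qed
  then have "(\<lambda>(V, x). bern \<alpha> x) \<in> facet_family Z"
    using bern_in_polys[OF \<alpha>(1)] by (simp add: facet_family_def vanishing_zero)
  moreover have "(\<lambda>x. bern \<alpha> x - (case (Z, x) of (V, x) \<Rightarrow> bern \<alpha> x)) \<in> vanishing k (Suc (\<alpha> Z)) (convex hull (X - {Z}))"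
    by (simp add: vanishing_zero)
  ultimately show ?thesis by (intro bexI)
next
  case False
  define m where "m = \<alpha> Z"
  have m: "1 \<le> m" "m \<le> r 1" using False \<alpha>(2) by (auto simp: m_def)
  \<comment> \<open>the least \<open>\<gamma>\<close> for which the pieces vanish to order \<open>r 1\<close> on the other facets\<close>
  define \<gamma> where "\<gamma> = (m - 1) - (r 2 - r 1)"
  have \<gamma>: "\<gamma> \<le> m - 1" "\<gamma> + 1 \<le> b" "\<gamma> + r 1 \<le> r 2" "m + r 1 \<le> Suc (\<gamma> + r 2)"
    using m r1_le_r2 b1 r2 r12 unfolding \<gamma>_def by linarith+
  \<comment> \<open>Integration raises the degree by one and \<open>t ^ \<gamma>\<close> contributes
    \<open>\<gamma>\<close>, so the exponent of \<open>Z\<close> drops by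
    \<open>\<gamma> + 1\<close> to keep the total degree \<open>k\<close>.\<close>
  define \<beta> where "\<beta> = \<alpha>(Z := m - 1 - \<gamma>)"
  have \<beta>V: "\<beta> V = \<alpha> V" if "V \<noteq> Z" for V using that by (simp add: \<beta>_def)
  have \<beta>Z: "\<beta> Z = m - 1 - \<gamma>" by (simp add: \<beta>_def)
  have sum_in: "sum \<beta> L + Suc \<gamma> = sum \<alpha> L" if "Z \<in> L" "L \<subseteq> X" for L
  proof -
    have fL: "finite L" by (rule fin_sub[OF that(2)])
    have "sum \<beta> (L - {Z}) = sum \<alpha> (L - {Z})" by (rule sum.cong) (auto simp: \<beta>_def)
    then show ?thesis using sum.remove[OF fL that(1), of \<alpha>] sum.remove[OF fL that(1), of \<beta>] \<gamma>(1) m \<beta>Z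
      by (simp add: m_def)
  qed
  have sum_out: "sum \<beta> L = sum \<alpha> L" if "Z \<notin> L" for L
    by (rule sum.cong) (use that in \<open>auto simp: \<beta>_def\<close>)
  have tot: "Suc (\<gamma> + sum \<beta> X) = k" using sum_in[OF Z] \<alpha>(1) by (simp add: idx_def)
  have facet: "r 2 < \<alpha> V + m" if "V \<in> X" "V \<noteq> Z" for V
    using admissible_facet[OF Z that adm] by (simp add: m_def)
  define f where "f V x = poly (antideriv (kernel \<gamma> \<beta> x)) (y V x)" for V x
  have y0: "(\<lambda>x. c * y V x) \<in> vanishing 1 0 Y" if "V \<in> X" for V c and Y :: "(real ^ 'n) set"
    using polys_scale[OF y_in_polys[OF that]] by simp
  have y1: "(\<lambda>x. c * y V x) \<in> vanishing 1 1 (convex hull C)" if "C \<subseteq> X" "V \<in> X - C" for V c C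
  proof (rule vanishing_1I)
    show "(\<lambda>x. c * y V x) \<in> polys 1"
      using polys_scale[OF y_in_polys] that by simp
    show "c * y V x = 0" if "x \<in> convex hull C" for x
      using mem_hull[OF \<open>C \<subseteq> X\<close>, of x] that \<open>V \<in> X - C\<close> by (simp add: y_def)
  qed
  have yd: "(\<lambda>x. y U x - (y W x + s * (y V x - y W x))) \<in> polys 1"
    if "U \<in> X" "V \<in> X" "W \<in> X" for U V W s
    by (intro polys_add polys_diff
        polys_scale y_in_polys that)
  have ye: "(\<lambda>x. y W x + s * (y V x - y W x)) \<in> polys 1" if "V \<in> X" "W \<in> X" for V W s
    by (intro polys_add polys_diff
        polys_scale y_in_polys that)
  have yf: "(\<lambda>x. y V x - y W x) \<in> polys 1" if "V \<in> X" "W \<in> X" for V W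
    by (intro polys_diff y_in_polys that)

  have int: "(\<lambda>x. f V x - f W x) \<in> vanishing k (Suc (r 1)) (T V \<inter> T W)" if VW: "V \<in> X" "W \<in> X" for V W
  proof (cases "V = W")
    case True
    then show ?thesis using vanishing_zero by simp
  next
    case neq: False
    define o1 where "o1 U = (if U = V \<or> U = W then 1 else 0 :: nat)" for U
    have eq: "y V x = y W x" if "x \<in> T V \<inter> T W" for x using T_Int[OF VW] that by auto
    have "(\<Sum>U\<in>X. \<beta> U * o1 U) = (\<Sum>U\<in>{V, W}. \<beta> U * o1 U)"
      by (rule sum.mono_neutral_right) (use VW fin in \<open>auto simp: o1_def\<close>)
    then have s: "(\<Sum>U\<in>X. \<beta> U * o1 U) = \<beta> V + \<beta> W" using neq by (simp add: o1_def)
    \<comment> \<open>If \<open>Z\<close> is one of the two, the codimension two bound loses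
      \<open>\<gamma> + 1\<close>, and \<open>\<gamma> + r 1 \<le> r 2\<close> makes up for it.
      Otherwise both exponents exceed \<open>r 2 - m\<close>, and
      \<open>3 * r 1 \<le> 2 * r 2 + 1\<close> suffices.\<close>
    have "r 1 \<le> \<beta> V + \<beta> W"
    proof -
      consider "V = Z" | "W = Z" | "V \<noteq> Z" "W \<noteq> Z" by blast
      then show ?thesis
      proof cases
        case 1
        then show ?thesis using \<beta>Z \<beta>V[of W] neq facet[of W] VW \<gamma> m by simp
      next
        case 2
        then show ?thesis using \<beta>Z \<beta>V[of V] neq facet[of V] VW \<gamma> m by simp
      next
        case 3
        then show ?thesis using \<beta>V facet[of V] facet[of W] VW m r12 by simp
      qed
    qed
    then have n: "Suc (r 1) \<le> 1 + \<gamma> * 0 + (\<Sum>U\<in>X. \<beta> U * o1 U)" by (simp add: s)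
    show ?thesis unfolding f_def
    proof (rule kernel_vanishing[OF _ _ _ n])
      show "(\<lambda>x. y V x - y W x) \<in> vanishing 1 1 (T V \<inter> T W)"
        by (rule vanishing_1I[OF yf[OF VW]]) (simp add: eq)
      show "(\<lambda>x. y W x + s * (y V x - y W x)) \<in> vanishing 1 0 (T V \<inter> T W)" for s
        using ye[OF VW] by simp
      show "(\<lambda>x. y U x - (y W x + s * (y V x - y W x))) \<in> vanishing 1 (o1 U) (T V \<inter> T W)" if "U \<in> X" for s U
      proof (cases "U = V \<or> U = W")
        case True
        then have o: "o1 U = 1" by (simp add: o1_def)
        show ?thesis unfolding o
          by (rule vanishing_1I[OF yd[OF that VW]]) (use True eq in auto)
      next
        case False
        then show ?thesis using yd[OF that VW] by (simp add: o1_def)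
      qed
    qed (simp add: tot)
  qed
  have centre: "(\<lambda>x. f V x - f W x) \<in> vanishing k (Suc \<rho>) {A}" if VW: "V \<in> X" "W \<in> X" for V W
  proof -
    \<comment> \<open>At \<open>A\<close> all rescaled coordinates are 1, so the interval has length
      zero and every factor \<open>y U x - t\<close> vanishes. The order is therefore
      \<open>k - \<gamma>\<close>.\<close>
    have n: "Suc \<rho> \<le> 1 + \<gamma> * 0 + (\<Sum>U\<in>X. \<beta> U * 1)" using tot \<gamma> \<rho> by simp
    show ?thesis unfolding f_def
    proof (rule kernel_vanishing[OF _ _ _ n])
      show "(\<lambda>x. y V x - y W x) \<in> vanishing 1 1 {A}"
        by (rule vanishing_1I[OF yf[OF VW]]) (simp add: y_A VW)
      show "(\<lambda>x. y W x + s * (y V x - y W x)) \<in> vanishing 1 0 {A}" for s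
        using ye[OF VW] by simp
      show "(\<lambda>x. y U x - (y W x + s * (y V x - y W x))) \<in> vanishing 1 1 {A}" if "U \<in> X" for s U
        by (rule vanishing_1I[OF yd[OF that VW]]) (simp add: y_A VW that)
    qed (simp add: tot)
  qed
  have van: "(\<lambda>x. f V x) \<in> vanishing k n (convex hull C)"
    if C: "C \<subseteq> X" "V \<in> X - C" and n: "n \<le> Suc \<gamma> + sum \<beta> (X - C)" for C V n
  proof -
    have VX: "V \<in> X" using C by simp
    define o1 where "o1 U = (if U \<in> X - C then 1 else 0 :: nat)" for U
    have "(\<Sum>U\<in>X. \<beta> U * o1 U) = (\<Sum>U\<in>X - C. \<beta> U * o1 U)"
      by (rule sum.mono_neutral_right) (use fin in \<open>auto simp: o1_def\<close>)
    then have s: "(\<Sum>U\<in>X. \<beta> U * o1 U) = sum \<beta> (X - C)" by (simp add: o1_def)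
    \<comment> \<open>On a face contained in the cell of \<open>V\<close> the upper limit is zero,
      so the interval shrinks to the point 0. Its length, the \<open>\<gamma>\<close> factors
      \<open>t\<close>, and the factors with \<open>U \<notin> C\<close> all count.\<close>
    then have n': "n \<le> 1 + \<gamma> * 1 + (\<Sum>U\<in>X. \<beta> U * o1 U)" using n by simp
    have "(\<lambda>x. f V x - poly (antideriv (kernel \<gamma> \<beta> x)) 0) \<in> vanishing k n (convex hull C)"
      unfolding f_def
    proof (rule kernel_vanishing[OF _ _ _ n'])
      show "(\<lambda>x. y V x - 0) \<in> vanishing 1 1 (convex hull C)" using y1[OF C, of 1] by simp
      show "(\<lambda>x. 0 + s * (y V x - 0)) \<in> vanishing 1 1 (convex hull C)" for s using y1[OF C, of s] by simp
      show "(\<lambda>x. y U x - (0 + s * (y V x - 0))) \<in> vanishing 1 (o1 U) (convex hull C)" if U: "U \<in> X" for s U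
      proof (cases "U \<in> C")
        case True
        have "(\<lambda>x. 1 * y U x - s * y V x) \<in> vanishing 1 0 (convex hull C)"
          by (intro vanishing_diff y0 U VX)
        then show ?thesis using True by (simp add: o1_def)
      next
        case False
        have "(\<lambda>x. 1 * y U x - s * y V x) \<in> vanishing 1 1 (convex hull C)"
          by (intro vanishing_diff y1 C) (use U False in simp)
        then show ?thesis using False U by (simp add: o1_def)
      qed
    qed (simp add: tot)
    then show ?thesis by (simp add: poly_antideriv_0)
  qed
  have faces: "(\<lambda>x. f V x) \<in> flat_on C"
    if C: "C \<subseteq> X" "C \<noteq> {}" "C \<noteq> X - {Z}" "V \<in> X - C" for C V
  proof (rule van[OF C(1,4)])
    show "Suc (face_order C) \<le> Suc \<gamma> + sum \<beta> (X - C)"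
    proof (cases "2 \<le> card (X - C)")
      case True
      have "face_order C < sum \<alpha> (X - C)" by (rule admissible_order[OF Z \<alpha> _ C(1,2) True]) (rule adm)
      then show ?thesis using sum_in[of "X - C"] sum_out[of "X - C"] by (cases "Z \<in> X - C") auto
    next
      case False
      have "card (X - C) > 0" using C(4) fin by (auto simp: card_gt_0_iff)
      with False have c1: "card (X - C) = 1" by linarith
      then obtain W where "X - C = {W}" by (auto simp: card_1_singleton_iff)
      then have e: "X - C = {V}" using C(4) by simp
      have VZ: "V \<noteq> Z" using C e Z by auto
      have "V \<in> X" using C by simp
      from facet[OF this VZ] show ?thesis unfolding face_order_def e using \<beta>V[OF VZ] \<gamma> by simp
    qed
  qed
  have fam: "(\<lambda>Vx. e * (case Vx of (V, x) \<Rightarrow> f V x)) \<in> facet_family Z" for e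
  proof (rule fun_subspace_scale[OF fun_subspace_facet_family])
    have "(\<lambda>x. f V x) \<in> polys k" if "V \<in> X" for V
      using van[of "X - {V}" V 0] that by simp
    then show "(\<lambda>(V, x). f V x) \<in> facet_family Z"
      using int centre faces by (simp add: facet_family_def)
  qed
  \<comment> \<open>The univariate factor that splits off the integrand after the substitution
    \<open>t = s * y Z x\<close>. Its integral \<open>c0\<close> is the Beta value B(\<gamma> + 1, m
    - \<gamma>), which is positive and can be divided by.\<close>
  define q :: "real poly" where "q = [:0, 1:] ^ \<gamma> * [:1, -1:] ^ (m - 1 - \<gamma>)"
  define c0 where "c0 = poly (antideriv q) 1"
  define ym where "ym x = (\<Prod>V\<in>X. y V x ^ \<alpha> V)" for x
  have polyq: "poly q s = s ^ \<gamma> * (1 - s) ^ (m - 1 - \<gamma>)" for s by (simp add: q_def)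
  have c0: "c0 > 0"
  proof -
    have "poly (antideriv q) 0 < poly (antideriv q) 1"
    proof (rule DERIV_pos_imp_increasing_open[of 0 1])
      show "\<exists>z. (poly (antideriv q) has_real_derivative z) (at s) \<and> 0 < z" if "0 < s" "s < 1" for s
        using poly_DERIV[of "antideriv q" s] that by (intro exI[of _ "poly q s"]) (simp add: pderiv_antideriv polyq)
    qed (auto intro!: continuous_intros)
    then show ?thesis by (simp add: c0_def poly_antideriv_0)
  qed
  have degq: "degree (antideriv q) \<le> k"
  proof -
    have "degree q \<le> \<gamma> + (m - 1 - \<gamma>)"
      unfolding q_def by (intro order_trans[OF degree_mult_le] add_mono order_trans[OF degree_power_le]) auto
    also have "\<dots> = m - 1" using \<gamma> by simp
    finally show ?thesis using degree_antideriv[of q] m \<alpha>(1) member_le_sum[OF Z, of \<alpha>] fin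
      by (simp add: idx_def m_def)
  qed
  define R where "R = X - {Z}"
  have split: "prod g X = g Z * prod g R" for g :: "real ^ 'n \<Rightarrow> real"
    unfolding R_def by (rule prod.remove[OF fin Z])
  have R: "sum \<alpha> R + m = k"
    using sum.remove[OF fin Z, of \<alpha>] \<alpha>(1) by (simp add: idx_def m_def R_def)
  have lead: "(\<lambda>x. f Z x - c0 * ym x) \<in> vanishing k (Suc m) (convex hull (X - {Z}))"
  proof -
    \<comment> \<open>The rescaled integral minus its leading term. The power
      \<open>y Z x ^ m\<close> splits off from the derivative, and the two products over
      \<open>R\<close> differ by a polynomial that vanishes where \<open>y Z\<close> does; this is
      the one extra order.\<close>
    define H where "H x = pcompose (antideriv (kernel \<gamma> \<beta> x)) [:0, y Z x:] - smult (ym x) (antideriv q)" for x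
    have "degree (H x) \<le> k" for x
    proof -
      have "degree (pcompose (antideriv (kernel \<gamma> \<beta> x)) [:0, y Z x:])
          \<le> degree (antideriv (kernel \<gamma> \<beta> x)) * degree [:0, y Z x:]"
        by (rule degree_pcompose_le)
      also have "\<dots> \<le> k * 1"
        using degree_antideriv[of "kernel \<gamma> \<beta> x"] degree_kernel[of \<gamma> \<beta> x] tot
        by (intro mult_le_mono) auto
      finally show ?thesis unfolding H_def using degq
        by (intro degree_diff_le order_trans[OF degree_smult_le]) auto
    qed
    moreover have "(\<lambda>x. poly (pderiv (H x)) s) \<in> vanishing k (Suc m) (convex hull (X - {Z}))" for s
    proof -
      have e: "poly (pderiv (H x)) s = (s ^ \<gamma> * (1 - s) ^ (m - 1 - \<gamma>)) *
          (y Z x ^ m * ((\<Prod>V\<in>R. (y V x - s * y Z x) ^ \<alpha> V) - (\<Prod>V\<in>R. y V x ^ \<alpha> V)))" for x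
      proof -
        have p1: "(\<Prod>V\<in>R. (y V x - s * y Z x) ^ \<beta> V) = (\<Prod>V\<in>R. (y V x - s * y Z x) ^ \<alpha> V)"
          by (rule prod.cong) (auto simp: \<beta>_def R_def)
        have "y Z x - s * y Z x = y Z x * (1 - s)" by (simp add: algebra_simps)
        then have p2: "(y Z x - s * y Z x) ^ \<beta> Z = y Z x ^ (m - 1 - \<gamma>) * (1 - s) ^ (m - 1 - \<gamma>)"
          by (simp add: \<beta>Z power_mult_distrib)
        have "m = Suc (\<gamma> + (m - 1 - \<gamma>))" using \<gamma>(1) m by simp
        then have "y Z x ^ m = y Z x ^ Suc (\<gamma> + (m - 1 - \<gamma>))" by (rule arg_cong)
        then have p3: "y Z x ^ m = y Z x * (y Z x ^ \<gamma> * y Z x ^ (m - 1 - \<gamma>))"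
          by (simp only: power_Suc power_add)
        have p4: "ym x = y Z x ^ m * (\<Prod>V\<in>R. y V x ^ \<alpha> V)"
          unfolding ym_def split by (simp add: m_def)
        have "poly (pderiv (H x)) s = y Z x * ((s * y Z x) ^ \<gamma> * (\<Prod>V\<in>X. (y V x - s * y Z x) ^ \<beta> V)) - ym x * poly q s"
          by (simp add: H_def pderiv_diff pderiv_smult pderiv_pcompose pderiv_antideriv poly_pcompose pderiv_pCons
              poly_kernel mult.commute)
        also have "\<dots> = (s ^ \<gamma> * (1 - s) ^ (m - 1 - \<gamma>)) *
          (y Z x ^ m * ((\<Prod>V\<in>R. (y V x - s * y Z x) ^ \<alpha> V) - (\<Prod>V\<in>R. y V x ^ \<alpha> V)))"
          unfolding split p1 p2 p4 polyq p3 power_mult_distrib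
          by (simp only: right_diff_distrib mult_ac)
        finally show ?thesis .
      qed
      have g: "(\<lambda>x. (\<Prod>V\<in>R. (y V x - s * y Z x) ^ \<alpha> V)) \<in> polys (sum \<alpha> R)" for s
      proof -
        have "(\<lambda>x. (y V x - s * y Z x) ^ \<alpha> V) \<in> vanishing (\<alpha> V) 0 {}" if "V \<in> R" for V
        proof -
          have "(\<lambda>x. 1 * y V x - s * y Z x) \<in> vanishing 1 0 {}"
            by (intro vanishing_diff y0 Z) (use that in \<open>simp add: R_def\<close>)
          from vanishing_power[OF this, of "\<alpha> V"] show ?thesis by simp
        qed
        from vanishing_prod[OF _ this, of R "\<lambda>V. V"] show ?thesis using fin by (simp add: R_def)
      qed
      have "(\<lambda>x. (\<Prod>V\<in>R. (y V x - s * y Z x) ^ \<alpha> V) - (\<Prod>V\<in>R. y V x ^ \<alpha> V)) \<in> vanishing (sum \<alpha> R) 1 (convex hull (X - {Z}))"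
      proof (rule vanishing_1I)
        show "(\<lambda>x. (\<Prod>V\<in>R. (y V x - s * y Z x) ^ \<alpha> V) - (\<Prod>V\<in>R. y V x ^ \<alpha> V)) \<in> polys (sum \<alpha> R)"
          using polys_diff[OF g[of s] g[of 0]] by simp
        show "(\<Prod>V\<in>R. (y V x - s * y Z x) ^ \<alpha> V) - (\<Prod>V\<in>R. y V x ^ \<alpha> V) = 0"
          if "x \<in> convex hull (X - {Z})" for x
          using mem_hull[of "X - {Z}" x] that Z by (simp add: y_def)
      qed
      from vanishing_mult[OF vanishing_power[OF y1[of "X - {Z}" Z 1], of m] this]
      have "(\<lambda>x. y Z x ^ m * ((\<Prod>V\<in>R. (y V x - s * y Z x) ^ \<alpha> V) - (\<Prod>V\<in>R. y V x ^ \<alpha> V)))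
          \<in> vanishing k (Suc m) (convex hull (X - {Z}))"
        using Z R by (simp add: add.commute)
      from vanishing_scale[OF this, of "s ^ \<gamma> * (1 - s) ^ (m - 1 - \<gamma>)"]
      show ?thesis unfolding e .
    qed
    ultimately have "(\<lambda>x. poly (H x) 1 - poly (H x) 0) \<in> vanishing k (Suc m) (convex hull (X - {Z}))"
      by (rule fun_subspace_integral[OF fun_subspace_vanishing])
    then show ?thesis by (simp add: H_def poly_pcompose poly_antideriv_0 f_def c0_def mult.commute)
  qed
  define c1 where "c1 = (\<Prod>V\<in>X. l V A ^ \<alpha> V)"
  have bern: "bern \<alpha> x = c1 * ym x" for x
    unfolding bern_def c1_def ym_def prod.distrib[symmetric]
    using l_A_pos by (intro prod.cong refl) (force simp: y_def power_divide)
  show ?thesis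
  proof (rule bexI[OF _ fam[of "c1 / c0"]])
    have "(\<lambda>x. bern \<alpha> x - (c1 / c0) * f Z x) = (\<lambda>x. (- c1 / c0) * (f Z x - c0 * ym x))"
      using c0 by (simp add: bern fun_eq_iff field_simps)
    then show "(\<lambda>x. bern \<alpha> x - (c1 / c0) * (case (Z, x) of (V, x) \<Rightarrow> f V x))
        \<in> vanishing k (Suc (\<alpha> Z)) (convex hull (X - {Z}))"
      using vanishing_scale[OF lead, of "- c1 / c0"] by (simp add: m_def)
  qed
qed

text \<open>Each step subtracts corrections for the monomials of lowest order on the facet and so raises
  the order of vanishing there by one.\<close>

lemma facet_extension:
  assumes Z: "Z \<in> X"
  shows "p \<in> polys k \<Longrightarrow> n \<le> Suc (r 1) \<Longrightarrow>
    (\<And>C. C \<subset> X - {Z} \<Longrightarrow> C \<noteq> {} \<Longrightarrow> p \<in> flat_on C) \<Longrightarrow>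
    p \<in> vanishing k (Suc (r 1) - n) (convex hull (X - {Z})) \<Longrightarrow>
    \<exists>P\<in>facet_family Z. (\<lambda>x. p x - P (Z, x)) \<in> vanishing k (Suc (r 1)) (convex hull (X - {Z}))"
proof (induction n arbitrary: p)
  case 0
  then show ?case
    by (intro bexI[OF _ fun_subspace_zero[OF fun_subspace_facet_family]]) simp
next
  case (Suc n)
  \<comment> \<open>\<open>m\<close> is the order of vanishing already reached on the facet, and
    \<open>n\<close> further orders are to be gained after this step.\<close>
  define m where "m = r 1 - n"
  have n: "Suc (r 1) - n = Suc m" "Suc (r 1) - Suc n = m" "n \<le> r 1" using Suc.prems(2) by (auto simp: m_def)
  note bd = Suc.prems(3)
  have pm: "p \<in> vanishing k m (convex hull (X - {Z}))" using Suc.prems(4) n by simp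
  have ne: "X - {Z} \<noteq> {}" using ex_other[of Z] by auto
  obtain c where c: "p = (\<lambda>x. \<Sum>\<alpha>\<in>idx k. c \<alpha> * bern \<alpha> x)"
    using polys_bern_expansion[OF Suc.prems(1)] by blast
  have adm: "face_order C < sum \<alpha> (X - C)"
    if "\<alpha> \<in> idx k" "c \<alpha> \<noteq> 0" "C \<subset> X - {Z}" "C \<noteq> {}" for \<alpha> C
  proof (rule ccontr)
    assume *: "\<not> ?thesis"
    have "c \<alpha> = 0"
      by (rule bern_coeff_zero[OF _ that(4) _ that(1)]) (use that bd[OF that(3,4)] c * in auto)
    with that show False by simp
  qed
  have eZ: "X - (X - {Z}) = {Z}" using Z by auto
  have low: "m \<le> \<alpha> Z" if "\<alpha> \<in> idx k" "c \<alpha> \<noteq> 0" for \<alpha>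
  proof (rule ccontr)
    assume *: "\<not> ?thesis"
    then have m1: "m = Suc (m - 1)" by simp
    have pm': "(\<lambda>x. \<Sum>\<alpha>\<in>idx k. c \<alpha> * bern \<alpha> x) \<in> vanishing k (Suc (m - 1)) (convex hull (X - {Z}))"
      using pm m1 unfolding c by simp
    have "c \<alpha> = 0"
      by (rule bern_coeff_zero[OF _ ne pm' that(1)]) (use * in \<open>auto simp: eZ\<close>)
    with that show False by simp
  qed
  \<comment> \<open>By \<open>low\<close> no term has a smaller exponent of \<open>Z\<close>, and
    terms with a larger one already vanish to order \<open>Suc m\<close>. Restricting to nonzero
    coefficients makes every index in \<open>S\<close> admissible.\<close>
  define S where "S = {\<alpha> \<in> idx k. c \<alpha> \<noteq> 0 \<and> \<alpha> Z = m}"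
  have "\<exists>P\<in>facet_family Z. (\<lambda>x. bern \<alpha> x - P (Z, x)) \<in> vanishing k (Suc m) (convex hull (X - {Z}))"
    if "\<alpha> \<in> S" for \<alpha>
  proof -
    have \<alpha>: "\<alpha> \<in> idx k" "c \<alpha> \<noteq> 0" "\<alpha> Z = m" using that by (auto simp: S_def)
    then have "\<alpha> Z \<le> r 1" by (simp add: m_def)
    then have "\<exists>P\<in>facet_family Z. (\<lambda>x. bern \<alpha> x - P (Z, x)) \<in> vanishing k (Suc (\<alpha> Z)) (convex hull (X - {Z}))"
      by (rule facet_monomial[OF Z \<alpha>(1)]) (rule adm[OF \<alpha>(1,2)])
    then show ?thesis unfolding \<alpha>(3) .
  qed
  then have "\<exists>P. \<forall>\<alpha>\<in>S. P \<alpha> \<in> facet_family Z \<and>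
      (\<lambda>x. bern \<alpha> x - P \<alpha> (Z, x)) \<in> vanishing k (Suc m) (convex hull (X - {Z}))"
    by (intro bchoice) (simp add: Bex_def)
  then obtain P where "\<forall>\<alpha>\<in>S. P \<alpha> \<in> facet_family Z \<and>
      (\<lambda>x. bern \<alpha> x - P \<alpha> (Z, x)) \<in> vanishing k (Suc m) (convex hull (X - {Z}))" by (elim exE)
  then have P: "P \<alpha> \<in> facet_family Z"
    "(\<lambda>x. bern \<alpha> x - P \<alpha> (Z, x)) \<in> vanishing k (Suc m) (convex hull (X - {Z}))" if "\<alpha> \<in> S" for \<alpha>
    using that by simp_all
  define P0 where "P0 = (\<lambda>Vx. \<Sum>\<alpha>\<in>S. c \<alpha> * P \<alpha> Vx)"
  have P0: "P0 \<in> facet_family Z" unfolding P0_def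
    by (intro fun_subspace_sum[OF fun_subspace_facet_family] fun_subspace_scale[OF fun_subspace_facet_family] P)
  define p1 where "p1 = (\<lambda>x. p x - P0 (Z, x))"
  have P0k: "(\<lambda>x. P0 (Z, x)) \<in> polys k" using P0 Z by (simp add: facet_family_def)
  have p1k: "p1 \<in> polys k" unfolding p1_def by (intro polys_diff Suc.prems P0k)
  have "\<exists>P\<in>facet_family Z. (\<lambda>x. p1 x - P (Z, x)) \<in> vanishing k (Suc (r 1)) (convex hull (X - {Z}))"
  proof (rule Suc.IH[OF p1k])
    show "n \<le> Suc (r 1)" using n by simp
    \<comment> \<open>The correction does not spoil proper faces of the facet, because members of
      the family are flat on every face other than the facet.\<close>
    show "p1 \<in> flat_on C" if C: "C \<subset> X - {Z}" "C \<noteq> {}" for C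
    proof -
      have "(\<lambda>x. P0 (Z, x)) \<in> flat_on C"
        by (rule facet_family_faces[OF P0]) (use C Z in auto)
      then show ?thesis unfolding p1_def by (intro vanishing_diff bd C)
    qed
    show "p1 \<in> vanishing k (Suc (r 1) - n) (convex hull (X - {Z}))"
    proof -
      have "p1 x = (\<Sum>\<alpha>\<in>S. c \<alpha> * (bern \<alpha> x - P \<alpha> (Z, x))) + (\<Sum>\<alpha>\<in>idx k - S. c \<alpha> * bern \<alpha> x)" for x
      proof -
        have "p x = (\<Sum>\<alpha>\<in>idx k - S. c \<alpha> * bern \<alpha> x) + (\<Sum>\<alpha>\<in>S. c \<alpha> * bern \<alpha> x)"
          unfolding c by (rule sum.subset_diff) (auto simp: S_def finite_idx)
        then show ?thesis by (simp add: p1_def P0_def right_diff_distrib sum_subtractf)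
      qed
      then have "p1 = (\<lambda>x. (\<Sum>\<alpha>\<in>S. c \<alpha> * (bern \<alpha> x - P \<alpha> (Z, x))) + (\<Sum>\<alpha>\<in>idx k - S. c \<alpha> * bern \<alpha> x))"
        by blast
      also have "\<dots> \<in> vanishing k (Suc m) (convex hull (X - {Z}))"
      proof (intro vanishing_add vanishing_sum)
        show "(\<lambda>x. c \<alpha> * (bern \<alpha> x - P \<alpha> (Z, x))) \<in> vanishing k (Suc m) (convex hull (X - {Z}))" if "\<alpha> \<in> S" for \<alpha>
          by (intro vanishing_scale P that)
        show "(\<lambda>x. c \<alpha> * bern \<alpha> x) \<in> vanishing k (Suc m) (convex hull (X - {Z}))" if \<alpha>: "\<alpha> \<in> idx k - S" for \<alpha>
        proof (cases "c \<alpha> = 0")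
          case True
          then show ?thesis by (simp add: vanishing_zero)
        next
          case False
          then have "Suc m \<le> \<alpha> Z" using low[of \<alpha>] \<alpha> by (auto simp: S_def)
          moreover have "bern \<alpha> \<in> vanishing k (sum \<alpha> {Z}) (convex hull (X - {Z}))"
            by (rule bern_vanishing) (use \<alpha> Z in auto)
          ultimately have "bern \<alpha> \<in> vanishing k (Suc m) (convex hull (X - {Z}))"
            by (simp add: vanishing_def)
          then show ?thesis by (rule vanishing_scale)
        qed
      qed
      finally show ?thesis unfolding n(1) .
    qed
  qed
  then obtain P1 where P1: "P1 \<in> facet_family Z"
    "(\<lambda>x. p1 x - P1 (Z, x)) \<in> vanishing k (Suc (r 1)) (convex hull (X - {Z}))" by blast
  show ?case
  proof (rule bexI[OF _ fun_subspace_add[OF fun_subspace_facet_family P0 P1(1)]])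
    show "(\<lambda>x. p x - (P0 (Z, x) + P1 (Z, x))) \<in> vanishing k (Suc (r 1)) (convex hull (X - {Z}))"
      using P1(2) by (simp add: p1_def algebra_simps)
  qed
qed

text \<open>In codimension at least two one polynomial serves on all cells, so the smoothness
  conditions hold trivially. A facet uses \<open>facet_extension\<close>, and the only cell
  containing it is that of \<open>Z\<close>. The restriction \<open>card C' \<le> card C\<close> is
  what makes the degrees of freedom triangular.\<close>

lemma trace_extension:
  assumes C: "C \<subset> X" "C \<noteq> {}" and p: "p \<in> polys k"
    and bd: "\<And>C'. C' \<subset> C \<Longrightarrow> C' \<noteq> {} \<Longrightarrow> p \<in> flat_on C'"
  shows "\<exists>u\<in>superspline k r \<rho> A (convex hull X).
    (\<forall>V\<in>X - C. (\<lambda>x. p x - cell_poly k (T V) u x) \<in> flat_on C) \<and>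
    (\<forall>C' V. C' \<subset> X \<longrightarrow> C' \<noteq> {} \<longrightarrow> C' \<noteq> C \<longrightarrow> card C' \<le> card C \<longrightarrow> V \<in> X - C' \<longrightarrow>
      cell_poly k (T V) u \<in> flat_on C')"
proof (cases "2 \<le> card (X - C)")
  case True
  have CX: "C \<subseteq> X" using C by auto
  have "\<exists>q\<in>polys k. (\<lambda>x. p x - q x) \<in> flat_on C \<and>
    (\<forall>C'\<subseteq>X. C' \<noteq> {} \<longrightarrow> C' \<noteq> C \<longrightarrow> card C' \<le> card C \<longrightarrow>
      q \<in> flat_on C')"
    by (rule truncated_extension[OF CX C(2) True p]) (rule bd)
  then obtain q where qk: "q \<in> polys k" and qC: "(\<lambda>x. p x - q x) \<in> flat_on C"
    and q: "\<forall>C'\<subseteq>X. C' \<noteq> {} \<longrightarrow> C' \<noteq> C \<longrightarrow> card C' \<le> card C \<longrightarrow>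
      q \<in> flat_on C'"
    by (elim bexE conjE)
  have "\<exists>u\<in>superspline k r \<rho> A (convex hull X). \<forall>V\<in>X. cell_poly k (T V) u = q"
    by (rule superspline_of_pieces) (simp_all add: qk vanishing_zero)
  then obtain u where u: "u \<in> superspline k r \<rho> A (convex hull X)" "\<And>V. V \<in> X \<Longrightarrow> cell_poly k (T V) u = q"
    by blast
  show ?thesis
  proof (rule bexI[OF _ u(1)], intro conjI ballI allI impI)
    show "(\<lambda>x. p x - cell_poly k (T V) u x) \<in> flat_on C"
      if "V \<in> X - C" for V using qC u(2)[of V] that by simp
    show "cell_poly k (T V) u \<in> flat_on C'"
      if "C' \<subset> X" "C' \<noteq> {}" "C' \<noteq> C" "card C' \<le> card C" "V \<in> X - C'" for C' V
      using q u(2)[of V] that by simp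
  qed
next
  case False
  have "card (X - C) > 0" using C fin by (auto simp: card_gt_0_iff)
  with False have "card (X - C) = 1" by linarith
  then obtain Z where Z: "X - C = {Z}" by (auto simp: card_1_singleton_iff)
  then have ZX: "Z \<in> X" and CZ: "C = X - {Z}" using C(1) by auto
  have oC: "face_order C = r 1" by (simp add: face_order_def Z)
  have "\<exists>P\<in>facet_family Z. (\<lambda>x. p x - P (Z, x)) \<in> vanishing k (Suc (r 1)) (convex hull (X - {Z}))"
    by (rule facet_extension[OF ZX p order_refl]) (use bd p CZ in simp_all)
  then obtain P where P: "P \<in> facet_family Z"
    "(\<lambda>x. p x - P (Z, x)) \<in> vanishing k (Suc (r 1)) (convex hull (X - {Z}))" by blast
  have Pk: "(\<lambda>x. P (V, x)) \<in> polys k" if "V \<in> X" for V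
    using P(1) that by (simp add: facet_family_def)
  note Pf = facet_family_faces[OF P(1)]
  have "\<exists>u\<in>superspline k r \<rho> A (convex hull X). \<forall>V\<in>X. cell_poly k (T V) u = (\<lambda>x. P (V, x))"
  proof (rule superspline_of_pieces[OF Pk])
    fix V W assume VW: "V \<in> X" "W \<in> X"
    show "(\<lambda>x. P (V, x) - P (W, x)) \<in> vanishing k (Suc (r 1)) (T V \<inter> T W)"
      and "(\<lambda>x. P (V, x) - P (W, x)) \<in> vanishing k (Suc \<rho>) {A}"
      using P(1) VW by (simp_all add: facet_family_def)
  next
    fix C' V W assume C': "C' \<subseteq> X" "C' \<noteq> {}" "2 \<le> card (X - C')" "V \<in> X - C'" "W \<in> X - C'"
    have "C' \<noteq> X - {Z}" using C'(3) Z CZ by auto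
    then show "(\<lambda>x. P (V, x) - P (W, x)) \<in> vanishing k (Suc (r (card (X - C')))) (convex hull C')"
      unfolding face_order_def[symmetric]
      by (intro vanishing_diff Pf C')
  qed
  then obtain u where u: "u \<in> superspline k r \<rho> A (convex hull X)"
    "\<And>V. V \<in> X \<Longrightarrow> cell_poly k (T V) u = (\<lambda>x. P (V, x))" by blast
  show ?thesis
  proof (rule bexI[OF _ u(1)], intro conjI ballI allI impI)
    fix V assume "V \<in> X - C"
    then have "V = Z" using Z by simp
    then show "(\<lambda>x. p x - cell_poly k (T V) u x) \<in> flat_on C"
      using P(2) u(2)[OF ZX] unfolding oC CZ[symmetric] by simp
  next
    fix C' V assume C': "C' \<subset> X" "C' \<noteq> {}" "C' \<noteq> C" "V \<in> X - C'"
    then have "V \<in> X" "C' \<subseteq> X" by auto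
    then show "cell_poly k (T V) u \<in> flat_on C'"
      using Pf[of C' V] u(2)[of V] CZ C' by simp
  qed
qed

end

section \<open>Degrees of freedom\<close>

lemma partial_derivs_zero: "partial_derivs is (\<lambda>x. 0) = (\<lambda>x. 0)"
  using partial_derivs_cmult[OF const_in_polys[of 0 0], of "is" 0] by simp

lemma partial_derivs_sum:
  assumes "\<And>i. i \<in> I \<Longrightarrow> f i \<in> polys k"
  shows "partial_derivs is (\<lambda>x. \<Sum>i\<in>I. c i * f i x) = (\<lambda>x. \<Sum>i\<in>I. c i * partial_derivs is (f i) x)"
  using assms
proof (induction I rule: infinite_finite_induct)
  case (insert i I)
  have s: "(\<lambda>x. \<Sum>i\<in>I. c i * f i x) \<in> polys k"
    by (intro polys_sum polys_scale insert) simp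
  have f: "f i \<in> polys k" using insert by simp
  have "partial_derivs is (\<lambda>x. c i * f i x + (\<Sum>i\<in>I. c i * f i x))
      = (\<lambda>x. c i * partial_derivs is (f i) x + partial_derivs is (\<lambda>x. \<Sum>i\<in>I. c i * f i x) x)"
    using partial_derivs_add[OF polys_scale[OF f] s, of "is"]
      partial_derivs_cmult[OF f, of "is"] by simp
  then show ?case using insert by simp
qed (simp_all add: partial_derivs_zero)

text \<open>For a subsimplex \<open>F\<close> of dimension \<open>t\<close> this is \<open>r\<^sub>d\<^sub>-\<^sub>t\<close>.\<close>

definition trace_order :: "(nat \<Rightarrow> nat) \<Rightarrow> (real ^ 'n) set \<Rightarrow> nat" where
  "trace_order r F = r (Suc CARD('n) - card (vertices F))"

text \<open>Formulated through the vertices of \<open>F\<close> alone: every simplex containing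
  \<open>F\<close> gets the same space and hence the same evaluations, which allows the degrees of
  freedom to be matched across simplices.\<close>

definition face_bubbles :: "nat \<Rightarrow> (nat \<Rightarrow> nat) \<Rightarrow> (real ^ 'n) set \<Rightarrow> (real ^ 'n \<Rightarrow> real) set" where
  "face_bubbles k r F = {p \<in> polys k. \<forall>C. C \<subset> vertices F \<longrightarrow> C \<noteq> {} \<longrightarrow>
     p \<in> vanishing k (Suc (r (Suc CARD('n) - card C))) (convex hull C)}"

abbreviation derivative_at :: "'n list \<times> (real ^ 'n) \<Rightarrow> (real ^ 'n \<Rightarrow> real) \<Rightarrow> real" where
  "derivative_at e p \<equiv> partial_derivs (fst e) p (snd e)"

text \<open>The pairs \<open>e i\<close> define the functionals; the bubbles \<open>p i\<close> dual
  to them are what has to be extended to shape functions.\<close>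

definition dual_face_dofs :: "nat \<Rightarrow> (nat \<Rightarrow> nat) \<Rightarrow> (real ^ 'n) set \<Rightarrow> nat \<Rightarrow>
    (nat \<Rightarrow> 'n list \<times> (real ^ 'n)) \<Rightarrow> (nat \<Rightarrow> real ^ 'n \<Rightarrow> real) \<Rightarrow> bool" where
  "dual_face_dofs k r F n e p \<longleftrightarrow>
    (\<forall>i<n. length (fst (e i)) \<le> trace_order r F \<and> snd (e i) \<in> F \<and> p i \<in> face_bubbles k r F) \<and>
    (\<forall>i<n. \<forall>j<n. derivative_at (e i) (p j) = (if i = j then 1 else 0)) \<and>
    (\<forall>q\<in>face_bubbles k r F. (\<forall>i<n. derivative_at (e i) q = 0) \<longrightarrow>
      q \<in> vanishing k (Suc (trace_order r F)) F)"

lemma fun_subspace_face_bubbles: "fun_subspace (face_bubbles k r F)"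
  unfolding fun_subspace_def face_bubbles_def
  by (auto simp: polys_zero vanishing_zero
      polys_add vanishing_add
      polys_scale vanishing_scale)

text \<open>A derivative evaluation of \<open>p\<close> is a point evaluation of its jet, seen as a
  function of pairs (derivative, point). So \<open>evaluation_basis\<close> applies to the jets of
  the bubbles, which lie in the span of the jets of the monomials.\<close>

lemma dual_face_dofs_exist:
  fixes F :: "(real ^ 'n) set"
  shows "\<exists>n e p. dual_face_dofs k r F n e p"
proof -
  \<comment> \<open>Outside the admissible orders and outside \<open>F\<close> the jet is set to 0.
    Each pair selected later carries the value 1 of some jet and is therefore admissible.\<close>
  define tr :: "(real ^ 'n \<Rightarrow> real) \<Rightarrow> 'n list \<times> (real ^ 'n) \<Rightarrow> real" where
    "tr p e = (if length (fst e) \<le> trace_order r F \<and> snd e \<in> F then derivative_at e p else 0)" for p e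
  define W where "W = tr ` face_bubbles k r F"
  note S = fun_subspace_face_bubbles[of k r F]
  have fbk: "p \<in> polys k" if "p \<in> face_bubbles k r F" for p using that by (simp add: face_bubbles_def)
  have "fun_subspace W"
    unfolding fun_subspace_def
  proof (intro conjI ballI allI)
    have "tr (\<lambda>x. 0) = (\<lambda>e. 0)" by (simp add: tr_def fun_eq_iff partial_derivs_zero)
    then show "(\<lambda>x. 0) \<in> W" unfolding W_def using fun_subspace_zero[OF S] by (metis image_eqI)
    fix f g c assume "f \<in> W"
    then obtain p where p: "p \<in> face_bubbles k r F" "f = tr p" by (auto simp: W_def)
    have "tr (\<lambda>x. c * p x) = (\<lambda>e. c * f e)"
      by (simp add: tr_def p(2) fun_eq_iff partial_derivs_cmult[OF fbk[OF p(1)]])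
    then show "(\<lambda>x. c * f x) \<in> W" unfolding W_def using fun_subspace_scale[OF S p(1), of c] by (metis image_eqI)
    assume "g \<in> W"
    then obtain q where q: "q \<in> face_bubbles k r F" "g = tr q" by (auto simp: W_def)
    have "tr (\<lambda>x. p x + q x) = (\<lambda>e. f e + g e)"
      by (simp add: tr_def p(2) q(2) fun_eq_iff partial_derivs_add[OF fbk[OF p(1)] fbk[OF q(1)]])
    then show "(\<lambda>x. f x + g x) \<in> W" unfolding W_def using fun_subspace_add[OF S p(1) q(1)] by (metis image_eqI)
  qed
  moreover have "\<exists>c. w = (\<lambda>e. \<Sum>\<alpha> | sum \<alpha> UNIV \<le> k. c \<alpha> * tr (monomial_fun \<alpha>) e)" if w: "w \<in> W" for w
  proof -
    obtain p where p: "p \<in> face_bubbles k r F" "w = tr p" using w by (auto simp: W_def)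
    obtain c where c: "p = (\<lambda>x. \<Sum>\<alpha> | sum \<alpha> UNIV \<le> k. c \<alpha> * monomial_fun \<alpha> x)"
      using fbk[OF p(1)] by (auto simp: polys_iff)
    have pd: "partial_derivs is p = (\<lambda>x. \<Sum>\<alpha> | sum \<alpha> UNIV \<le> k. c \<alpha> * partial_derivs is (monomial_fun \<alpha>) x)" for "is"
      unfolding c by (rule partial_derivs_sum[where k = k]) (simp add: monomial_fun_in_polys)
    have "tr p e = (\<Sum>\<alpha> | sum \<alpha> UNIV \<le> k. c \<alpha> * tr (monomial_fun \<alpha>) e)" for e
    proof (cases "length (fst e) \<le> trace_order r F \<and> snd e \<in> F")
      case True
      then show ?thesis using pd by (simp add: tr_def)
    next
      case False
      then have "tr q e = 0" for q unfolding tr_def by (rule if_not_P)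
      then show ?thesis by simp
    qed
    then have "tr p = (\<lambda>e. \<Sum>\<alpha> | sum \<alpha> UNIV \<le> k. c \<alpha> * tr (monomial_fun \<alpha>) e)" by (rule ext)
    then show ?thesis unfolding p(2) by (rule exI[where x = c])
  qed
  ultimately have "\<exists>(n::nat) xs ws. (\<forall>i<n. ws i \<in> W) \<and> (\<forall>i<n. \<forall>j<n. ws j (xs i) = (if i = j then 1 else 0))
    \<and> (\<forall>w\<in>W. (\<forall>i<n. w (xs i) = 0) \<longrightarrow> w = (\<lambda>x. 0))"
    by (rule evaluation_basis[OF finite_multi_indices])
  then obtain n :: nat and e ws where ws: "\<forall>i<n. ws i \<in> W"
    and dual: "\<forall>i<n. \<forall>j<n. ws j (e i) = (if i = j then 1 else 0)"
    and sep: "\<forall>w\<in>W. (\<forall>i<n. w (e i) = 0) \<longrightarrow> w = (\<lambda>x. 0)" by (elim exE conjE)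
  have "\<forall>i\<in>{..<n}. \<exists>p. p \<in> face_bubbles k r F \<and> ws i = tr p" using ws by (auto simp: W_def)
  then obtain p where p: "\<forall>i\<in>{..<n}. p i \<in> face_bubbles k r F \<and> ws i = tr (p i)"
    using bchoice[of "{..<n}" "\<lambda>i p. p \<in> face_bubbles k r F \<and> ws i = tr p"] by blast
  have e: "length (fst (e i)) \<le> trace_order r F \<and> snd (e i) \<in> F" if "i < n" for i
  proof -
    have "tr (p i) (e i) = 1" using dual p that by simp
    then show ?thesis by (simp add: tr_def split: if_splits)
  qed
  have "dual_face_dofs k r F n e p"
    unfolding dual_face_dofs_def
  proof (intro conjI allI impI ballI)
    fix i assume i: "i < n"
    show "length (fst (e i)) \<le> trace_order r F" "snd (e i) \<in> F" "p i \<in> face_bubbles k r F"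
      using e[OF i] p i by auto
    fix j assume j: "j < n"
    show "derivative_at (e i) (p j) = (if i = j then 1 else 0)"
    proof -
      have "tr (p j) (e i) = (if i = j then 1 else 0)" using dual p i j by simp
      then show ?thesis using e[OF i] by (simp add: tr_def)
    qed
  next
    fix q assume q: "q \<in> face_bubbles k r F" and z: "\<forall>i<n. derivative_at (e i) q = 0"
    have "tr q = (\<lambda>x. 0)" using sep q z by (simp add: W_def tr_def)
    then have "tr q (is, x) = 0" for "is" x by simp
    then have "partial_derivs is q x = 0" if "length is \<le> trace_order r F" "x \<in> F" for "is" x
      using that unfolding tr_def fst_conv snd_conv by metis
    then show "q \<in> vanishing k (Suc (trace_order r F)) F"
      using fbk[OF q] by (simp add: vanishing_def less_Suc_eq_le)
  qed
  then show ?thesis by blast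
qed

definition cell_bubbles :: "nat \<Rightarrow> (nat \<Rightarrow> nat) \<Rightarrow> nat \<Rightarrow> real ^ 'n \<Rightarrow> (real ^ 'n) set \<Rightarrow> (real ^ 'n \<Rightarrow> real) set" where
  "cell_bubbles k r \<rho> A K = {u \<in> superspline k r \<rho> A K. \<forall>F\<in>subsimplices K. \<forall>T\<in>alfeld_split A K.
     F \<noteq> K \<longrightarrow> F \<subseteq> T \<longrightarrow> cell_poly k T u \<in> vanishing k (Suc (trace_order r F)) F}"

text \<open>These point evaluations become the degrees of freedom attached to \<open>K\<close>
  itself.\<close>

definition dual_cell_dofs :: "nat \<Rightarrow> (nat \<Rightarrow> nat) \<Rightarrow> nat \<Rightarrow> real ^ 'n \<Rightarrow> (real ^ 'n) set \<Rightarrow> nat \<Rightarrow>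
    (nat \<Rightarrow> real ^ 'n) \<Rightarrow> (nat \<Rightarrow> real ^ 'n \<Rightarrow> real) \<Rightarrow> bool" where
  "dual_cell_dofs k r \<rho> A K n xs ws \<longleftrightarrow>
    (\<forall>i<n. ws i \<in> cell_bubbles k r \<rho> A K) \<and> (\<forall>i<n. \<forall>j<n. ws j (xs i) = (if i = j then 1 else 0)) \<and>
    (\<forall>w\<in>cell_bubbles k r \<rho> A K. (\<forall>i<n. w (xs i) = 0) \<longrightarrow> w = (\<lambda>x. 0))"

section \<open>Superspline functions in terms of their cell polynomials\<close>

context superspline_params
begin

abbreviation S :: "(real ^ 'n \<Rightarrow> real) set" where
  "S \<equiv> superspline k r \<rho> A (convex hull X)"

lemma trace_order_hull: "C \<subseteq> X \<Longrightarrow> trace_order r (convex hull C) = face_order C"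
  by (simp add: trace_order_def face_order_def vertices_hull card_compl)

lemma subsimplices_eq: "subsimplices (convex hull X) = (\<lambda>C. convex hull C) ` {C. C \<subseteq> X \<and> C \<noteq> {}}"
proof -
  have "(\<exists>t. card C = t + 1) \<longleftrightarrow> C \<noteq> {}" if "C \<subseteq> X" for C
    using fin_sub[OF that] by (cases "card C") auto
  then show ?thesis
    unfolding subsimplices_def subsimplex_iff by auto
qed

lemma hull_eq_iff: "C \<subseteq> X \<Longrightarrow> D \<subseteq> X \<Longrightarrow> convex hull C = convex hull D \<longleftrightarrow> C = D"
  using vertices_hull by metis

lemma superspline_cell:
  assumes "u \<in> S" "V \<in> X"
  shows "cell_poly k (T V) u \<in> polys k" "x \<in> T V \<Longrightarrow> cell_poly k (T V) u x = u x"
proof -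
  have "T V \<in> alfeld_split A (convex hull X)" using assms(2) by (simp add: alfeld_split_eq)
  then obtain p where p: "p \<in> polys k" "\<forall>x\<in>T V. p x = u x"
    using assms(1) unfolding superspline_def by blast
  then have "cell_poly k (T V) u = p" using cell_poly_eq[OF assms(2) p(1)] by simp
  then show "cell_poly k (T V) u \<in> polys k" "x \<in> T V \<Longrightarrow> cell_poly k (T V) u x = u x" using p by auto
qed

lemma single_valued_vanishing:
  assumes u: "u \<in> S" and VW: "V \<in> X" "W \<in> X" "F \<subseteq> T V" "F \<subseteq> T W"
    and sv: "\<And>n. n \<le> m \<Longrightarrow> single_valued k A (convex hull X) u n F"
  shows "(\<lambda>x. cell_poly k (T V) u x - cell_poly k (T W) u x) \<in> vanishing k (Suc m) F"
proof -
  note p = superspline_cell(1)[OF u VW(1)] superspline_cell(1)[OF u VW(2)]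
  have "partial_derivs is (cell_poly k (T V) u) x = partial_derivs is (cell_poly k (T W) u) x"
    if "length is < Suc m" "x \<in> F" for "is" x
  proof -
    have "single_valued k A (convex hull X) u (length is) F" using sv that by simp
    note this[unfolded single_valued_def alfeld_split_eq]
    from bspec[OF bspec[OF this imageI[OF VW(1)]] imageI[OF VW(2)]]
    have "same_trace k (length is) F (T V) u (T W) u" using VW by blast
    then show ?thesis using that by (simp add: same_trace_def)
  qed
  then show ?thesis
    unfolding vanishing_def
    by (simp add: polys_diff[OF p] partial_derivs_diff[OF p])
qed

text \<open>In codimension at least two this is part of the definition of the space; a facet lies in
  a single cell, so there \<open>V = W\<close>.\<close>

lemma superspline_face:
  assumes u: "u \<in> S" and C: "C \<subset> X" "C \<noteq> {}" and VW: "V \<in> X - C" "W \<in> X - C"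
  shows "(\<lambda>x. cell_poly k (T V) u x - cell_poly k (T W) u x) \<in> flat_on C"
proof (cases "2 \<le> card (X - C)")
  case True
  have CX: "C \<subseteq> X" using C by auto
  have c: "card C = (card C - 1) + 1" using fin_sub[OF CX] C(2) by (cases "card C") auto
  then have t: "subsimplex (card C - 1) (convex hull C) (convex hull X)"
    using CX by (auto simp: subsimplex_iff)
  have e: "CARD('n) - (card C - 1) = card (X - C)" "card C - 1 + 2 \<le> CARD('n)"
    using c True card_compl[OF CX] by auto
  show ?thesis
  proof (rule single_valued_vanishing[OF u])
    show "convex hull C \<subseteq> T V" "convex hull C \<subseteq> T W" "V \<in> X" "W \<in> X"
      using VW hull_subset_T_iff[OF CX] by auto
    fix n assume "n \<le> face_order C"
    then have "card C - 1 + 2 \<le> CARD('n) \<and> subsimplex (card C - 1) (convex hull C) (convex hull X) \<and>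
        n \<le> r (CARD('n) - (card C - 1))"
      using e t by (simp add: face_order_def)
    then show "single_valued k A (convex hull X) u n (convex hull C)"
      using u unfolding superspline_def by blast
  qed
next
  case False
  have "V = W"
  proof (rule ccontr)
    assume "V \<noteq> W"
    then have "card {V, W} \<le> card (X - C)" using VW fin by (intro card_mono) auto
    then show False using False \<open>V \<noteq> W\<close> by simp
  qed
  then show ?thesis by (simp add: vanishing_zero)
qed

lemma superspline_centre:
  assumes u: "u \<in> S" and VW: "V \<in> X" "W \<in> X"
  shows "(\<lambda>x. cell_poly k (T V) u x - cell_poly k (T W) u x) \<in> vanishing k (Suc \<rho>) {A}"
  by (rule single_valued_vanishing[OF u VW]) (use u A_in_T in \<open>auto simp: superspline_def\<close>)

text \<open>Smoothness speaks of derivatives in the interior of the simplex. The common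
  \<open>g\<close> from \<open>C_upto_poly_derivs\<close> turns it into agreement of traces on the
  whole interface, boundary points included.\<close>

lemma superspline_interface:
  assumes u: "u \<in> S" and VW: "V \<in> X" "W \<in> X"
  shows "(\<lambda>x. cell_poly k (T V) u x - cell_poly k (T W) u x) \<in> vanishing k (Suc (r 1)) (T V \<inter> T W)"
proof -
  have "C_upto (r 1) (convex hull X) u" using u by (simp add: superspline_def)
  from C_upto_poly_derivs[OF this] obtain g where
    g: "\<forall>T p k is x. T \<subseteq> convex hull X \<and> closure (interior T) = T \<and> p \<in> polys k \<and> (\<forall>x\<in>T. p x = u x)
      \<and> length is \<le> r 1 \<and> x \<in> T \<longrightarrow> partial_derivs is p x = g is x" by (elim exE)
  have g': "partial_derivs is (cell_poly k (T V) u) x = g is x"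
    if "V \<in> X" "x \<in> T V" "length is \<le> r 1" for V x "is"
    by (rule g[rule_format, of "T V" _ k])
      (use that T_subset[OF that(1)] closure_interior_T[OF that(1)] superspline_cell[OF u that(1)] in auto)
  note p = superspline_cell(1)[OF u VW(1)] superspline_cell(1)[OF u VW(2)]
  show ?thesis
    unfolding vanishing_def
    by (simp add: polys_diff[OF p] partial_derivs_diff[OF p] g' VW less_Suc_eq_le)
qed

lemma superspline_eqI:
  assumes u: "u \<in> S" and v: "\<And>x. x \<notin> convex hull X \<Longrightarrow> v x = 0"
    "\<And>V x. V \<in> X \<Longrightarrow> x \<in> T V \<Longrightarrow> v x = cell_poly k (T V) u x"
  shows "v = u"
proof
  fix x show "v x = u x"
  proof (cases "x \<in> convex hull X")
    case True
    then obtain V where "V \<in> X" "x \<in> T V" using UN_T by blast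
    then show ?thesis using v(2) superspline_cell(2)[OF u] by simp
  next
    case False
    then show ?thesis using v(1) u by (simp add: superspline_def)
  qed
qed

text \<open>Smoothness is an existence statement and \<open>cell_poly\<close> a definite
  description, so neither shows its linearity directly. The combined cell polynomials are
  reassembled into a shape function, which then has to be the pointwise combination.\<close>

lemma superspline_lincomb:
  assumes u: "u \<in> S" and v: "v \<in> S"
  shows "(\<lambda>x. a * u x + c * v x) \<in> S"
    and "V \<in> X \<Longrightarrow> cell_poly k (T V) (\<lambda>x. a * u x + c * v x) =
      (\<lambda>x. a * cell_poly k (T V) u x + c * cell_poly k (T V) v x)"
proof -
  define P where "P V x = a * cell_poly k (T V) u x + c * cell_poly k (T V) v x" for V x
  have d: "(\<lambda>x. P V x - P W x) \<in> vanishing k m Y"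
    if "(\<lambda>x. cell_poly k (T V) u x - cell_poly k (T W) u x) \<in> vanishing k m Y"
      "(\<lambda>x. cell_poly k (T V) v x - cell_poly k (T W) v x) \<in> vanishing k m Y" for V W m Y
    using vanishing_add[OF vanishing_scale[OF that(1), of a]
        vanishing_scale[OF that(2), of c]]
    by (simp add: P_def algebra_simps)
  have "\<exists>w\<in>S. \<forall>V\<in>X. cell_poly k (T V) w = P V"
  proof (rule superspline_of_pieces)
    show "P V \<in> polys k" if "V \<in> X" for V
      unfolding P_def by (intro polys_add polys_scale
          superspline_cell u v that)
    fix V W assume VW: "V \<in> X" "W \<in> X"
    show "(\<lambda>x. P V x - P W x) \<in> vanishing k (Suc (r 1)) (T V \<inter> T W)"
      by (intro d superspline_interface u v VW)
    show "(\<lambda>x. P V x - P W x) \<in> vanishing k (Suc \<rho>) {A}"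
      by (intro d superspline_centre u v VW)
  next
    fix C V W assume C: "C \<subseteq> X" "C \<noteq> {}" "V \<in> X - C" "W \<in> X - C"
    have "C \<subset> X" using C by auto
    then show "(\<lambda>x. P V x - P W x) \<in> vanishing k (Suc (r (card (X - C)))) (convex hull C)"
      unfolding face_order_def[symmetric] by (intro d superspline_face u v C)
  qed
  then obtain w where w: "w \<in> S" "\<forall>V\<in>X. cell_poly k (T V) w = P V" by blast
  have e: "(\<lambda>x. a * u x + c * v x) = w"
  proof (rule superspline_eqI[OF w(1)])
    show "a * u x + c * v x = 0" if "x \<notin> convex hull X" for x
      using u v that by (simp add: superspline_def)
    show "a * u x + c * v x = cell_poly k (T V) w x" if "V \<in> X" "x \<in> T V" for V x
      using w(2) superspline_cell(2)[OF u that] superspline_cell(2)[OF v that] that(1) by (simp add: P_def)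
  qed
  show "(\<lambda>x. a * u x + c * v x) \<in> S" unfolding e by (rule w)
  show "cell_poly k (T V) (\<lambda>x. a * u x + c * v x) =
      (\<lambda>x. a * cell_poly k (T V) u x + c * cell_poly k (T V) v x)" if "V \<in> X"
    unfolding e using w(2) that by (simp add: P_def[abs_def])
qed

lemma zero_in_superspline: "(\<lambda>x. 0) \<in> S"
proof -
  have "\<exists>w\<in>S. \<forall>V\<in>X. cell_poly k (T V) w = (\<lambda>x. 0)"
    by (rule superspline_of_pieces)
      (simp_all add: vanishing_zero polys_zero)
  then obtain w where w: "w \<in> S" "\<forall>V\<in>X. cell_poly k (T V) w = (\<lambda>x. 0)" by blast
  have "(\<lambda>x. 0) = w" by (rule superspline_eqI[OF w(1)]) (use w(2) in auto)
  then show ?thesis using w(1) by simp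
qed

lemma fun_subspace_superspline: "fun_subspace S"
  unfolding fun_subspace_def
proof (intro conjI ballI allI zero_in_superspline)
  fix u v c assume u: "u \<in> S"
  show "(\<lambda>x. c * u x) \<in> S" using superspline_lincomb(1)[OF u u, of c 0] by simp
  assume v: "v \<in> S"
  show "(\<lambda>x. u x + v x) \<in> S" using superspline_lincomb(1)[OF u v, of 1 1] by simp
qed

lemma
  assumes "u \<in> S" "V \<in> X"
  shows cell_poly_add: "v \<in> S \<Longrightarrow> cell_poly k (T V) (\<lambda>x. u x + v x) =
      (\<lambda>x. cell_poly k (T V) u x + cell_poly k (T V) v x)"
    and cell_poly_cmult: "cell_poly k (T V) (\<lambda>x. c * u x) = (\<lambda>x. c * cell_poly k (T V) u x)"
  using superspline_lincomb(2)[OF assms(1) _ assms(2), of v 1 1]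
    superspline_lincomb(2)[OF assms(1) assms(1) assms(2), of c 0] by simp_all

lemma cell_bubbles_iff:
  "u \<in> cell_bubbles k r \<rho> A (convex hull X) \<longleftrightarrow> u \<in> S \<and> (\<forall>C V. C \<subset> X \<longrightarrow> C \<noteq> {} \<longrightarrow> V \<in> X - C \<longrightarrow>
    cell_poly k (T V) u \<in> flat_on C)"
  (is "_ \<longleftrightarrow> _ \<and> ?R")
proof -
  have "(\<forall>F\<in>subsimplices (convex hull X). \<forall>T\<in>alfeld_split A (convex hull X).
     F \<noteq> convex hull X \<longrightarrow> F \<subseteq> T \<longrightarrow> cell_poly k T u \<in> vanishing k (Suc (trace_order r F)) F) \<longleftrightarrow>
    (\<forall>C. C \<subseteq> X \<and> C \<noteq> {} \<longrightarrow> (\<forall>V\<in>X. C \<noteq> X \<longrightarrow> V \<notin> C \<longrightarrow>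
      cell_poly k (T V) u \<in> flat_on C))"
    unfolding subsimplices_eq alfeld_split_eq
    by (simp add: hull_eq_iff hull_subset_T_iff trace_order_hull)
  also have "\<dots> \<longleftrightarrow> ?R"
    unfolding psubset_eq Diff_iff by (intro iffI allI impI ballI) simp_all
  finally show ?thesis by (simp add: cell_bubbles_def)
qed

lemma fun_subspace_cell_bubbles: "fun_subspace (cell_bubbles k r \<rho> A (convex hull X))"
  unfolding fun_subspace_def
proof (intro conjI ballI allI)
  have "cell_poly k (T V) (\<lambda>x. 0) = (\<lambda>x. 0)" if "V \<in> X" for V
    using cell_poly_cmult[OF zero_in_superspline that, of 0] by simp
  then show "(\<lambda>x. 0) \<in> cell_bubbles k r \<rho> A (convex hull X)"
    unfolding cell_bubbles_iff by (simp add: zero_in_superspline vanishing_zero)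
  fix u v c assume u: "u \<in> cell_bubbles k r \<rho> A (convex hull X)"
  then have uS: "u \<in> S" by (simp add: cell_bubbles_iff)
  show "(\<lambda>x. c * u x) \<in> cell_bubbles k r \<rho> A (convex hull X)"
    using u unfolding cell_bubbles_iff
    by (simp add: fun_subspace_scale[OF fun_subspace_superspline] cell_poly_cmult[OF uS]
        vanishing_scale)
  assume v: "v \<in> cell_bubbles k r \<rho> A (convex hull X)"
  then have vS: "v \<in> S" by (simp add: cell_bubbles_iff)
  show "(\<lambda>x. u x + v x) \<in> cell_bubbles k r \<rho> A (convex hull X)"
    using u v unfolding cell_bubbles_iff
    by (simp add: fun_subspace_add[OF fun_subspace_superspline] cell_poly_add[OF uS _ vS]
        vanishing_add)
qed

lemma dual_cell_dofs_exist: "\<exists>n xs ws. dual_cell_dofs k r \<rho> A (convex hull X) n xs ws"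
proof -
  define cell where "cell x = (SOME V. V \<in> X \<and> x \<in> T V)" for x
  have cell: "cell x \<in> X \<and> x \<in> T (cell x)" if x: "x \<in> convex hull X" for x
  proof -
    obtain V where "V \<in> X \<and> x \<in> T V" using UN_T x by blast
    then show ?thesis unfolding cell_def by (rule someI[of "\<lambda>V. V \<in> X \<and> x \<in> T V"])
  qed
  \<comment> \<open>Assigning each point to one cell turns the Bernstein expansions on the cells
    into a single finite expansion. The functions \<open>B i\<close> may be discontinuous and
    outside the space; they only bound its dimension.\<close>
  define B where "B i x = (if x \<in> convex hull X \<and> cell x = fst i then bern (snd i) x else 0)" for i x
  have fI: "finite (X \<times> idx k)" using fin finite_idx by simp
  have span: "\<exists>c. u = (\<lambda>x. \<Sum>i\<in>X \<times> idx k. c i * B i x)" if "u \<in> cell_bubbles k r \<rho> A (convex hull X)" for u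
  proof -
    have u: "u \<in> S" using that by (simp add: cell_bubbles_iff)
    have "\<exists>c. cell_poly k (T V) u = (\<lambda>x. \<Sum>\<alpha>\<in>idx k. c \<alpha> * bern \<alpha> x)" if V: "V \<in> X" for V
      by (rule polys_bern_expansion[OF superspline_cell(1)[OF u V]]) blast
    then have "\<forall>V\<in>X. \<exists>c. cell_poly k (T V) u = (\<lambda>x. \<Sum>\<alpha>\<in>idx k. c \<alpha> * bern \<alpha> x)" by blast
    then obtain c where c: "\<forall>V\<in>X. cell_poly k (T V) u = (\<lambda>x. \<Sum>\<alpha>\<in>idx k. c V \<alpha> * bern \<alpha> x)"
      using bchoice[of X "\<lambda>V c. cell_poly k (T V) u = (\<lambda>x. \<Sum>\<alpha>\<in>idx k. c \<alpha> * bern \<alpha> x)"] by blast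
    have "u x = (\<Sum>i\<in>X \<times> idx k. c (fst i) (snd i) * B i x)" for x
    proof (cases "x \<in> convex hull X")
      case True
      have "(\<Sum>i\<in>X \<times> idx k. c (fst i) (snd i) * B i x) = (\<Sum>V\<in>X. \<Sum>\<alpha>\<in>idx k. c V \<alpha> * B (V, \<alpha>) x)"
        by (simp add: sum.cartesian_product case_prod_unfold)
      also have "\<dots> = (\<Sum>V\<in>X. if V = cell x then \<Sum>\<alpha>\<in>idx k. c V \<alpha> * bern \<alpha> x else 0)"
        by (intro sum.cong refl) (use True in \<open>auto simp: B_def\<close>)
      also have "\<dots> = (\<Sum>\<alpha>\<in>idx k. c (cell x) \<alpha> * bern \<alpha> x)"
        using cell[OF True] fin by simp
      also have "\<dots> = cell_poly k (T (cell x)) u x" using c cell[OF True] by simp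
      also have "\<dots> = u x" using superspline_cell(2)[OF u] cell[OF True] by simp
      finally show ?thesis by simp
    next
      case False
      then show ?thesis using u by (simp add: B_def superspline_def)
    qed
    then have "u = (\<lambda>x. \<Sum>i\<in>X \<times> idx k. c (fst i) (snd i) * B i x)" by (rule ext)
    then show ?thesis by - (rule exI[where x = "\<lambda>i. c (fst i) (snd i)"], assumption)
  qed
  show ?thesis
    unfolding dual_cell_dofs_def
    by (rule evaluation_basis[where b = B, OF fI fun_subspace_cell_bubbles]) (rule span)
qed

end

text \<open>A functional needs a definite cell. By \<open>cell_of_partial_derivs\<close> any cell
  containing \<open>F\<close> gives the same value up to the order prescribed on
  \<open>F\<close>.\<close>

definition cell_of :: "real ^ 'n \<Rightarrow> (real ^ 'n) set \<Rightarrow> (real ^ 'n) set \<Rightarrow> (real ^ 'n) set" where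
  "cell_of A K F = (SOME T. T \<in> alfeld_split A K \<and> F \<subseteq> T)"

section \<open>Unisolvence\<close>

context superspline_params
begin

lemma face_bubbles_hull:
  assumes "C \<subseteq> X"
  shows "q \<in> face_bubbles k r (convex hull C) \<longleftrightarrow> q \<in> polys k \<and>
    (\<forall>C'. C' \<subset> C \<longrightarrow> C' \<noteq> {} \<longrightarrow> q \<in> flat_on C')"
proof -
  have "r (Suc CARD('n) - card C') = face_order C'" if "C' \<subset> C" for C'
  proof -
    have "C' \<subseteq> X" using that assms by blast
    then show ?thesis by (simp add: face_order_def card_compl)
  qed
  then show ?thesis by (simp add: face_bubbles_def vertices_hull[OF assms] cong: conj_cong)
qed

lemma cell_of_hull:
  assumes C: "C \<subset> X"
  obtains V where "V \<in> X - C" "cell_of A (convex hull X) (convex hull C) = T V"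
proof -
  have CX: "C \<subseteq> X" using C by auto
  obtain V where "V \<in> X" "V \<notin> C" using C by auto
  then have "T V \<in> alfeld_split A (convex hull X) \<and> convex hull C \<subseteq> T V"
    using hull_subset_T_iff[OF CX] by (simp add: alfeld_split_eq)
  then have "cell_of A (convex hull X) (convex hull C) \<in> alfeld_split A (convex hull X) \<and>
      convex hull C \<subseteq> cell_of A (convex hull X) (convex hull C)"
    unfolding cell_of_def by (rule someI)
  then obtain W where W: "W \<in> X" "cell_of A (convex hull X) (convex hull C) = T W" "convex hull C \<subseteq> T W"
    unfolding alfeld_split_eq by auto
  then have "W \<in> X - C" using hull_subset_T_iff[OF CX W(1)] by simp
  then show ?thesis using that W by blast
qed

lemma cell_of_partial_derivs:
  assumes u: "u \<in> S" and C: "C \<subset> X" "C \<noteq> {}" and V: "V \<in> X - C"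
    and len: "length is \<le> face_order C" and x: "x \<in> convex hull C"
  shows "partial_derivs is (cell_poly k (cell_of A (convex hull X) (convex hull C)) u) x =
    partial_derivs is (cell_poly k (T V) u) x"
proof -
  obtain W where W: "W \<in> X - C" "cell_of A (convex hull X) (convex hull C) = T W"
    by (rule cell_of_hull[OF C(1)])
  have VX: "V \<in> X" "W \<in> X" using V W by auto
  note p = superspline_cell(1)[OF u VX(2)] superspline_cell(1)[OF u VX(1)]
  have "partial_derivs is (\<lambda>x. cell_poly k (T W) u x - cell_poly k (T V) u x) x = 0"
    using superspline_face[OF u C W(1) V] len x by (simp add: vanishing_def)
  then show ?thesis unfolding W(2) partial_derivs_diff[OF p] by simp
qed

text \<open>Ordering by the number of vertices makes the system triangular: extended bubbles vanish
  on the other faces of at most the same size, and cell bubbles on all proper faces. A function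
  killed by all functionals loses its traces from the vertices upwards; what remains is a cell
  bubble, and point values separate those.\<close>

lemma unisolvent:
  assumes face: "\<And>C. C \<subset> X \<Longrightarrow> C \<noteq> {} \<Longrightarrow> dual_face_dofs k r (convex hull C) (N (convex hull C)) (e (convex hull C)) (p (convex hull C))"
    and cell: "dual_cell_dofs k r \<rho> A (convex hull X) (N (convex hull X)) xs ws"
    and \<phi>_face: "\<And>C i V u. C \<subset> X \<Longrightarrow> C \<noteq> {} \<Longrightarrow> i < N (convex hull C) \<Longrightarrow> u \<in> S \<Longrightarrow> V \<in> X - C \<Longrightarrow>
      \<phi> (convex hull C, i) u =
        derivative_at (e (convex hull C) i) (cell_poly k (T V) u)"
    and \<phi>_cell: "\<And>i u. i < N (convex hull X) \<Longrightarrow> u \<in> S \<Longrightarrow> \<phi> (convex hull X, i) u = u (xs i)"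
  shows "dual_basis S (dof_indices N (convex hull X)) \<phi>"
proof -
  define I where "I = dof_indices N (convex hull X)"
  have memI: "Fi \<in> I \<longleftrightarrow> (\<exists>C i. C \<subseteq> X \<and> C \<noteq> {} \<and> i < N (convex hull C) \<and> Fi = (convex hull C, i))" for Fi
    unfolding I_def dof_indices_def subsimplices_eq by (cases Fi) auto
  have fI: "finite I"
  proof -
    have "finite {C. C \<subseteq> X \<and> C \<noteq> {}}" using fin by (simp add: Collect_conj_eq[symmetric])
    then show ?thesis unfolding I_def dof_indices_def subsimplices_eq by auto
  qed
  define rank where "rank Fi = card (vertices (fst Fi))" for Fi :: "(real ^ 'n) set \<times> nat"
  have bubble: "w i \<in> S" if "w i \<in> cell_bubbles k r \<rho> A (convex hull X)" for w :: "nat \<Rightarrow> _" and i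
    using that by (simp add: cell_bubbles_iff)
  have pick: "\<exists>V. V \<in> X - C" if "C \<subset> X" for C using that by auto
  have linear: "linear_functional_on S (\<phi> Fi)" if "Fi \<in> I" for Fi
  proof -
    obtain C i where C: "C \<subseteq> X" "C \<noteq> {}" "i < N (convex hull C)" "Fi = (convex hull C, i)"
      using \<open>Fi \<in> I\<close> memI by blast
    show ?thesis
    proof (cases "C = X")
      case True
      then show ?thesis using C(3) unfolding linear_functional_on_def C(4) True
        by (simp add: \<phi>_cell fun_subspace_add[OF fun_subspace_superspline] fun_subspace_scale[OF fun_subspace_superspline])
    next
      case False
      then have CX: "C \<subset> X" using C by auto
      then obtain V where V: "V \<in> X - C" using pick by blast
      then have VX: "V \<in> X" by simp
      have \<phi>: "\<phi> Fi u = derivative_at (e (convex hull C) i) (cell_poly k (T V) u)"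
        if "u \<in> S" for u unfolding C(4) by (rule \<phi>_face[OF CX C(2,3) that V])
      show ?thesis unfolding linear_functional_on_def
      proof (intro conjI ballI allI)
        fix u v c assume u: "u \<in> S"
        show "\<phi> Fi (\<lambda>x. c * u x) = c * \<phi> Fi u"
          unfolding \<phi>[OF u] \<phi>[OF fun_subspace_scale[OF fun_subspace_superspline u]]
            cell_poly_cmult[OF u VX] partial_derivs_cmult[OF superspline_cell(1)[OF u VX]] ..
        assume v: "v \<in> S"
        show "\<phi> Fi (\<lambda>x. u x + v x) = \<phi> Fi u + \<phi> Fi v"
          unfolding \<phi>[OF u] \<phi>[OF v] \<phi>[OF fun_subspace_add[OF fun_subspace_superspline u v]]
            cell_poly_add[OF u VX v] partial_derivs_add[OF superspline_cell(1)[OF u VX] superspline_cell(1)[OF v VX]] ..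
      qed
    qed
  qed
  have faceD: "length (fst (e (convex hull C) i)) \<le> face_order C" "snd (e (convex hull C) i) \<in> convex hull C"
    "p (convex hull C) i \<in> face_bubbles k r (convex hull C)"
    if "C \<subset> X" "C \<noteq> {}" "i < N (convex hull C)" for C i
    using face[OF that(1,2)] that(3) trace_order_hull[of C] psubset_imp_subset[OF that(1)]
    by (auto simp: dual_face_dofs_def)
  have faceDual: "derivative_at (e (convex hull C) i) (p (convex hull C) j) =
      (if i = j then 1 else 0)" if "C \<subset> X" "C \<noteq> {}" "i < N (convex hull C)" "j < N (convex hull C)" for C i j
    using face[OF that(1,2)] that(3,4) by (simp add: dual_face_dofs_def)
  have zero: "derivative_at (e (convex hull C) i) q = 0"
    if "C \<subset> X" "C \<noteq> {}" "i < N (convex hull C)" "q \<in> flat_on C" for C i q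
    using faceD(1,2)[OF that(1-3)] that(4) by (simp add: vanishing_def)
  have cellD: "ws i \<in> cell_bubbles k r \<rho> A (convex hull X)" if "i < N (convex hull X)" for i
    using cell that by (simp add: dual_cell_dofs_def)
  have cellDual: "ws j (xs i) = (if i = j then 1 else 0)" if "i < N (convex hull X)" "j < N (convex hull X)" for i j
    using cell that by (simp add: dual_cell_dofs_def)
  have cellSep: "w = (\<lambda>x. 0)" if "w \<in> cell_bubbles k r \<rho> A (convex hull X)" "\<And>i. i < N (convex hull X) \<Longrightarrow> w (xs i) = 0" for w
    using cell that by (simp add: dual_cell_dofs_def)
  have "\<exists>u\<in>S. \<phi> Fi u = 1 \<and> (\<forall>Gj\<in>I. Gj \<noteq> Fi \<longrightarrow> rank Gj \<le> rank Fi \<longrightarrow> \<phi> Gj u = 0)" if "Fi \<in> I" for Fi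
  proof -
    obtain C i where C: "C \<subseteq> X" "C \<noteq> {}" "i < N (convex hull C)" "Fi = (convex hull C, i)"
      using \<open>Fi \<in> I\<close> memI by blast
    show ?thesis
    proof (cases "C = X")
      case True
      have i: "i < N (convex hull X)" using C True by simp
      have wS: "ws i \<in> S" using cellD[OF i] by (simp add: cell_bubbles_iff)
      have b: "cell_poly k (T V) (ws i) \<in> flat_on D"
        if "D \<subset> X" "D \<noteq> {}" "V \<in> X - D" for D V
        using cellD[OF i] that unfolding cell_bubbles_iff by blast
      show ?thesis
      proof (intro bexI[OF _ wS] conjI ballI impI)
        show "\<phi> Fi (ws i) = 1" unfolding C(4) True \<phi>_cell[OF i wS] using cellDual[OF i i] by simp
        fix Gj assume "Gj \<in> I" "Gj \<noteq> Fi"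
        then obtain D j where D: "D \<subseteq> X" "D \<noteq> {}" "j < N (convex hull D)" "Gj = (convex hull D, j)"
          using memI by blast
        show "\<phi> Gj (ws i) = 0"
        proof (cases "D = X")
          case DX: True
          have j: "j < N (convex hull X)" using D DX by simp
          have "j \<noteq> i" using \<open>Gj \<noteq> Fi\<close> D C True DX by auto
          then show ?thesis unfolding D(4) DX \<phi>_cell[OF j wS] using cellDual[OF j i] by simp
        next
          case False
          then have DX: "D \<subset> X" using D by auto
          then obtain V where V: "V \<in> X - D" using pick by blast
          show ?thesis unfolding D(4) \<phi>_face[OF DX D(2,3) wS V]
            by (rule zero[OF DX D(2,3) b[OF DX D(2) V]])
        qed
      qed
    next
      case False
      then have CX: "C \<subset> X" using C by auto
      have pb: "p (convex hull C) i \<in> polys k"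
        "\<And>C'. C' \<subset> C \<Longrightarrow> C' \<noteq> {} \<Longrightarrow> p (convex hull C) i \<in> flat_on C'"
        using faceD(3)[OF CX C(2,3)] unfolding face_bubbles_hull[OF C(1)] by blast+
      have "\<exists>u\<in>S.
        (\<forall>V\<in>X - C. (\<lambda>x. p (convex hull C) i x - cell_poly k (T V) u x) \<in> flat_on C) \<and>
        (\<forall>C' V. C' \<subset> X \<longrightarrow> C' \<noteq> {} \<longrightarrow> C' \<noteq> C \<longrightarrow> card C' \<le> card C \<longrightarrow> V \<in> X - C' \<longrightarrow>
          cell_poly k (T V) u \<in> flat_on C')"
        by (rule trace_extension[OF CX C(2) pb(1)]) (rule pb(2))
      then obtain u where u: "u \<in> S"
        "\<forall>V\<in>X - C. (\<lambda>x. p (convex hull C) i x - cell_poly k (T V) u x) \<in> flat_on C"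
        "\<forall>C' V. C' \<subset> X \<longrightarrow> C' \<noteq> {} \<longrightarrow> C' \<noteq> C \<longrightarrow> card C' \<le> card C \<longrightarrow> V \<in> X - C' \<longrightarrow>
          cell_poly k (T V) u \<in> flat_on C'"
        by (elim bexE conjE)
      have same: "\<phi> (convex hull C, j) u = (if j = i then 1 else 0)" if j: "j < N (convex hull C)" for j
      proof -
        obtain V where V: "V \<in> X - C" using pick[OF CX] by blast
        then have VX: "V \<in> X" by simp
        have "derivative_at (e (convex hull C) j) (\<lambda>x. p (convex hull C) i x - cell_poly k (T V) u x) = 0"
          by (rule zero[OF CX C(2) j]) (use u(2) V in blast)
        then show ?thesis
          unfolding partial_derivs_diff[OF pb(1) superspline_cell(1)[OF u(1) VX]] \<phi>_face[OF CX C(2) j u(1) V]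
          using faceDual[OF CX C(2) j C(3)] by simp
      qed
      show ?thesis
      proof (intro bexI[OF _ u(1)] conjI ballI impI)
        show "\<phi> Fi u = 1" unfolding C(4) using same[OF C(3)] by simp
        fix Gj assume "Gj \<in> I" "Gj \<noteq> Fi" and rank: "rank Gj \<le> rank Fi"
        then obtain D j where D: "D \<subseteq> X" "D \<noteq> {}" "j < N (convex hull D)" "Gj = (convex hull D, j)"
          using memI by blast
        have card: "card D \<le> card C" using rank D C by (simp add: rank_def vertices_hull)
        then have DX: "D \<subset> X" using D(1) psubset_card_mono[OF fin CX] by auto
        show "\<phi> Gj u = 0"
        proof (cases "D = C")
          case True
          then have "j \<noteq> i" using \<open>Gj \<noteq> Fi\<close> D C by auto
          then show ?thesis unfolding D(4) True using same[of j] D True by simp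
        next
          case False
          obtain V where V: "V \<in> X - D" using pick[OF DX] by blast
          have "cell_poly k (T V) u \<in> flat_on D"
            using u(3) DX D(2) False card V by blast
          then show ?thesis unfolding D(4) \<phi>_face[OF DX D(2,3) u(1) V] by (rule zero[OF DX D(2,3)])
        qed
      qed
    qed
  qed
  then have "\<forall>Fi\<in>I. \<exists>u. u \<in> S \<and> \<phi> Fi u = 1 \<and> (\<forall>Gj\<in>I. Gj \<noteq> Fi \<longrightarrow> rank Gj \<le> rank Fi \<longrightarrow> \<phi> Gj u = 0)"
    by blast
  from bchoice[OF this] obtain u where
    u: "\<forall>Fi\<in>I. u Fi \<in> S \<and> \<phi> Fi (u Fi) = 1 \<and> (\<forall>Gj\<in>I. Gj \<noteq> Fi \<longrightarrow> rank Gj \<le> rank Fi \<longrightarrow> \<phi> Gj (u Fi) = 0)"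
    by (elim exE)
  have sep: "v = (\<lambda>x. 0)" if v: "v \<in> S" and z: "\<And>Fi. Fi \<in> I \<Longrightarrow> \<phi> Fi v = 0" for v
  proof -
    \<comment> \<open>On the boundary of \<open>C\<close> the traces are zero by induction, so the
      cell polynomial is a face bubble, and zero degrees of freedom at \<open>C\<close> force its
      jet along the face to vanish.\<close>
    have van: "cell_poly k (T V) v \<in> flat_on C"
      if "C \<subset> X" "C \<noteq> {}" "V \<in> X - C" for C V
      using that
    proof (induction "card C" arbitrary: C V rule: less_induct)
      case less
      have CX: "C \<subseteq> X" and VX: "V \<in> X" using less.prems by auto
      have IH: "cell_poly k (T V) v \<in> flat_on C'" if "C' \<subset> C" "C' \<noteq> {}" for C'
        by (rule less.hyps[OF psubset_card_mono[OF fin_sub[OF CX] that(1)] _ that(2)]) (use that less.prems in auto)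
      have "cell_poly k (T V) v \<in> face_bubbles k r (convex hull C)"
        unfolding face_bubbles_hull[OF CX] using superspline_cell(1)[OF v VX] IH by simp
      moreover have "derivative_at (e (convex hull C) i) (cell_poly k (T V) v) = 0"
        if "i < N (convex hull C)" for i
      proof -
        have "(convex hull C, i) \<in> I" using memI CX less.prems that by blast
        then show ?thesis using z \<phi>_face[OF less.prems(1,2) that v less.prems(3)] by simp
      qed
      ultimately show ?case
        using face[OF less.prems(1,2)] trace_order_hull[OF CX] by (simp add: dual_face_dofs_def)
    qed
    have "v \<in> cell_bubbles k r \<rho> A (convex hull X)"
      unfolding cell_bubbles_iff using v van by simp
    moreover have "v (xs i) = 0" if "i < N (convex hull X)" for i
    proof -
      have "X \<noteq> {}" using card_X by auto
      then have "(convex hull X, i) \<in> I" using memI that by blast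
      then show ?thesis using z \<phi>_cell[OF that v] by simp
    qed
    ultimately show ?thesis by (rule cellSep)
  qed
  show ?thesis unfolding I_def[symmetric]
  proof (rule dual_basis_of_triangular[where rank = rank and u = u, OF fI fun_subspace_superspline linear])
    show "u Fi \<in> S" "\<phi> Fi (u Fi) = 1" if "Fi \<in> I" for Fi using u that by blast+
    show "\<phi> Gj (u Fi) = 0" if "Fi \<in> I" "Gj \<in> I" "Gj \<noteq> Fi" "rank Gj \<le> rank Fi" for Fi Gj
      using u that by blast
    show "v = (\<lambda>x. 0)" if "v \<in> S" "\<And>Fi. Fi \<in> I \<Longrightarrow> \<phi> Fi v = 0" for v by (rule sep[OF that])
  qed
qed

end

text \<open>The upward induction of the unisolvence proof, applied to the difference of two
  polynomials from different simplices. That difference is a polynomial on the whole space and face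
  bubbles refer to the face only, so it can be tested by the shared degrees of freedom.\<close>

lemma traces_agree:
  assumes P: "superspline_params X l A r \<rho> k b" and P': "superspline_params X' l' A' r \<rho> k b"
    and u: "u \<in> superspline k r \<rho> A (convex hull X)" and u': "u' \<in> superspline k r \<rho> A' (convex hull X')"
    and dofs: "\<And>D. D \<subset> X \<Longrightarrow> D \<noteq> {} \<Longrightarrow> dual_face_dofs k r (convex hull D) (N (convex hull D)) (e (convex hull D)) (p (convex hull D))"
    and eq: "\<And>D i V V'. D \<subset> X \<Longrightarrow> D \<subset> X' \<Longrightarrow> D \<noteq> {} \<Longrightarrow> i < N (convex hull D) \<Longrightarrow> V \<in> X - D \<Longrightarrow> V' \<in> X' - D \<Longrightarrow>
      derivative_at (e (convex hull D) i) (cell_poly k (alfeld.T X A V) u) =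
      derivative_at (e (convex hull D) i) (cell_poly k (alfeld.T X' A' V') u')"
    and C: "C \<subset> X" "C \<subset> X'" "C \<noteq> {}" "V \<in> X - C" "V' \<in> X' - C"
  shows "(\<lambda>x. cell_poly k (alfeld.T X A V) u x - cell_poly k (alfeld.T X' A' V') u' x)
    \<in> vanishing k (Suc (r (card (X - C)))) (convex hull C)"
proof -
  interpret P: superspline_params X l A r \<rho> k b by (rule P)
  interpret P': superspline_params X' l' A' r \<rho> k b by (rule P')
  show ?thesis
    using C
  proof (induction "card C" arbitrary: C V V' rule: less_induct)
    case less
    have CX: "C \<subseteq> X" and VX: "V \<in> X" "V' \<in> X'" using less.prems by auto
    let ?q = "\<lambda>x. cell_poly k (alfeld.T X A V) u x - cell_poly k (alfeld.T X' A' V') u' x"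
    note q = P.superspline_cell(1)[OF u VX(1)] P'.superspline_cell(1)[OF u' VX(2)]
    have IH: "?q \<in> P.flat_on D" if D: "D \<subset> C" "D \<noteq> {}" for D
      unfolding P.face_order_def
      by (rule less.hyps[OF psubset_card_mono[OF P.fin_sub[OF CX] D(1)] _ _ D(2)]) (use D less.prems in auto)
    have "?q \<in> face_bubbles k r (convex hull C)"
      unfolding P.face_bubbles_hull[OF CX] using polys_diff[OF q] IH by simp
    moreover have "derivative_at (e (convex hull C) i) ?q = 0"
      if "i < N (convex hull C)" for i
      unfolding partial_derivs_diff[OF q] using eq[OF less.prems(1-3) that less.prems(4,5)] by simp
    ultimately have "?q \<in> vanishing k (Suc (trace_order r (convex hull C))) (convex hull C)"
      using dofs[OF less.prems(1,3)] by (simp add: dual_face_dofs_def)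
    then show ?case unfolding P.trace_order_hull[OF CX] P.face_order_def .
  qed
qed

theorem theorem1p1:
  fixes r :: "nat \<Rightarrow> nat" and \<rho> k b :: nat
    and A :: "(real ^ 'n) set \<Rightarrow> real ^ 'n"
  assumes "CARD('n) \<ge> 2"
    and "1 \<le> \<lceil>(3 * real (r 1) - 1) / 2\<rceil>"
    and "\<lceil>(3 * real (r 1) - 1) / 2\<rceil> \<le> int (r 2)"
    and "int (r 2) \<le> 2 * int (r 1) - 1"
    and "\<forall>i\<in>{2..<CARD('n)}. 2 ^ (CARD('n) - i) * r i \<le> 2 ^ (CARD('n) - (i + 1)) * r (i + 1)"
    and "2 * r CARD('n) + 1 \<le> k"
    and "int \<rho> = int k - int b"
    and "2 * int (r 1) - int (r 2) \<le> int b"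
    and "int b \<le> int (r 2) - int (r 1) + 1"
    and "\<And>K. full_simplex K \<Longrightarrow> A K \<in> interior K"
  shows "\<exists>(N :: (real ^ 'n) set \<Rightarrow> nat) (dof :: 'n dofs).
      unisolvent_dofs (\<lambda>K. superspline k r \<rho> (A K) K) N dof \<and>
      attached_dofs k r A (\<lambda>K. superspline k r \<rho> (A K) K) N dof \<and>
      (\<forall>\<T>. triangulation \<T> \<and> (\<forall>K\<in>\<T>. full_simplex K) \<longrightarrow>
         conforming (r 1) \<T> (fe_space (\<lambda>K. superspline k r \<rho> (A K) K) N dof \<T>))"
proof -
  have r1: "1 \<le> r 1" using assms(2) by (cases "r 1") auto
  have "(3 * real (r 1) - 1) / 2 \<le> real (r 2)" using assms(3) by (simp add: ceiling_le_iff)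
  then have "real (3 * r 1) \<le> real (2 * r 2 + 1)" by (simp add: field_simps)
  then have r12: "3 * r 1 \<le> 2 * r 2 + 1" by (rule of_nat_le_iff[THEN iffD1])
  have double: "2 * r i \<le> r (Suc i)" if "2 \<le> i" "i < CARD('n)" for i
  proof -
    have "2 ^ (CARD('n) - i) * r i \<le> 2 ^ (CARD('n) - (i + 1)) * r (i + 1)" using assms(5) that by simp
    moreover have "CARD('n) - i = Suc (CARD('n) - (i + 1))" using that by simp
    ultimately show ?thesis by simp
  qed
  have simplex: "\<not> affine_dependent (vertices K) \<and> card (vertices K) = Suc CARD('n) \<and> convex hull (vertices K) = K"
    if K: "full_simplex K" for K :: "(real ^ 'n) set"
  proof -
    obtain C where C: "\<not> affine_dependent C" "int (card C) = int CARD('n) + 1" "K = convex hull C"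
      using K by (auto simp: simplex_def)
    have "vertices K = C" unfolding C(3) vertices_def
      using extreme_point_of_convex_hull_affine_independent[OF C(1)] by simp
    then show ?thesis using C by simp
  qed
  have params: "\<exists>l. superspline_params (vertices K) l (A K) r \<rho> k b" if K: "full_simplex K" for K
  proof -
    obtain l where "simplex_coords (vertices K) l" using simplex_coords_exists simplex[OF K] by blast
    then interpret simplex_coords "vertices K" l .
    have "alfeld (vertices K) l (A K)"
      by (rule interior_imp_alfeld) (use assms(10)[OF K] simplex[OF K] in simp)
    then interpret alfeld "vertices K" l "A K" .
    have "superspline_params (vertices K) l (A K) r \<rho> k b"
      by unfold_locales (use assms r1 r12 double in auto)
    then show ?thesis by blast
  qed
  then obtain l where l: "\<And>K. full_simplex K \<Longrightarrow> superspline_params (vertices K) (l K) (A K) r \<rho> k b"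
    by metis
  have "\<forall>F :: (real ^ 'n) set. \<exists>nep. dual_face_dofs k r F (fst nep) (fst (snd nep)) (snd (snd nep))"
    using dual_face_dofs_exist by (metis fst_conv snd_conv)
  then obtain nep where nep: "\<And>F :: (real ^ 'n) set. dual_face_dofs k r F (fst (nep F)) (fst (snd (nep F))) (snd (snd (nep F)))"
    by metis
  have "\<forall>K. \<exists>c. full_simplex K \<longrightarrow> dual_cell_dofs k r \<rho> (A K) K (fst c) (fst (snd c)) (snd (snd c))"
  proof
    fix K :: "(real ^ 'n) set"
    show "\<exists>c. full_simplex K \<longrightarrow> dual_cell_dofs k r \<rho> (A K) K (fst c) (fst (snd c)) (snd (snd c))"
    proof (cases "full_simplex K")
      case True
      obtain n xs ws where "dual_cell_dofs k r \<rho> (A K) K n xs ws"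
        using superspline_params.dual_cell_dofs_exist[OF l[OF True]] simplex[OF True] by auto
      then show ?thesis by (intro exI[of _ "(n, xs, ws)"]) simp
    qed simp
  qed
  then obtain c where c: "\<And>K. full_simplex K \<Longrightarrow> dual_cell_dofs k r \<rho> (A K) K (fst (c K)) (fst (snd (c K))) (snd (snd (c K)))"
    by metis
  \<comment> \<open>Full simplices carry cell degrees of freedom and all other sets those of a face;
    \<open>not_full\<close> puts proper subsimplices into the second case.\<close>
  define N where "N F = (if full_simplex F then fst (c F) else fst (nep F))" for F
  define e where "e F = fst (snd (nep F))" for F
  define p where "p F = snd (snd (nep F))" for F
  define xs where "xs F = fst (snd (c F))" for F
  define dof :: "'n dofs" where "dof K F i u = (if F = K then u (xs K i)
    else derivative_at (e F i) (cell_poly k (cell_of (A K) K F) u))" for K F i u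

  have not_full: "\<not> full_simplex (convex hull C) \<and> convex hull C \<noteq> K" if "full_simplex K" "C \<subset> vertices K" for K C :: "(real ^ 'n) set"
  proof -
    interpret superspline_params "vertices K" "l K" "A K" r \<rho> k b by (rule l[OF that(1)])
    have CX: "C \<subseteq> vertices K" using that by auto
    have "card C < Suc CARD('n)" using psubset_card_mono[OF fin that(2)] card_X by simp
    then show ?thesis using simplex[of "convex hull C"] simplex[OF that(1)] vertices_hull[OF CX] that(2) by auto
  qed
  have face_dofs: "dual_face_dofs k r (convex hull C) (N (convex hull C)) (e (convex hull C)) (p (convex hull C))"
    if "full_simplex K" "C \<subset> vertices K" for K C
    using nep[of "convex hull C"] not_full[OF that] by (simp add: N_def e_def p_def)
  have e: "length (fst (e (convex hull C) i)) \<le> trace_order r (convex hull C)" "snd (e (convex hull C) i) \<in> convex hull C"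
    if "full_simplex K" "C \<subset> vertices K" "i < N (convex hull C)" for K C i
    using face_dofs[OF that(1,2)] that(3) by (simp_all add: dual_face_dofs_def)
  have dof_face: "dof K (convex hull C) i u =
      derivative_at (e (convex hull C) i) (cell_poly k (alfeld.T (vertices K) (A K) V) u)"
    if K: "full_simplex K" and C: "C \<subset> vertices K" "C \<noteq> {}" and i: "i < N (convex hull C)"
      and u: "u \<in> superspline k r \<rho> (A K) K" and V: "V \<in> vertices K - C" for K C i u V
  proof -
    interpret superspline_params "vertices K" "l K" "A K" r \<rho> k b by (rule l[OF K])
    have hK: "convex hull (vertices K) = K" using simplex[OF K] by simp
    have CX: "C \<subseteq> vertices K" using C by auto
    have "derivative_at (e (convex hull C) i) (cell_poly k (cell_of (A K) (convex hull (vertices K)) (convex hull C)) u) =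
      derivative_at (e (convex hull C) i) (cell_poly k (alfeld.T (vertices K) (A K) V) u)"
    proof (rule cell_of_partial_derivs[OF _ C V])
      show "u \<in> superspline k r \<rho> (A K) (convex hull (vertices K))" unfolding hK by (rule u)
      show "length (fst (e (convex hull C) i)) \<le> face_order C" using e(1)[OF K C(1) i] trace_order_hull[OF CX] by simp
      show "snd (e (convex hull C) i) \<in> convex hull C" by (rule e(2)[OF K C(1) i])
    qed
    then show ?thesis using not_full[OF K C(1)] unfolding hK by (simp add: dof_def)
  qed

  have "unisolvent_dofs (\<lambda>K. superspline k r \<rho> (A K) K) N dof"
    unfolding unisolvent_dofs_def
  proof (intro allI impI)
    fix K :: "(real ^ 'n) set" assume K: "full_simplex K"
    interpret superspline_params "vertices K" "l K" "A K" r \<rho> k b by (rule l[OF K])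
    have hK: "convex hull (vertices K) = K" using simplex[OF K] by simp
    have "dual_basis (superspline k r \<rho> (A K) (convex hull (vertices K))) (dof_indices N (convex hull (vertices K)))
        (\<lambda>(F, i). dof K F i)"
    proof (rule unisolvent[where e = e and p = p and xs = "xs K" and ws = "snd (snd (c K))"])
      show "dual_face_dofs k r (convex hull C) (N (convex hull C)) (e (convex hull C)) (p (convex hull C))"
        if "C \<subset> vertices K" for C by (rule face_dofs[OF K that])
      show "dual_cell_dofs k r \<rho> (A K) (convex hull (vertices K)) (N (convex hull (vertices K))) (xs K) (snd (snd (c K)))"
        unfolding hK using c[OF K] K by (simp add: N_def xs_def)
      show "(case (convex hull C, i) of (F, i) \<Rightarrow> dof K F i) u =
          derivative_at (e (convex hull C) i) (cell_poly k (alfeld.T (vertices K) (A K) V) u)"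
        if "C \<subset> vertices K" "C \<noteq> {}" "i < N (convex hull C)" "u \<in> superspline k r \<rho> (A K) (convex hull (vertices K))"
          "V \<in> vertices K - C" for C i V u
        using dof_face[OF K that(1-3) _ that(5), of u] that(4) unfolding hK by simp
      show "(case (convex hull (vertices K), i) of (F, i) \<Rightarrow> dof K F i) u = u (xs K i)" for i u
        unfolding hK by (simp add: dof_def)
    qed
    then show "dual_basis (superspline k r \<rho> (A K) K) (dof_indices N K) (\<lambda>(F, i). dof K F i)"
      unfolding hK .
  qed

  moreover have "attached_dofs k r A (\<lambda>K. superspline k r \<rho> (A K) K) N dof"
    unfolding attached_dofs_def
  proof (intro allI impI ballI, elim conjE)
    fix K K' F :: "(real ^ 'n) set" and t i u u'
    assume i: "i < N F" and u: "u \<in> superspline k r \<rho> (A K) K" and u': "u' \<in> superspline k r \<rho> (A K') K'"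
      and K: "full_simplex K" and K': "full_simplex K'" and t: "t < CARD('n)"
      and sub: "subsimplex t F K" "subsimplex t F K'"
      and tr: "\<forall>n\<le>r (CARD('n) - t). \<forall>T\<in>alfeld_split (A K) K. \<forall>T'\<in>alfeld_split (A K') K'.
        F \<subseteq> T \<and> F \<subseteq> T' \<longrightarrow> same_trace k n F T u T' u'"
    interpret K: superspline_params "vertices K" "l K" "A K" r \<rho> k b by (rule l[OF K])
    interpret K': superspline_params "vertices K'" "l K'" "A K'" r \<rho> k b by (rule l[OF K'])
    have hK: "convex hull (vertices K) = K" "convex hull (vertices K') = K'" using simplex[OF K] simplex[OF K'] by simp_all
    obtain C where C: "C \<subseteq> vertices K" "card C = t + 1" "F = convex hull C"
      using sub(1) by (auto simp: subsimplex_def)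
    obtain C' where C': "C' \<subseteq> vertices K'" "card C' = t + 1" "F = convex hull C'"
      using sub(2) by (auto simp: subsimplex_def)
    have "C' = C" using K.vertices_hull[OF C(1)] K'.vertices_hull[OF C'(1)] C(3) C'(3) by simp
    then have psub: "C \<subset> vertices K" "C \<subset> vertices K'" and ne: "C \<noteq> {}"
      using C C' t K.card_X K'.card_X by auto
    obtain V where V: "V \<in> vertices K - C" using psub by auto
    obtain V' where V': "V' \<in> vertices K' - C" using psub by auto
    have "alfeld.T (vertices K) (A K) V \<in> alfeld_split (A K) K" "F \<subseteq> alfeld.T (vertices K) (A K) V"
      using K.alfeld_split_eq K.hull_subset_T_iff[of C V] V C hK by auto
    moreover have "alfeld.T (vertices K') (A K') V' \<in> alfeld_split (A K') K'" "F \<subseteq> alfeld.T (vertices K') (A K') V'"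
      using K'.alfeld_split_eq K'.hull_subset_T_iff[of C V'] V' C psub hK by auto
    \<comment> \<open>The functional reads one derivative of admissible order at one point of
      \<open>F\<close>, so equal traces give equal values.\<close>
    moreover have len: "length (fst (e F i)) \<le> r (CARD('n) - t)" "snd (e F i) \<in> F"
      using e[OF K psub(1), of i] i C K.vertices_hull[OF C(1)] by (auto simp: trace_order_def)
    ultimately have "same_trace k (length (fst (e F i))) F (alfeld.T (vertices K) (A K) V) u (alfeld.T (vertices K') (A K') V') u'"
      using tr by blast
    then have "derivative_at (e F i) (cell_poly k (alfeld.T (vertices K) (A K) V) u) =
        derivative_at (e F i) (cell_poly k (alfeld.T (vertices K') (A K') V') u')"
      using len(2) by (simp add: same_trace_def)
    then show "dof K F i u = dof K' F i u'"
      using dof_face[OF K psub(1) ne _ u V, of i] dof_face[OF K' psub(2) ne _ u' V', of i] i C(3) by simp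
  qed

  \<comment> \<open>The cells of all simplices together carry one piecewise polynomial.
    \<open>C_upto_piecewise\<close> then asks for equal derivatives at every common point of two
    cells, in the same simplex or in different ones.\<close>
  moreover have "conforming (r 1) \<T> (fe_space (\<lambda>K. superspline k r \<rho> (A K) K) N dof \<T>)"
    if tri: "triangulation \<T>" and full: "\<forall>K\<in>\<T>. full_simplex K" for \<T>
    unfolding conforming_def
  proof
    fix v assume v: "v \<in> fe_space (\<lambda>K. superspline k r \<rho> (A K) K) N dof \<T>"
    define I where "I = (SIGMA K:\<T>. vertices K)"
    define cell_at where "cell_at KV = alfeld.T (vertices (fst KV)) (A (fst KV)) (snd KV)" for KV :: "(real ^ 'n) set \<times> (real ^ 'n)"
    define P where "P KV = cell_poly k (cell_at KV) (v (fst KV))" for KV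
    have K: "full_simplex K" "superspline_params (vertices K) (l K) (A K) r \<rho> k b"
      "convex hull (vertices K) = K" "v K \<in> superspline k r \<rho> (A K) (convex hull (vertices K))" if "K \<in> \<T>" for K
      using that full l simplex[of K] v by (auto simp: fe_space_def)
    have cell: "closed (cell_at (K, V))" "cell_at (K, V) \<subseteq> K" "P (K, V) \<in> polys k" "x \<in> cell_at (K, V) \<Longrightarrow> P (K, V) x = v K x"
      if "K \<in> \<T>" "V \<in> vertices K" for K V x
    proof -
      interpret superspline_params "vertices K" "l K" "A K" r \<rho> k b by (rule K(2)[OF that(1)])
      show "closed (cell_at (K, V))" "cell_at (K, V) \<subseteq> K" "P (K, V) \<in> polys k" "x \<in> cell_at (K, V) \<Longrightarrow> P (K, V) x = v K x"
        using closed_T T_subset[OF that(2)] superspline_cell[OF K(4)[OF that(1)] that(2)] K(3)[OF that(1)]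
        by (auto simp: cell_at_def P_def)
    qed
    have cover: "(\<Union>V\<in>vertices K. cell_at (K, V)) = K" if "K \<in> \<T>" for K
    proof -
      interpret superspline_params "vertices K" "l K" "A K" r \<rho> k b by (rule K(2)[OF that])
      show ?thesis using UN_T K(3)[OF that] by (simp add: cell_at_def)
    qed
    have same_cell: "partial_derivs is (P (K, V)) x = partial_derivs is (P (K, W)) x"
      if "K \<in> \<T>" "V \<in> vertices K" "W \<in> vertices K" "x \<in> cell_at (K, V)" "x \<in> cell_at (K, W)" "length is \<le> r 1" for K V W x "is"
    proof -
      interpret superspline_params "vertices K" "l K" "A K" r \<rho> k b by (rule K(2)[OF that(1)])
      have "partial_derivs is (\<lambda>x. P (K, V) x - P (K, W) x) x = 0"
        using superspline_interface[OF K(4)[OF that(1)] that(2,3)] that(4-6)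
        by (simp add: P_def cell_at_def vanishing_def)
      then show ?thesis
        unfolding partial_derivs_diff[OF cell(3)[OF that(1,2)] cell(3)[OF that(1,3)]] by simp
    qed
    have agree: "partial_derivs is (P (K, V)) x = partial_derivs is (P (K', V')) x"
      if KK: "K \<in> \<T>" "K' \<in> \<T>" and V: "V \<in> vertices K" "V' \<in> vertices K'"
        and x: "x \<in> cell_at (K, V)" "x \<in> cell_at (K', V')" and len: "length is \<le> r 1" for K V K' V' x "is"
    proof (cases "K = K'")
      case True
      have V': "V' \<in> vertices K" "x \<in> cell_at (K, V')" using V(2) x(2) True by simp_all
      show ?thesis using same_cell[OF KK(1) V(1) V'(1) x(1) V'(2) len] True by simp
    next
      case False
      interpret K: superspline_params "vertices K" "l K" "A K" r \<rho> k b by (rule K(2)[OF KK(1)])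
      interpret K': superspline_params "vertices K'" "l K'" "A K'" r \<rho> k b by (rule K(2)[OF KK(2)])
      have xK: "x \<in> K \<inter> K'" using x cell(2)[OF KK(1) V(1)] cell(2)[OF KK(2) V(2)] by auto
      have face: "(K \<inter> K') face_of K" "(K' \<inter> K) face_of K'"
        using tri KK unfolding triangulation_def by blast+
      have "\<exists>C\<subseteq>vertices K. K \<inter> K' = convex hull C"
        using face(1) face_of_convex_hull_affine_independent[OF K.indep, of "K \<inter> K'"] K(3)[OF KK(1)] by simp
      then obtain C where C: "C \<subseteq> vertices K" "K \<inter> K' = convex hull C" by blast
      have "\<exists>C\<subseteq>vertices K'. K \<inter> K' = convex hull C"
        using face(2)[unfolded Int_commute[of K']] face_of_convex_hull_affine_independent[OF K'.indep, of "K \<inter> K'"] K(3)[OF KK(2)] by simp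
      then obtain C' where C': "C' \<subseteq> vertices K'" "K \<inter> K' = convex hull C'" by blast
      have "C' = C" using K.vertices_hull[OF C(1)] K'.vertices_hull[OF C'(1)] C(2) C'(2) by simp
      then have CX': "C \<subseteq> vertices K'" using C' by simp
      have ne: "C \<noteq> {}" using xK C by auto
      have cc: "card (vertices K) = card (vertices K')" using K.card_X K'.card_X by simp
      have neq: "vertices K \<noteq> vertices K'" using False K(3)[OF KK(1)] K(3)[OF KK(2)] by metis
      \<comment> \<open>If \<open>C\<close> were the whole vertex set of one simplex, equal
        cardinalities would force \<open>K = K'\<close>.\<close>
      have psub: "C \<subset> vertices K" "C \<subset> vertices K'"
        using C(1) CX' neq cc card_subset_eq[OF K'.fin, of C] card_subset_eq[OF K.fin, of C] by auto
      \<comment> \<open>The given cells contain \<open>x\<close> but perhaps not the common face;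
        \<open>W\<close> and \<open>W'\<close> index cells that contain all of it. The comparison
        goes from \<open>V\<close> to \<open>W\<close> inside \<open>K\<close>, across the face to
        \<open>W'\<close>, and from there to \<open>V'\<close> inside \<open>K'\<close>.\<close>
      obtain W where W: "W \<in> vertices K - C" using psub by auto
      obtain W' where W': "W' \<in> vertices K' - C" using psub by auto
      have WX: "W \<in> vertices K" "W' \<in> vertices K'" using W W' by auto
      have xC: "x \<in> convex hull C" using xK C by simp
      have xT: "x \<in> cell_at (K, W)" "x \<in> cell_at (K', W')"
        using K.hull_subset_T_iff[OF C(1) WX(1)] K'.hull_subset_T_iff[OF CX' WX(2)] W W' xC by (auto simp: cell_at_def)
      have "(\<lambda>x. P (K, W) x - P (K', W') x) \<in> vanishing k (Suc (r (card (vertices K - C)))) (convex hull C)"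
        unfolding P_def cell_at_def fst_conv snd_conv
      proof (rule traces_agree[where N = N and e = e and p = p, OF K(2)[OF KK(1)] K(2)[OF KK(2)] K(4)[OF KK(1)] K(4)[OF KK(2)] _ _ psub ne W W'])
        show "dual_face_dofs k r (convex hull D) (N (convex hull D)) (e (convex hull D)) (p (convex hull D))"
          if "D \<subset> vertices K" for D by (rule face_dofs[OF K(1)[OF KK(1)] that])
        fix D i U U'
        assume D: "D \<subset> vertices K" "D \<subset> vertices K'" "D \<noteq> {}" and i: "i < N (convex hull D)"
          and U: "U \<in> vertices K - D" and U': "U' \<in> vertices K' - D"
        have "convex hull D \<in> subsimplices K \<inter> subsimplices K'"
          using K.subsimplices_eq K'.subsimplices_eq K(3)[OF KK(1)] K(3)[OF KK(2)] D by auto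
        then have "dof K (convex hull D) i (v K) = dof K' (convex hull D) i (v K')"
          using bspec[OF bspec[OF bspec[OF v[unfolded fe_space_def mem_Collect_eq, THEN conjunct2] KK(1)] KK(2)]] i
          by blast
        moreover have "v K \<in> superspline k r \<rho> (A K) K" "v K' \<in> superspline k r \<rho> (A K') K'"
          using v KK by (auto simp: fe_space_def)
        ultimately show "derivative_at (e (convex hull D) i) (cell_poly k (alfeld.T (vertices K) (A K) U) (v K)) =
          derivative_at (e (convex hull D) i) (cell_poly k (alfeld.T (vertices K') (A K') U') (v K'))"
          using dof_face[OF K(1)[OF KK(1)] D(1,3) i _ U, of "v K"] dof_face[OF K(1)[OF KK(2)] D(2,3) i _ U', of "v K'"]
          by simp
      qed
      \<comment> \<open>The traces agree up to the order prescribed on the common face, and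
        \<open>r 1\<close> is the smallest of these orders.\<close>
      moreover have "r 1 \<le> r (card (vertices K - C))"
      proof (cases "2 \<le> card (vertices K - C)")
        case True
        then show ?thesis by (rule K.r1_le[OF _ K.card_compl_le[OF C(1) ne]])
      next
        case False
        moreover have "card (vertices K - C) > 0" using W K.fin by (auto simp: card_gt_0_iff)
        ultimately have "card (vertices K - C) = 1" by linarith
        then show ?thesis by simp
      qed
      ultimately have "partial_derivs is (\<lambda>x. P (K, W) x - P (K', W') x) x = 0"
        using xC len by (simp add: vanishing_def)
      then have "partial_derivs is (P (K, W)) x = partial_derivs is (P (K', W')) x"
        unfolding partial_derivs_diff[OF cell(3)[OF KK(1) WX(1)] cell(3)[OF KK(2) WX(2)]] by simp
      then show ?thesis
        using same_cell[OF KK(1) V(1) WX(1) x(1) xT(1) len] same_cell[OF KK(2) V(2) WX(2) x(2) xT(2) len] by simp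
    qed
    define u where "u x = v (SOME K. K \<in> \<T> \<and> x \<in> K) x" for x
    have u: "u x = v K x" if Kx: "K \<in> \<T>" "x \<in> K" for K x
    proof -
      define K' where "K' = (SOME K. K \<in> \<T> \<and> x \<in> K)"
      have "K' \<in> \<T> \<and> x \<in> K'" unfolding K'_def by (rule someI[of "\<lambda>K. K \<in> \<T> \<and> x \<in> K" K]) (use Kx in simp)
      then have K': "K' \<in> \<T>" "x \<in> K'" by auto
      obtain V where V: "V \<in> vertices K" "x \<in> cell_at (K, V)" using cover[OF Kx(1)] Kx(2) by blast
      obtain V' where V': "V' \<in> vertices K'" "x \<in> cell_at (K', V')" using cover[OF K'(1)] K'(2) by blast
      have "v K x = v K' x"
        using agree[OF Kx(1) K'(1) V(1) V'(1) V(2) V'(2), of "[]"] cell(4)[OF Kx(1) V] cell(4)[OF K'(1) V'] by simp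
      then show ?thesis by (simp add: u_def K'_def)
    qed
    have "C_upto (r 1) (\<Union>\<T>) u"
    proof (rule C_upto_piecewise[where I = I and T = cell_at and P = P and k = k])
      have "finite (vertices K)" if "K \<in> \<T>" for K
        using simplex[OF K(1)[OF that]] aff_independent_finite by blast
      then show "finite I" using tri unfolding I_def triangulation_def by blast
      show "(\<Union>i\<in>I. cell_at i) = \<Union>\<T>" 
      proof -
        have "(\<Union>i\<in>I. cell_at i) = (\<Union>K\<in>\<T>. \<Union>V\<in>vertices K. cell_at (K, V))"
          unfolding I_def by blast
        then show ?thesis using cover by simp
      qed
      show "closed (cell_at i)" "P i \<in> polys k" if i: "i \<in> I" for i
      proof -
        obtain K V where KV: "i = (K, V)" "K \<in> \<T>" "V \<in> vertices K" using i by (auto simp: I_def)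
        show "closed (cell_at i)" "P i \<in> polys k" using cell(1,3)[OF KV(2,3)] KV(1) by simp_all
      qed
      show "u x = P i x" if i: "i \<in> I" and x: "x \<in> cell_at i" for i x
      proof -
        obtain K V where KV: "i = (K, V)" "K \<in> \<T>" "V \<in> vertices K" using i by (auto simp: I_def)
        have xc: "x \<in> cell_at (K, V)" using x KV(1) by simp
        then have "x \<in> K" using cell(2)[OF KV(2,3)] by blast
        from u[OF KV(2) this] cell(4)[OF KV(2,3) xc] show ?thesis using KV(1) by simp
      qed
      show "partial_derivs is (P i) x = partial_derivs is (P j) x"
        if i: "i \<in> I" and j: "j \<in> I" and x: "x \<in> cell_at i" "x \<in> cell_at j" and len: "length is \<le> r 1"
        for i j x "is"
      proof -
        obtain K V where KV: "i = (K, V)" "K \<in> \<T>" "V \<in> vertices K" using i by (auto simp: I_def)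
        obtain K' V' where KV': "j = (K', V')" "K' \<in> \<T>" "V' \<in> vertices K'" using j by (auto simp: I_def)
        show ?thesis
          using agree[OF KV(2) KV'(2) KV(3) KV'(3) _ _ len] x unfolding KV(1) KV'(1) by simp
      qed
    qed
    then show "\<exists>u. C_upto (r 1) (\<Union>\<T>) u \<and> (\<forall>K\<in>\<T>. \<forall>x\<in>K. u x = v K x)" using u by blast
  qed
  ultimately show ?thesis by blast
qed

end
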